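(* Let $(G,\tau)$ be a locally compact Hausdorff right topological group that has a compact strong normal system of subgroups. Then $G$ has a right invariant Haar measure, i.e. a non-zero (positive) Radon measure $\mu$ on $G$ such that $\mu(Eg)=\mu(E)$ for all $g\in G$ and all Borel sets $E\subset G$.
   Context: A right topological group is a group $G$ with a topology $\tau$ such that for every $x\in G$ the map $G\to G$, $g\mapsto gx$, is continuous. The $\sigma$-topology on $G$ is the quotient topology on $G$ induced by the map $(G,\tau)\times(G,\tau)\to G$, $(x,y)\mapsto x^{-1}y$; "$\sigma$-closed" means closed in $(G,\sigma)$. For a subgroup $K$, $G/K$ denotes the space of left cosets $\{xK : x\in G\}$ with the quotient topology from $\tau$ (and similarly for quotients of subgroups of $G$ with the subspace topology from $\tau$). A compact strong normal system of subgroups of $G$ is a family $\{L_\xi\}_{\xi\le\xi_0}$ of $\sigma$-closed normal subgroups of $G$, indexed by the ordinals $\xi\le \xi_0$ for some ordinal $\xi_0>0$, such that: (1) $L_0=G$, $L_{\xi_0}=\{e\}$, $L_\xi\supset L_{\xi+1}$ for $\xi<\xi_0$, and $L_\xi=\bigcap_{\eta<\xi}L_\eta$ for every limit ordinal $\xi\le\xi_0$; (2) $G/L_1=L_0/L_1$ is a locally compact Hausdorff topological group, each $L_\xi$ with $1\le \xi\le \xi_0$ is compact (in $\tau$), and $L_\xi/L_{\xi+1}$ is a compact Hausdorff topological group for $1\le\xi<\xi_0$; (3) for each $\xi<\xi_0$ the map $G/L_{\xi+1}\times L_\xi/L_{\xi+1}\to G/L_{\xi+1}$, $([x],[y])\mapsto[xy]$,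 is jointly continuous. *)

theory Defs
  imports "HOL-Analysis.Analysis" "HOL-Algebra.Coset"
begin

section \<open>Quotient topologies\<close>

definition quotient_topology :: "'a topology \<Rightarrow> ('a \<Rightarrow> 'b) \<Rightarrow> 'b topology" where
  "quotient_topology X f =
     topology (\<lambda>V. V \<subseteq> f ` topspace X \<and> openin X {x \<in> topspace X. f x \<in> V})"

lemma openin_quotient_topology:
  "openin (quotient_topology X f) V \<longleftrightarrow>
     V \<subseteq> f ` topspace X \<and> openin X {x \<in> topspace X. f x \<in> V}"
proof -
  have "istopology (\<lambda>V. V \<subseteq> f ` topspace X \<and> openin X {x \<in> topspace X. f x \<in> V})"
    unfolding istopology_def
  proof (intro conjI allI impI)
    fix S T
    assume S: "S \<subseteq> f ` topspace X \<and> openin X {x \<in> topspace X. f x \<in> S}"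
      and T: "T \<subseteq> f ` topspace X \<and> openin X {x \<in> topspace X. f x \<in> T}"
    show "S \<inter> T \<subseteq> f ` topspace X" using S by blast
    have "{x \<in> topspace X. f x \<in> S \<inter> T} =
        {x \<in> topspace X. f x \<in> S} \<inter> {x \<in> topspace X. f x \<in> T}" by blast
    then show "openin X {x \<in> topspace X. f x \<in> S \<inter> T}"
      using S T by (simp add: openin_Int)
  next
    fix \<K>
    assume K: "\<forall>S\<in>\<K>. S \<subseteq> f ` topspace X \<and> openin X {x \<in> topspace X. f x \<in> S}"
    show "\<Union>\<K> \<subseteq> f ` topspace X" using K by blast
    have "{x \<in> topspace X. f x \<in> \<Union>\<K>} = (\<Union>S\<in>\<K>. {x \<in> topspace X. f x \<in> S})" by blast
    moreover have "openin X (\<Union>S\<in>\<K>. {x \<in> topspace X. f x \<in> S})"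
      using K by (intro openin_Union) auto
    ultimately show "openin X {x \<in> topspace X. f x \<in> \<Union>\<K>}" by (simp only:)
  qed
  then show ?thesis
    by (simp add: quotient_topology_def topology_inverse')
qed

lemma topspace_quotient_topology [simp]:
  "topspace (quotient_topology X f) = f ` topspace X"
proof
  show "topspace (quotient_topology X f) \<subseteq> f ` topspace X"
    using openin_topspace [of "quotient_topology X f"] unfolding openin_quotient_topology
    by (rule conjunct1)
  have "{x \<in> topspace X. f x \<in> f ` topspace X} = topspace X" by blast
  then have "openin (quotient_topology X f) (f ` topspace X)"
    by (simp add: openin_quotient_topology)
  then show "f ` topspace X \<subseteq> topspace (quotient_topology X f)"
    by (rule openin_subset)
qed

lemma quotient_map_quotient_topology: "quotient_map X (quotient_topology X f) f"
  unfolding quotient_map_def openin_quotient_topology topspace_quotient_topology by blast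


section \<open>Topological and right topological groups\<close>

definition topological_group :: "('a, 'm) monoid_scheme \<Rightarrow> 'a topology \<Rightarrow> bool" where
  "topological_group G T \<longleftrightarrow>
     group G \<and> topspace T = carrier G \<and>
     continuous_map (prod_topology T T) T (\<lambda>(x, y). x \<otimes>\<^bsub>G\<^esub> y) \<and>
     continuous_map T T (\<lambda>x. inv\<^bsub>G\<^esub> x)"

definition right_topological_group :: "('a, 'm) monoid_scheme \<Rightarrow> 'a topology \<Rightarrow> bool" where
  "right_topological_group G T \<longleftrightarrow>
     group G \<and> topspace T = carrier G \<and>
     (\<forall>x\<in>carrier G. continuous_map T T (\<lambda>g. g \<otimes>\<^bsub>G\<^esub> x))"

definition sigma_topology :: "('a, 'm) monoid_scheme \<Rightarrow> 'a topology \<Rightarrow> 'a topology" where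
  "sigma_topology G T =
     quotient_topology (prod_topology T T) (\<lambda>(x, y). inv\<^bsub>G\<^esub> x \<otimes>\<^bsub>G\<^esub> y)"

text \<open>The space \<open>H/K\<close> of left cosets \<open>xK\<close>, \<open>x \<in> H\<close>, as a quotient of \<open>H\<close> with the subspace
  topology. The underlying group, for \<open>K\<close> normal, is \<open>G\<lparr>carrier := H\<rparr> Mod K\<close>, whose
  elements are right cosets; these are the same sets as the left cosets.\<close>

definition coset_topology ::
  "('a, 'm) monoid_scheme \<Rightarrow> 'a topology \<Rightarrow> 'a set \<Rightarrow> 'a set \<Rightarrow> 'a set topology" where
  "coset_topology G T H K = quotient_topology (subtopology T H) (\<lambda>x. x <#\<^bsub>G\<^esub> K)"


section \<open>Compact strong normal systems\<close>

text \<open>Ordinals are represented by the elements of a well-ordered type. \<open>ord_succ i\<close> is meaningful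
  only if \<open>i\<close> is not the greatest element; it is only applied to elements below some other element.\<close>

definition ord_zero :: "'i::wellorder" where
  "ord_zero = (LEAST i. True)"

definition ord_succ :: "'i::wellorder \<Rightarrow> 'i" where
  "ord_succ i = (LEAST j. i < j)"

definition ord_limit :: "'i::wellorder \<Rightarrow> bool" where
  "ord_limit i \<longleftrightarrow> i \<noteq> ord_zero \<and> (\<forall>j<i. ord_succ j \<noteq> i)"

text \<open>In the joint continuity condition, the product \<open>A <#> B\<close> of cosets is the map
  \<open>([x], [y]) \<mapsto> [xy]\<close>, since \<open>L (ord_succ \<xi>)\<close> is normal.\<close>

definition compact_strong_normal_system ::
  "('a, 'm) monoid_scheme \<Rightarrow> 'a topology \<Rightarrow> 'i::wellorder \<Rightarrow> ('i \<Rightarrow> 'a set) \<Rightarrow> bool" where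
  "compact_strong_normal_system G T \<xi>\<^sub>0 L \<longleftrightarrow>
     ord_zero < \<xi>\<^sub>0 \<and>
     (\<forall>\<xi>\<le>\<xi>\<^sub>0. L \<xi> \<lhd> G \<and> closedin (sigma_topology G T) (L \<xi>)) \<and>
     L ord_zero = carrier G \<and>
     L \<xi>\<^sub>0 = {\<one>\<^bsub>G\<^esub>} \<and>
     (\<forall>\<xi><\<xi>\<^sub>0. L (ord_succ \<xi>) \<subseteq> L \<xi>) \<and>
     (\<forall>\<xi>\<le>\<xi>\<^sub>0. ord_limit \<xi> \<longrightarrow> L \<xi> = (\<Inter>\<eta>\<in>{..<\<xi>}. L \<eta>)) \<and>
     (let L\<^sub>1 = L (ord_succ ord_zero); Q = coset_topology G T (carrier G) L\<^sub>1
      in topological_group (G Mod L\<^sub>1) Q \<and> locally_compact_space Q \<and> Hausdorff_space Q) \<and>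
     (\<forall>\<xi>. ord_succ ord_zero \<le> \<xi> \<and> \<xi> \<le> \<xi>\<^sub>0 \<longrightarrow> compactin T (L \<xi>)) \<and>
     (\<forall>\<xi>. ord_succ ord_zero \<le> \<xi> \<and> \<xi> < \<xi>\<^sub>0 \<longrightarrow>
        (let K = L (ord_succ \<xi>); Q = coset_topology G T (L \<xi>) K
         in topological_group (G\<lparr>carrier := L \<xi>\<rparr> Mod K) Q \<and>
            compact_space Q \<and> Hausdorff_space Q)) \<and>
     (\<forall>\<xi><\<xi>\<^sub>0.
        (let K = L (ord_succ \<xi>)
         in continuous_map
              (prod_topology (coset_topology G T (carrier G) K) (coset_topology G T (L \<xi>) K))
              (coset_topology G T (carrier G) K)
              (\<lambda>(A, B). A <#>\<^bsub>G\<^esub> B)))"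


section \<open>Radon measures and Haar measures\<close>

definition borel_of :: "'a topology \<Rightarrow> 'a measure" where
  "borel_of T = sigma (topspace T) {U. openin T U}"

text \<open>The usual convention on locally compact Hausdorff spaces: outer regularity on all Borel sets,
  inner regularity by compact sets on open sets (not necessarily on all Borel sets, as the
  space need not be \<open>\<sigma>\<close>-compact).\<close>

definition radon_measure :: "'a topology \<Rightarrow> 'a measure \<Rightarrow> bool" where
  "radon_measure T \<mu> \<longleftrightarrow>
     sets \<mu> = sets (borel_of T) \<and>
     (\<forall>K. compactin T K \<longrightarrow> emeasure \<mu> K < \<infinity>) \<and>
     (\<forall>E\<in>sets \<mu>. emeasure \<mu> E = (INF U\<in>{U. openin T U \<and> E \<subseteq> U}. emeasure \<mu> U)) \<and>
     (\<forall>U. openin T U \<longrightarrow> emeasure \<mu> U = (SUP K\<in>{K. compactin T K \<and> K \<subseteq> U}. emeasure \<mu> K))"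

definition right_haar_measure ::
  "('a, 'm) monoid_scheme \<Rightarrow> 'a topology \<Rightarrow> 'a measure \<Rightarrow> bool" where
  "right_haar_measure G T \<mu> \<longleftrightarrow>
     radon_measure T \<mu> \<and> emeasure \<mu> (topspace T) \<noteq> 0 \<and>
     (\<forall>g\<in>carrier G. \<forall>E\<in>sets (borel_of T). emeasure \<mu> (E #>\<^bsub>G\<^esub> g) = emeasure \<mu> E)"

end

theory Submission
  imports Defs
begin

text \<open>One passes from \<open>G/L\<^sub>1\<close> to \<open>G\<close> along the system, and keeps at each level \<open>\<xi>\<close> a right invariant
  positive functional on the compactly supported continuous functions that are constant on the cosets
  of \<open>L\<^sub>\<xi>\<close>. On the locally compact group \<open>G/L\<^sub>1\<close> it comes from Weil's covering numbers. At a successor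
  step one composes with averaging over the cosets of \<open>L\<^sub>\<xi>/L\<^sub>\<xi>\<^sub>+\<^sub>1\<close>: the restriction of a function to such a coset
  is almost periodic by joint continuity, so it has a von Neumann--Maak mean, and the uniqueness of that
  mean makes averaging commute with right translations. At a limit step the functions of lower levels
  are dense. The delicate point is that \<open>G/L\<^sub>\<xi> \<rightarrow> G/L\<^sub>1\<close> stays proper at limits, without which pulling back
  destroys compactness of supports; this follows from Baire's theorem when the cofinality is countable,
  and otherwise from the fact that a decreasing net of reals indexed by an ordinal of uncountable
  cofinality is eventually constant, applied to the functionals already constructed. The functional
  on \<open>C\<^sub>c(G)\<close> finally yields the measure by the construction in the Riesz representation theorem.\<close>

section \<open>Quotients by admissible subgroups\<close>

text \<open>Only right translations are known to be continuous: left translations, inversion and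
  conjugations are not, and a product C N of compact sets need not be compact. This shapes the
  proof. Separation comes from the sigma-topology: N is sigma-closed, so the relation inv x y \<in>
  N is closed in the product, and this gives both Hausdorff quotients and closed sets C N. The
  average over a layer K/N is not integration against a Haar measure but a mean defined on K as an
  abstract group. Conjugation by g need not be continuous on K, yet it maps averages to averages,
  which is enough to commute the mean with right translation by g; continuity enters only to make
  the orbit functions k \<mapsto> f (x k) almost periodic. Functionals live on cones of nonnegative
  functions and are only required to be additive, monotone, invariant and nonzero; scaling by 1/n
  follows from additivity and is all that the limits use.\<close>

lemma compactin_finite_subcover_points:
  assumes "compactin X C" and "\<And>x. x \<in> C \<Longrightarrow> openin X (U x) \<and> x \<in> U x"
  obtains F where "finite F" "F \<subseteq> C" "C \<subseteq> (\<Union>x\<in>F. U x)"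
proof -
  have "\<exists>\<F>. finite \<F> \<and> \<F> \<subseteq> U ` C \<and> C \<subseteq> \<Union>\<F>"
    using assms by (intro compactinD[of X]) auto
  then show thesis
    using that by (metis finite_subset_image)
qed

text \<open>The set where f differs from its value at second coordinate y by less than \<epsilon> is
  open and contains C x {y}, so the tube lemma applies. This turns joint continuity into uniformity
  over a compact set.\<close>

lemma continuous_map_tube:
  fixes f :: "'a \<times> 'b \<Rightarrow> real"
  assumes f: "continuous_map (prod_topology X Y) euclideanreal f"
    and C: "compactin X C" and y: "y \<in> topspace Y" and e: "\<epsilon> > 0"
  obtains V where "openin Y V" "y \<in> V" "\<And>x v. x \<in> C \<Longrightarrow> v \<in> V \<Longrightarrow> \<bar>f (x, v) - f (x, y)\<bar> < \<epsilon>"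
proof -
  have 1: "continuous_map (prod_topology X Y) euclideanreal (\<lambda>p. f p - f (fst p, y))"
  proof (intro continuous_map_diff f)
    have "continuous_map (prod_topology X Y) euclideanreal (f \<circ> (\<lambda>p. (fst p, y)))"
      by (rule continuous_map_compose[OF _ f]) (intro continuous_map_pairedI continuous_map_fst, simp add: y)
    then show "continuous_map (prod_topology X Y) euclideanreal (\<lambda>p. f (fst p, y))"
      by (simp add: o_def)
  qed
  define W where "W = {p \<in> topspace (prod_topology X Y). f p - f (fst p, y) \<in> {-\<epsilon><..<\<epsilon>}}"
  have W: "openin (prod_topology X Y) W"
    unfolding W_def by (rule openin_continuous_map_preimage[OF 1]) auto
  have sub: "C \<times> {y} \<subseteq> W"
    using y e compactin_subset_topspace[OF C] by (auto simp: W_def)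
  obtain U V where "openin X U" "openin Y V" "C \<subseteq> U" "{y} \<subseteq> V" "U \<times> V \<subseteq> W"
    using Wallace_theorem_prod_topology[OF C _ W sub] y by auto
  then show thesis
    using that[of V] by (force simp: W_def abs_less_iff)
qed

text \<open>In a chain a finite intersection is the member of largest index, so nonemptiness of each
  single C \<inter> D i already gives the finite intersection property.\<close>

lemma compact_chain_Inter:
  assumes C: "compactin X C" and I: "I \<noteq> {}"
    and D: "\<And>i. i \<in> I \<Longrightarrow> closedin X (D i) \<and> C \<inter> D i \<noteq> {}"
    and mono: "\<And>i j. i \<in> I \<Longrightarrow> j \<in> I \<Longrightarrow> i \<le> j \<Longrightarrow> D j \<subseteq> D i"
  shows "\<exists>x\<in>C. \<forall>i\<in>(I::'i::linorder set). x \<in> D i"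
proof -
  have "C \<inter> \<Inter>(D ` I) \<noteq> {}"
  proof -
    have "C \<inter> \<Inter>\<F> \<noteq> {}" if F: "finite \<F>" "\<F> \<subseteq> D ` I" for \<F>
    proof -
      obtain J where J: "finite J" "J \<subseteq> I" "\<F> = D ` J"
        using F by (meson finite_subset_image)
      show ?thesis
      proof (cases "J = {}")
        case True
        then show ?thesis using J I D by auto
      next
        case False
        then have "Max J \<in> I" using J by (meson Max_in subsetD)
        moreover have "D (Max J) \<subseteq> D j" if "j \<in> J" for j
          using mono[of j "Max J"] J that calculation by auto
        ultimately show ?thesis using D[of "Max J"] J by blast
      qed
    qed
    then show ?thesis
      using C D unfolding compactin_fip by auto
  qed
  then show ?thesis by auto
qed

section \<open>The setting, and the cones of functions on quotients\<close>

locale lch_right_top_group = group G for G (structure) +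
  fixes T :: "'a topology"
  assumes topspace_T: "topspace T = carrier G"
    and right_cont: "x \<in> carrier G \<Longrightarrow> continuous_map T T (\<lambda>g. g \<otimes> x)"
    and lc: "locally_compact_space T" and haus: "Hausdorff_space T"
begin

definition admissible :: "'a set \<Rightarrow> bool" where
  "admissible N \<longleftrightarrow> N \<lhd> G \<and> closedin (sigma_topology G T) N"

definition coset_space :: "'a set \<Rightarrow> 'a set topology" where
  "coset_space N = coset_topology G T (carrier G) N"

text \<open>\<open>cc N\<close> is the cone of nonnegative functions in \<open>C\<^sub>c(G/N)\<close>, pulled back to \<open>G\<close>;
  values outside the carrier are irrelevant.\<close>

definition cc :: "'a set \<Rightarrow> ('a \<Rightarrow> real) set" where
  "cc N = {f. continuous_map T euclideanreal f \<and> (\<forall>x\<in>carrier G. 0 \<le> f x) \<and>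
     (\<forall>x\<in>carrier G. \<forall>n\<in>N. f (x \<otimes> n) = f x) \<and>
     (\<exists>C. compactin T C \<and> (\<forall>x\<in>carrier G. f x \<noteq> 0 \<longrightarrow> x \<in> C <#> N))}"

lemma admissible_subgroup: "admissible N \<Longrightarrow> subgroup N G"
  by (simp add: admissible_def normal_imp_subgroup)

lemma admissible_subset: "admissible N \<Longrightarrow> n \<in> N \<Longrightarrow> n \<in> carrier G"
  using admissible_subgroup subgroup.mem_carrier by metis

lemma admissible_one: "admissible N \<Longrightarrow> \<one> \<in> N"
  using admissible_subgroup subgroup.one_closed by metis

lemma admissible_conj: "admissible N \<Longrightarrow> n \<in> N \<Longrightarrow> g \<in> carrier G \<Longrightarrow> g \<otimes> n \<otimes> inv g \<in> N"
  by (simp add: admissible_def normal.inv_op_closed2)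

lemma admissible_conj': "admissible N \<Longrightarrow> n \<in> N \<Longrightarrow> g \<in> carrier G \<Longrightarrow> inv g \<otimes> n \<otimes> g \<in> N"
  by (simp add: admissible_def normal.inv_op_closed1)

lemma carrier_compactin: "compactin T C \<Longrightarrow> x \<in> C \<Longrightarrow> x \<in> carrier G"
  using compactin_subset_topspace topspace_T by blast

lemma carrier_openin: "openin T C \<Longrightarrow> x \<in> C \<Longrightarrow> x \<in> carrier G"
  using openin_subset topspace_T by blast

section \<open>Translates, and products with an admissible subgroup\<close>

lemma openin_r_coset:
  assumes U: "openin T U" and g: "g \<in> carrier G"
  shows "openin T (U #> g)"
proof -
  have "U #> g = {x \<in> topspace T. x \<otimes> inv g \<in> U}"
  proof (intro subset_antisym subsetI)
    fix x assume "x \<in> U #> g"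
    then show "x \<in> {x \<in> topspace T. x \<otimes> inv g \<in> U}"
      using g carrier_openin[OF U] by (auto simp: r_coset_def topspace_T m_assoc)
  next
    fix x assume "x \<in> {x \<in> topspace T. x \<otimes> inv g \<in> U}"
    then show "x \<in> U #> g"
      using g by (auto simp: r_coset_def topspace_T m_assoc intro!: bexI[of _ "x \<otimes> inv g"])
  qed
  then show ?thesis
    using openin_continuous_map_preimage[OF right_cont U, of "inv g"] g by simp
qed

lemma compactin_r_coset:
  assumes "compactin T C" and "g \<in> carrier G"
  shows "compactin T (C #> g)"
proof -
  have "C #> g = (\<lambda>x. x \<otimes> g) ` C" by (auto simp: r_coset_def)
  then show ?thesis using image_compactin[OF assms(1) right_cont[OF assms(2)]] by simp
qed

text \<open>U N is the union of the right translates U n, so continuity of right translations is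
  enough.\<close>

lemma openin_set_mult:
  assumes "openin T U" and "N \<subseteq> carrier G"
  shows "openin T (U <#> N)"
proof -
  have "U <#> N = (\<Union>n\<in>N. U #> n)" by (auto simp: set_mult_def r_coset_def)
  then show ?thesis using assms openin_r_coset by (auto intro!: openin_Union)
qed

text \<open>The sigma-topology is a quotient topology, so sigma-closedness of N is closedness of its
  preimage under (x, y) \<mapsto> inv x y. All separation in the quotients comes from this.\<close>

lemma closedin_relation:
  assumes "admissible N"
  shows "closedin (prod_topology T T) {(x, y). x \<in> carrier G \<and> y \<in> carrier G \<and> inv x \<otimes> y \<in> N}"
proof -
  have "closedin (quotient_topology (prod_topology T T) (\<lambda>(x, y). inv x \<otimes> y)) N"
    using assms by (simp add: admissible_def sigma_topology_def)
  moreover have "{z \<in> topspace (prod_topology T T). (\<lambda>(x, y). inv x \<otimes> y) z \<in> N} =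
      {(x, y). x \<in> carrier G \<and> y \<in> carrier G \<and> inv x \<otimes> y \<in> N}"
    by (auto simp: topspace_T)
  ultimately show ?thesis
    using closedin_continuous_map_preimage[OF quotient_imp_continuous_map[OF quotient_map_quotient_topology],
      of "prod_topology T T" "\<lambda>(x, y). inv x \<otimes> y" N] by simp
qed

lemma set_mult_mem_iff:
  assumes N: "admissible N" and C: "C \<subseteq> carrier G" and y: "y \<in> carrier G"
  shows "y \<in> C <#> N \<longleftrightarrow> (\<exists>x\<in>C. inv x \<otimes> y \<in> N)"
proof
  assume "y \<in> C <#> N"
  then obtain c n where c: "c \<in> C" "n \<in> N" "y = c \<otimes> n" by (auto simp: set_mult_def)
  then have "inv c \<otimes> y = n"
    using C admissible_subset[OF N] by (simp add: subset_iff flip: m_assoc)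
  then show "\<exists>x\<in>C. inv x \<otimes> y \<in> N" using c(1,2) by (intro bexI[of _ c]) auto
next
  assume "\<exists>x\<in>C. inv x \<otimes> y \<in> N"
  then obtain x where x: "x \<in> C" "inv x \<otimes> y \<in> N" by auto
  then have "y = x \<otimes> (inv x \<otimes> y)" using C y by (simp add: subset_iff flip: m_assoc)
  then show "y \<in> C <#> N" using x by (auto simp: set_mult_def)
qed

text \<open>C N is the projection of the part of the closed relation that lies over C, and
  projection along a compact factor is a closed map. Compactness of C N is not claimed.\<close>

lemma closedin_compact_set_mult:
  assumes N: "admissible N" and C: "compactin T C"
  shows "closedin T (C <#> N)"
proof -
  define R where "R = {(x, y). x \<in> carrier G \<and> y \<in> carrier G \<and> inv x \<otimes> y \<in> N}"
  have Cs: "C \<subseteq> carrier G" using carrier_compactin[OF C] by auto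
  have "closedin (prod_topology T T) R" using closedin_relation[OF N] by (simp add: R_def)
  then have "closedin (subtopology (prod_topology T T) (C \<times> carrier G)) ((C \<times> carrier G) \<inter> R)"
    by (rule closedin_subtopology_Int_closed)
  then have "closedin (prod_topology (subtopology T C) T) ((C \<times> carrier G) \<inter> R)"
    by (metis subtopology_Times subtopology_topspace topspace_T)
  moreover have "closed_map (prod_topology (subtopology T C) T) T snd"
    by (rule closed_map_snd) (use C in \<open>simp add: compactin_subspace\<close>)
  ultimately have "closedin T (snd ` ((C \<times> carrier G) \<inter> R))"
    by (simp add: closed_map_def)
  moreover have "snd ` ((C \<times> carrier G) \<inter> R) = C <#> N"
  proof (intro subset_antisym subsetI)
    fix y assume "y \<in> snd ` ((C \<times> carrier G) \<inter> R)"
    then obtain x where "x \<in> C" "y \<in> carrier G" "inv x \<otimes> y \<in> N" by (auto simp: R_def)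
    then show "y \<in> C <#> N" using set_mult_mem_iff[OF N Cs] by auto
  next
    fix y assume y: "y \<in> C <#> N"
    then have "y \<in> carrier G"
      using Cs admissible_subset[OF N] by (auto simp: set_mult_def)
    moreover obtain x where "x \<in> C" "inv x \<otimes> y \<in> N"
      using y set_mult_mem_iff[OF N Cs] calculation by auto
    ultimately show "y \<in> snd ` ((C \<times> carrier G) \<inter> R)"
      using Cs by (force simp: R_def)
  qed
  ultimately show ?thesis by simp
qed

lemma set_mult_closed_right:
  assumes N: "admissible N" and C: "C \<subseteq> carrier G" and "x \<in> C <#> N" and "n \<in> N"
  shows "x \<otimes> n \<in> C <#> N"
proof -
  obtain c m where c: "c \<in> C" "m \<in> N" "x = c \<otimes> m" using assms(3) by (auto simp: set_mult_def)
  then have "x \<otimes> n = c \<otimes> (m \<otimes> n)" "m \<otimes> n \<in> N"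
    using C admissible_subset[OF N] assms(4) subgroup.m_closed[OF admissible_subgroup[OF N]]
    by (auto simp: m_assoc subset_iff)
  then show ?thesis using c by (auto simp: set_mult_def)
qed

lemma set_mult_right_imp:
  assumes N: "admissible N" and C: "C \<subseteq> carrier G" and "x \<otimes> n \<in> C <#> N" and "n \<in> N" "x \<in> carrier G"
  shows "x \<in> C <#> N"
proof -
  have "inv n \<in> N" by (simp add: assms(4) N admissible_subgroup subgroup.m_inv_closed)
  then have "x \<otimes> n \<otimes> inv n \<in> C <#> N" using set_mult_closed_right[OF N C assms(3)] by auto
  then show ?thesis using assms admissible_subset[OF N assms(4)] by (simp add: m_assoc)
qed

lemma subset_set_mult: "admissible N \<Longrightarrow> C \<subseteq> carrier G \<Longrightarrow> C \<subseteq> C <#> N"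
proof
  fix x assume "admissible N" "C \<subseteq> carrier G" "x \<in> C"
  then have "x = x \<otimes> \<one>" "\<one> \<in> N" by (auto simp: admissible_one subset_iff)
  then show "x \<in> C <#> N" using \<open>x \<in> C\<close> by (auto simp: set_mult_def)
qed

lemma set_mult_subset_carrier: "admissible N \<Longrightarrow> C \<subseteq> carrier G \<Longrightarrow> C <#> N \<subseteq> carrier G"
  using admissible_subset by (auto simp: set_mult_def)

text \<open>The elements inv (c inv g) x and inv c (x g) are conjugate by g, so normality puts both
  or neither into N.\<close>

lemma set_mult_translate:
  assumes N: "admissible N" and C: "C \<subseteq> carrier G" and g: "g \<in> carrier G" and x: "x \<in> carrier G"
  shows "x \<otimes> g \<in> C <#> N \<longleftrightarrow> x \<in> (C #> inv g) <#> N"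
proof -
  have Cg: "C #> inv g \<subseteq> carrier G" using C g by (auto simp: r_coset_def)
  have *: "inv (c \<otimes> inv g) \<otimes> x \<in> N \<longleftrightarrow> inv c \<otimes> (x \<otimes> g) \<in> N" if c: "c \<in> C" for c
  proof -
    have cc: "c \<in> carrier G" using c C by auto
    have 1: "inv (c \<otimes> inv g) \<otimes> x = g \<otimes> (inv c \<otimes> (x \<otimes> g)) \<otimes> inv g"
      using cc g x by (simp add: inv_mult_group m_assoc)
    have 2: "inv c \<otimes> (x \<otimes> g) = inv g \<otimes> (inv (c \<otimes> inv g) \<otimes> x) \<otimes> g"
      using cc g x by (simp add: inv_mult_group m_assoc) (simp flip: m_assoc)
    show ?thesis using 1 2 admissible_conj[OF N _ g] admissible_conj'[OF N _ g] by metis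
  qed
  show ?thesis
    unfolding set_mult_mem_iff[OF N C m_closed[OF x g]] set_mult_mem_iff[OF N Cg x]
    using * by (auto simp: r_coset_def)
qed

section \<open>Closure properties of the cone \<open>cc N\<close>\<close>

lemma
  assumes "f \<in> cc N"
  shows cc_cont: "continuous_map T euclideanreal f"
    and cc_nonneg: "x \<in> carrier G \<Longrightarrow> 0 \<le> f x"
    and cc_inv: "x \<in> carrier G \<Longrightarrow> n \<in> N \<Longrightarrow> f (x \<otimes> n) = f x"
  using assms by (auto simp: cc_def)

lemma cc_supp:
  assumes "f \<in> cc N"
  obtains C where "compactin T C" "\<And>x. x \<in> carrier G \<Longrightarrow> f x \<noteq> 0 \<Longrightarrow> x \<in> C <#> N"
  using assms by (auto simp: cc_def)

lemma ccI:
  assumes "continuous_map T euclideanreal f" "\<And>x. x \<in> carrier G \<Longrightarrow> 0 \<le> f x"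
    "\<And>x n. x \<in> carrier G \<Longrightarrow> n \<in> N \<Longrightarrow> f (x \<otimes> n) = f x"
    "compactin T C" "\<And>x. x \<in> carrier G \<Longrightarrow> f x \<noteq> 0 \<Longrightarrow> x \<in> C <#> N"
  shows "f \<in> cc N"
  using assms by (auto simp: cc_def)

lemma cc_dominated:
  assumes g: "g \<in> cc N" and "continuous_map T euclideanreal f" "\<And>x. x \<in> carrier G \<Longrightarrow> 0 \<le> f x"
    "\<And>x n. x \<in> carrier G \<Longrightarrow> n \<in> N \<Longrightarrow> f (x \<otimes> n) = f x"
    "\<And>x. x \<in> carrier G \<Longrightarrow> g x = 0 \<Longrightarrow> f x = 0"
  shows "f \<in> cc N"
  using assms by (metis cc_supp ccI)

lemma cc_add:
  assumes f: "f \<in> cc N" and g: "g \<in> cc N"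
  shows "(\<lambda>x. f x + g x) \<in> cc N"
proof -
  obtain C where C: "compactin T C" "\<And>x. x \<in> carrier G \<Longrightarrow> f x \<noteq> 0 \<Longrightarrow> x \<in> C <#> N"
    using cc_supp[OF f] by blast
  obtain D where D: "compactin T D" "\<And>x. x \<in> carrier G \<Longrightarrow> g x \<noteq> 0 \<Longrightarrow> x \<in> D <#> N"
    using cc_supp[OF g] by blast
  show ?thesis
  proof (rule ccI[of _ _ "C \<union> D"])
    show "compactin T (C \<union> D)" using C D by (simp add: compactin_Un)
    show "x \<in> (C \<union> D) <#> N" if "x \<in> carrier G" "f x + g x \<noteq> 0" for x
    proof -
      have "f x \<noteq> 0 \<or> g x \<noteq> 0" using that by auto
      then show ?thesis using C(2)[OF that(1)] D(2)[OF that(1)] by (fastforce simp: set_mult_def)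
    qed
  qed (use f g in \<open>auto simp: cc_cont cc_nonneg cc_inv intro!: continuous_map_add\<close>)
qed

lemma cc_scale:
  assumes f: "f \<in> cc N" and c: "c \<ge> 0"
  shows "(\<lambda>x. c * f x) \<in> cc N"
  by (rule cc_dominated[OF f]) (use f c in \<open>auto simp: cc_cont cc_nonneg cc_inv intro!: continuous_map_real_mult\<close>)

lemma cc_sum_list:
  assumes "h \<in> cc N" and "\<And>i. i \<in> set is \<Longrightarrow> f i \<in> cc N"
  shows "(\<lambda>x. \<Sum>i\<leftarrow>is. f i x) \<in> cc N"
  using assms(2)
proof (induction "is")
  case Nil
  show ?case using cc_scale[OF assms(1), of 0] by simp
next
  case (Cons i "is")
  then have "f i \<in> cc N" "(\<lambda>x. \<Sum>i\<leftarrow>is. f i x) \<in> cc N" by auto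
  then show ?case using cc_add by simp
qed

lemma cc_min:
  assumes f: "f \<in> cc N" and g: "g \<in> cc N"
  shows "(\<lambda>x. min (f x) (g x)) \<in> cc N"
  by (rule cc_dominated[OF f]) (use f g in \<open>auto simp: cc_cont cc_nonneg cc_inv min_def intro!: continuous_map_real_min[unfolded min_def]\<close>)

lemma cc_translate:
  assumes N: "admissible N" and f: "f \<in> cc N" and g: "g \<in> carrier G"
  shows "(\<lambda>x. f (x \<otimes> g)) \<in> cc N"
proof -
  obtain C where C: "compactin T C" "\<And>x. x \<in> carrier G \<Longrightarrow> f x \<noteq> 0 \<Longrightarrow> x \<in> C <#> N"
    using cc_supp[OF f] by blast
  have Cs: "C \<subseteq> carrier G" using carrier_compactin[OF C(1)] by auto
  show ?thesis
  proof (rule ccI[of _ _ "C #> inv g"])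
    show "continuous_map T euclideanreal (\<lambda>x. f (x \<otimes> g))"
      using continuous_map_compose[OF right_cont[OF g] cc_cont[OF f]] by (simp add: o_def)
    show "compactin T (C #> inv g)" using C g by (simp add: compactin_r_coset)
    show "x \<in> (C #> inv g) <#> N" if "x \<in> carrier G" "f (x \<otimes> g) \<noteq> 0" for x
      using C(2)[of "x \<otimes> g"] that g set_mult_translate[OF N Cs g] by auto
    show "f (x \<otimes> n \<otimes> g) = f (x \<otimes> g)" if "x \<in> carrier G" "n \<in> N" for x n
    proof -
      have nc: "n \<in> carrier G" using that admissible_subset[OF N] by auto
      have "x \<otimes> n \<otimes> g = x \<otimes> g \<otimes> (inv g \<otimes> n \<otimes> g)"
        using that g nc by (simp add: m_assoc) (simp flip: m_assoc)
      then show ?thesis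
        using cc_inv[OF f, of "x \<otimes> g"] admissible_conj'[OF N _ g] that g by simp
    qed
  qed (use g f in \<open>auto simp: cc_nonneg\<close>)
qed

text \<open>By N-invariance the values on C N are those on the compact set C.\<close>

lemma cc_bounded:
  assumes N: "admissible N" and f: "f \<in> cc N"
  obtains B where "B > 0" "\<And>x. x \<in> carrier G \<Longrightarrow> f x \<le> B"
proof -
  obtain C where C: "compactin T C" "\<And>x. x \<in> carrier G \<Longrightarrow> f x \<noteq> 0 \<Longrightarrow> x \<in> C <#> N"
    using cc_supp[OF f] by blast
  have "compactin euclideanreal (f ` C)" using image_compactin[OF C(1) cc_cont[OF f]] .
  then have "bounded (f ` C)" by (simp add: compact_imp_bounded)
  then obtain B where B: "B > 0" "\<forall>y\<in>f ` C. norm y \<le> B" unfolding bounded_pos by auto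
  show thesis
  proof (rule that[OF B(1)])
    fix x assume x: "x \<in> carrier G"
    show "f x \<le> B"
    proof (cases "f x = 0")
      case False
      then obtain c n where c: "c \<in> C" "n \<in> N" "x = c \<otimes> n" using C(2)[OF x] by (auto simp: set_mult_def)
      then have "f x = f c" using cc_inv[OF f] carrier_compactin[OF C(1)] by auto
      then show ?thesis using B c by auto
    qed (use B in auto)
  qed
qed

section \<open>The topology of the coset space\<close>

lemma l_coset_eq_iff:
  assumes N: "admissible N" and "x \<in> carrier G" "y \<in> carrier G"
  shows "x <#\<^bsub>G\<^esub> N = y <#\<^bsub>G\<^esub> N \<longleftrightarrow> inv x \<otimes> y \<in> N"
proof
  have sub: "subgroup N G" using admissible_subgroup[OF N] .
  assume "x <#\<^bsub>G\<^esub> N = y <#\<^bsub>G\<^esub> N"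
  then have "y \<in> x <#\<^bsub>G\<^esub> N"
    using assms(3) admissible_one[OF N] by (force simp: l_coset_def)
  then obtain n where "n \<in> N" "y = x \<otimes> n" by (auto simp: l_coset_def)
  then show "inv x \<otimes> y \<in> N" using assms admissible_subset[OF N] by (simp flip: m_assoc)
next
  assume a: "inv x \<otimes> y \<in> N"
  have "y = x \<otimes> (inv x \<otimes> y)" using assms by (simp flip: m_assoc)
  then have "y \<in> x <#\<^bsub>G\<^esub> N" using a by (force simp: l_coset_def)
  then show "x <#\<^bsub>G\<^esub> N = y <#\<^bsub>G\<^esub> N"
    using assms l_repr_independence admissible_subgroup by metis
qed

lemma quotient_map_coset: "quotient_map T (coset_space N) (\<lambda>x. x <#\<^bsub>G\<^esub> N)"
  unfolding coset_space_def coset_topology_def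
  by (metis quotient_map_quotient_topology subtopology_topspace topspace_T)

lemma topspace_coset_space: "topspace (coset_space N) = (\<lambda>x. x <#\<^bsub>G\<^esub> N) ` carrier G"
  using quotient_imp_surjective_map[OF quotient_map_coset] topspace_T by metis

text \<open>The saturation of an open U is U N, which is open by
  \<open>openin_set_mult\<close>.\<close>

lemma open_map_coset:
  assumes N: "admissible N"
  shows "open_map T (coset_space N) (\<lambda>x. x <#\<^bsub>G\<^esub> N)"
  unfolding open_map_def
proof (intro allI impI)
  fix U assume U: "openin T U"
  have "{x \<in> topspace T. x <#\<^bsub>G\<^esub> N \<in> (\<lambda>x. x <#\<^bsub>G\<^esub> N) ` U} = U <#> N"
    using set_mult_mem_iff[OF N, of U] carrier_openin[OF U] l_coset_eq_iff[OF N]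
      set_mult_subset_carrier[OF N, of U]
    by (auto simp: topspace_T image_iff subset_iff) metis+
  moreover have "openin T (U <#> N)" using U openin_set_mult admissible_subset[OF N] by blast
  moreover have "(\<lambda>x. x <#\<^bsub>G\<^esub> N) ` U \<subseteq> topspace (coset_space N)"
    using carrier_openin[OF U] by (auto simp: topspace_coset_space)
  ultimately show "openin (coset_space N) ((\<lambda>x. x <#\<^bsub>G\<^esub> N) ` U)"
    using quotient_map_coset[of N] unfolding quotient_map_def by auto
qed

lemma locally_compact_coset_space: "admissible N \<Longrightarrow> locally_compact_space (coset_space N)"
  using locally_compact_space_continuous_open_map_image[OF quotient_imp_continuous_map[OF quotient_map_coset]
      open_map_coset] lc quotient_imp_surjective_map[OF quotient_map_coset] by blast

text \<open>For an open quotient map a closed relation separates points: an open box around (x, y)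
  that misses the relation has disjoint open images.\<close>

lemma Hausdorff_coset_space:
  assumes N: "admissible N"
  shows "Hausdorff_space (coset_space N)"
  unfolding Hausdorff_space_def
proof (intro allI impI)
  fix p q assume "p \<in> topspace (coset_space N) \<and> q \<in> topspace (coset_space N) \<and> p \<noteq> q"
  then obtain x y where xy: "x \<in> carrier G" "y \<in> carrier G" "p = x <#\<^bsub>G\<^esub> N" "q = y <#\<^bsub>G\<^esub> N" "p \<noteq> q"
    by (auto simp: topspace_coset_space)
  define R where "R = {(x, y). x \<in> carrier G \<and> y \<in> carrier G \<and> inv x \<otimes> y \<in> N}"
  have "openin (prod_topology T T) (topspace (prod_topology T T) - R)"
    using closedin_relation[OF N] by (simp add: R_def closedin_def)
  moreover have "(x, y) \<in> topspace (prod_topology T T) - R"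
    using xy l_coset_eq_iff[OF N] by (auto simp: R_def topspace_T)
  ultimately obtain U V where UV: "openin T U" "openin T V" "x \<in> U" "y \<in> V"
      "U \<times> V \<subseteq> topspace (prod_topology T T) - R"
    unfolding openin_prod_topology_alt by meson
  show "\<exists>U V. openin (coset_space N) U \<and> openin (coset_space N) V \<and> p \<in> U \<and> q \<in> V \<and> disjnt U V"
  proof (intro exI conjI)
    show "openin (coset_space N) ((\<lambda>x. x <#\<^bsub>G\<^esub> N) ` U)" "openin (coset_space N) ((\<lambda>x. x <#\<^bsub>G\<^esub> N) ` V)"
      using open_map_coset[OF N] UV by (auto simp: open_map_def)
    show "p \<in> (\<lambda>x. x <#\<^bsub>G\<^esub> N) ` U" "q \<in> (\<lambda>x. x <#\<^bsub>G\<^esub> N) ` V" using xy UV by auto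
    have "u <#\<^bsub>G\<^esub> N \<noteq> v <#\<^bsub>G\<^esub> N" if "u \<in> U" "v \<in> V" for u v
    proof -
      have "u \<in> carrier G" "v \<in> carrier G" "(u, v) \<notin> R"
        using that UV(5) carrier_openin[OF UV(1)] carrier_openin[OF UV(2)] by auto
      then show ?thesis using l_coset_eq_iff[OF N, of u v] by (simp add: R_def)
    qed
    then show "disjnt ((\<lambda>x. x <#\<^bsub>G\<^esub> N) ` U) ((\<lambda>x. x <#\<^bsub>G\<^esub> N) ` V)" by (auto simp: disjnt_iff)
  qed
qed

text \<open>Each point of K lies in the open image of an open set that is contained in a compact
  one. Finitely many of these images cover K, and C is the union of the compact sets. This lifting
  allows supports to be described by compact subsets of G.\<close>

lemma compactin_coset_space_lift:
  assumes N: "admissible N" and K: "compactin (coset_space N) K"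
  obtains C where "compactin T C" "K \<subseteq> (\<lambda>x. x <#\<^bsub>G\<^esub> N) ` C"
proof -
  obtain U D where UD: "\<And>x. x \<in> carrier G \<Longrightarrow> openin T (U x) \<and> compactin T (D x) \<and> x \<in> U x \<and> U x \<subseteq> D x"
    using lc unfolding locally_compact_space_def topspace_T by metis
  have "\<forall>k\<in>K. \<exists>x\<in>carrier G. k = x <#\<^bsub>G\<^esub> N"
    using compactin_subset_topspace[OF K] by (auto simp: topspace_coset_space)
  then obtain r where r: "\<And>k. k \<in> K \<Longrightarrow> r k \<in> carrier G \<and> k = r k <#\<^bsub>G\<^esub> N" by metis
  obtain F where F: "finite F" "F \<subseteq> K" "K \<subseteq> (\<Union>k\<in>F. (\<lambda>x. x <#\<^bsub>G\<^esub> N) ` U (r k))"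
  proof (rule compactin_finite_subcover_points[OF K, of "\<lambda>k. (\<lambda>x. x <#\<^bsub>G\<^esub> N) ` U (r k)"])
    fix k assume "k \<in> K"
    then have k: "openin T (U (r k))" "r k \<in> U (r k)" "k = r k <#\<^bsub>G\<^esub> N" using r UD by auto
    show "openin (coset_space N) ((\<lambda>x. x <#\<^bsub>G\<^esub> N) ` U (r k)) \<and> k \<in> (\<lambda>x. x <#\<^bsub>G\<^esub> N) ` U (r k)"
      using open_map_coset[OF N] k(1) imageI[OF k(2), of "\<lambda>x. x <#\<^bsub>G\<^esub> N"] k(3) by (simp add: open_map_def)
  qed auto
  show thesis
  proof (rule that[of "\<Union>k\<in>F. D (r k)"])
    show "compactin T (\<Union>k\<in>F. D (r k))"
      using F r UD by (intro compactin_Union) auto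
    show "K \<subseteq> (\<lambda>x. x <#\<^bsub>G\<^esub> N) ` (\<Union>k\<in>F. D (r k))"
    proof
      fix k assume "k \<in> K"
      then obtain j where j: "j \<in> F" "k \<in> (\<lambda>x. x <#\<^bsub>G\<^esub> N) ` U (r j)" using F by auto
      then have "U (r j) \<subseteq> D (r j)" using F r UD by blast
      then show "k \<in> (\<lambda>x. x <#\<^bsub>G\<^esub> N) ` (\<Union>k\<in>F. D (r k))" using j by auto
    qed
  qed
qed

section \<open>Passing functions to the coset space and back\<close>

lemma cc_factor:
  assumes N: "admissible N" and f: "continuous_map T euclideanreal f"
    "\<And>x n. x \<in> carrier G \<Longrightarrow> n \<in> N \<Longrightarrow> f (x \<otimes> n) = f x"
  obtains F where "continuous_map (coset_space N) euclideanreal F" "\<And>x. x \<in> carrier G \<Longrightarrow> F (x <#\<^bsub>G\<^esub> N) = f x"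
proof -
  have "f x = f y" if xy: "x \<in> topspace T" "y \<in> topspace T" "x <#\<^bsub>G\<^esub> N = y <#\<^bsub>G\<^esub> N" for x y
  proof -
    have "inv x \<otimes> y \<in> N" "y = x \<otimes> (inv x \<otimes> y)"
      using xy l_coset_eq_iff[OF N] by (auto simp: topspace_T simp flip: m_assoc)
    then show ?thesis using f(2) xy by (metis topspace_T)
  qed
  then obtain F where "continuous_map (coset_space N) euclideanreal F"
     "\<And>x. x \<in> topspace T \<Longrightarrow> F (x <#\<^bsub>G\<^esub> N) = f x"
    using quotient_map_lift_exists[OF quotient_map_coset f(1)] by metis
  then show thesis using that topspace_T by auto
qed

text \<open>Urysohn's lemma is applied in the locally compact Hausdorff space G/N, between the
  images of C and of the saturated set U, and the result is pulled back. The set \<open>D\<close>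
  lifts a compact set of cosets containing the support, and it stays inside U because U is
  saturated.\<close>

lemma urysohn_cc:
  assumes N: "admissible N" and C: "compactin T C" and U: "openin T U" and CU: "C \<subseteq> U"
    and sat: "\<And>x n. x \<in> U \<Longrightarrow> n \<in> N \<Longrightarrow> x \<otimes> n \<in> U"
  obtains f D where "f \<in> cc N" "\<And>x. x \<in> carrier G \<Longrightarrow> f x \<le> 1" "\<And>x. x \<in> C \<Longrightarrow> f x = 1"
    "compactin T D" "D \<subseteq> U" "\<And>x. x \<in> carrier G \<Longrightarrow> f x \<noteq> 0 \<Longrightarrow> x \<in> D <#> N"
proof -
  let ?q = "\<lambda>x. x <#\<^bsub>G\<^esub> N" and ?Q = "coset_space N"
  have lcQ: "locally_compact_space ?Q" and hQ: "Hausdorff_space ?Q"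
    using locally_compact_coset_space[OF N] Hausdorff_coset_space[OF N] by auto
  have regQ: "regular_space ?Q" using lcQ hQ by (simp add: locally_compact_Hausdorff_imp_regular_space)
  have cq: "continuous_map T ?Q ?q" by (rule quotient_imp_continuous_map[OF quotient_map_coset])
  have qC: "compactin ?Q (?q ` C)" using image_compactin[OF C cq] .
  have qU: "openin ?Q (?q ` U)" using open_map_coset[OF N] U by (simp add: open_map_def)
  have "locally_compact_space (subtopology ?Q (?q ` U))"
    using lcQ regQ qU by (simp add: locally_compact_space_open_subset)
  moreover have "compactin (subtopology ?Q (?q ` U)) (?q ` C)"
    using qC CU by (auto simp: compactin_subtopology)
  ultimately obtain O' L where OL: "openin (subtopology ?Q (?q ` U)) O'" "compactin (subtopology ?Q (?q ` U)) L"
      "?q ` C \<subseteq> O'" "O' \<subseteq> L"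
    using locally_compact_space_compact_closed_compact[of "subtopology ?Q (?q ` U)"] hQ
    by (metis Hausdorff_space_subtopology)
  have O: "openin ?Q O'" using OL(1) qU openin_open_subtopology by blast
  have L: "compactin ?Q L" "L \<subseteq> ?q ` U" using OL(2) by (auto simp: compactin_subtopology)
  have disj: "disjnt (?q ` C) (topspace ?Q - O')" using OL(3) by (auto simp: disjnt_iff)
  obtain F where F: "continuous_map ?Q (subtopology euclidean {0..1::real}) F"
      "F ` (topspace ?Q - O') \<subseteq> {0}" "F ` (?q ` C) \<subseteq> {1}"
    by (rule Urysohn_completely_regular_compact_closed[of 0 1 ?Q, OF _ _ qC _ disj])
      (use locally_compact_regular_imp_completely_regular_space[OF lcQ] regQ O in auto)
  obtain D0 where D0: "compactin T D0" "L \<subseteq> ?q ` D0"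
    using compactin_coset_space_lift[OF N L(1)] .
  define D where "D = {x \<in> topspace T. x <#\<^bsub>G\<^esub> N \<in> L} \<inter> D0"
  have Fc: "continuous_map ?Q euclideanreal F" and F01: "\<And>p. p \<in> topspace ?Q \<Longrightarrow> 0 \<le> F p \<and> F p \<le> 1"
    using F(1) by (auto simp: continuous_map_in_subtopology Pi_iff)
  have qtop: "x <#\<^bsub>G\<^esub> N \<in> topspace ?Q" if "x \<in> carrier G" for x using that by (auto simp: topspace_coset_space)
  have D: "compactin T D"
  proof -
    have "closedin ?Q L" using L(1) hQ compactin_imp_closedin by blast
    then have "closedin T {x \<in> topspace T. x <#\<^bsub>G\<^esub> N \<in> L}" using closedin_continuous_map_preimage[OF cq] by blast
    then show ?thesis unfolding D_def using D0(1) closed_Int_compactin by blast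
  qed
  have DU: "D \<subseteq> U"
  proof
    fix x assume "x \<in> D"
    then have x: "x \<in> carrier G" "x <#\<^bsub>G\<^esub> N \<in> L" by (auto simp: D_def topspace_T)
    then obtain u where u: "u \<in> U" "u <#\<^bsub>G\<^esub> N = x <#\<^bsub>G\<^esub> N" using L(2) by auto
    then have "inv u \<otimes> x \<in> N" "x = u \<otimes> (inv u \<otimes> x)"
      using x carrier_openin[OF U] l_coset_eq_iff[OF N] by (auto simp flip: m_assoc)
    then show "x \<in> U" using sat[OF u(1)] by metis
  qed
  have supp: "x \<in> D <#> N" if x: "x \<in> carrier G" and nz: "F (x <#\<^bsub>G\<^esub> N) \<noteq> 0" for x
  proof -
    have "x <#\<^bsub>G\<^esub> N \<in> O'" using nz F(2) qtop[OF x] by blast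
    then have xL: "x <#\<^bsub>G\<^esub> N \<in> L" using OL(4) by auto
    then obtain d where d: "d \<in> D0" "x <#\<^bsub>G\<^esub> N = d <#\<^bsub>G\<^esub> N" using D0 by auto
    then have "d \<in> D" using xL carrier_compactin[OF D0(1)] by (auto simp: D_def topspace_T)
    moreover have "inv d \<otimes> x \<in> N" using d x l_coset_eq_iff[OF N, of d x] carrier_compactin[OF D0(1)] by auto
    ultimately show ?thesis
      using set_mult_mem_iff[OF N _ x, of D] carrier_compactin[OF D] by auto
  qed
  show thesis
  proof (rule that[of "\<lambda>x. F (x <#\<^bsub>G\<^esub> N)" D])
    show "(\<lambda>x. F (x <#\<^bsub>G\<^esub> N)) \<in> cc N"
    proof (rule ccI[OF _ _ _ D supp])
      show "continuous_map T euclideanreal (\<lambda>x. F (x <#\<^bsub>G\<^esub> N))"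
        using continuous_map_compose[OF cq Fc] by (simp add: o_def)
      show "F ((x \<otimes> n) <#\<^bsub>G\<^esub> N) = F (x <#\<^bsub>G\<^esub> N)" if "x \<in> carrier G" "n \<in> N" for x n
        using l_coset_eq_iff[OF N, of x "x \<otimes> n"] that admissible_subset[OF N]
        by (simp flip: m_assoc)
    qed (use F01 qtop in auto)
    show "F (x <#\<^bsub>G\<^esub> N) = 1" if "x \<in> C" for x using F(3) that by auto
  qed (use F01 qtop supp D DU in auto)
qed

lemma cc_positive_set:
  assumes "f \<in> cc N"
  shows "openin T {x \<in> carrier G. f x > c}"
  using openin_continuous_map_preimage[OF cc_cont[OF assms], of "{c<..}"] by (simp add: topspace_T)

text \<open>At each point of C some member of a finite family of translates of v exceeds a fixed d >
  0, and N-invariance carries this over to C N. Repeating the family often enough beats the bound B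
  of f.\<close>

lemma cc_covered:
  assumes N: "admissible N" and f: "f \<in> cc N" and v: "v \<in> cc N" and x0: "x0 \<in> carrier G" "v x0 > 0"
  obtains gs where "set gs \<subseteq> carrier G" "\<And>x. x \<in> carrier G \<Longrightarrow> f x \<le> (\<Sum>g\<leftarrow>gs. v (x \<otimes> g))"
proof -
  obtain C where C: "compactin T C" "\<And>x. x \<in> carrier G \<Longrightarrow> f x \<noteq> 0 \<Longrightarrow> x \<in> C <#> N"
    using cc_supp[OF f] by blast
  obtain B where B: "B > 0" "\<And>x. x \<in> carrier G \<Longrightarrow> f x \<le> B" using cc_bounded[OF N f] by blast
  define d where "d = v x0 / 2"
  have d: "d > 0" "v x0 > d" using x0 by (auto simp: d_def)
  \<comment> \<open>Right multiplication by \<open>t c\<close> carries c to x0, so v (x t c) > d for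
    x near c.\<close>
  define t where "t = (\<lambda>c. inv c \<otimes> x0)"
  have t: "t c \<in> carrier G" "c \<otimes> t c = x0" if "c \<in> carrier G" for c
    using that x0 by (auto simp: t_def simp flip: m_assoc)
  obtain F where F: "finite F" "F \<subseteq> C" "C \<subseteq> (\<Union>c\<in>F. {x \<in> carrier G. v (x \<otimes> t c) > d})"
  proof (rule compactin_finite_subcover_points[OF C(1), of "\<lambda>c. {x \<in> carrier G. v (x \<otimes> t c) > d}"])
    fix c assume "c \<in> C"
    then have c: "c \<in> carrier G" using carrier_compactin[OF C(1)] by auto
    show "openin T {x \<in> carrier G. v (x \<otimes> t c) > d} \<and> c \<in> {x \<in> carrier G. v (x \<otimes> t c) > d}"
      using cc_positive_set[OF cc_translate[OF N v t(1)[OF c]]] c t d by auto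
  qed auto
  \<comment> \<open>Where f is nonzero one translate exceeds d, so n copies of the family sum to at
    least n d \<ge> B. The multiplicity is encoded by repetition in the list
    \<open>gs\<close>.\<close>
  obtain n :: nat where n: "real n * d \<ge> B" using reals_Archimedean3[OF d(1)] by (meson less_imp_le)
  obtain cs where cs: "set cs = F" using F(1) finite_list by auto
  define gs where "gs = concat (replicate n (map t cs))"
  have car: "F \<subseteq> carrier G" using F(2) carrier_compactin[OF C(1)] by auto
  have sumgs: "(\<Sum>g\<leftarrow>gs. h g) = real n * (\<Sum>c\<leftarrow>cs. h (t c))" for h :: "'a \<Rightarrow> real"
    unfolding gs_def by (induction n) (auto simp: o_def algebra_simps)
  show thesis
  proof (rule that)
    show "set gs \<subseteq> carrier G" using t(1) car cs by (auto simp: gs_def)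
    fix x assume x: "x \<in> carrier G"
    have nn: "0 \<le> v (x \<otimes> t c)" if "c \<in> F" for c using that car x t(1) cc_nonneg[OF v] by auto
    show "f x \<le> (\<Sum>g\<leftarrow>gs. v (x \<otimes> g))"
    proof (cases "f x = 0")
      case True
      have "0 \<le> (\<Sum>c\<leftarrow>cs. v (x \<otimes> t c))" using nn cs by (intro sum_list_nonneg) auto
      then show ?thesis using True by (simp add: sumgs)
    next
      case False
      then obtain c m where c: "c \<in> C" "m \<in> N" "x = c \<otimes> m" using C(2)[OF x] by (auto simp: set_mult_def)
      then obtain b where b: "b \<in> F" "v (c \<otimes> t b) > d" using F(3) by auto
      have cb: "c \<in> carrier G" "t b \<in> carrier G" "m \<in> carrier G"
        using c carrier_compactin[OF C(1)] t(1) car b admissible_subset[OF N] by auto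
      have "v (x \<otimes> t b) = v (c \<otimes> t b)"
        using cc_inv[OF cc_translate[OF N v cb(2)] cb(1) c(2)] c by simp
      then have "d \<le> v (x \<otimes> t b)" using b by simp
      also have "\<dots> \<le> (\<Sum>c\<leftarrow>cs. v (x \<otimes> t c))"
        using nn cs b by (intro member_le_sum_list) auto
      finally have "real n * d \<le> (\<Sum>g\<leftarrow>gs. v (x \<otimes> g))" by (simp add: sumgs mult_left_mono)
      then show ?thesis using B(2)[OF x] n by linarith
    qed
  qed
qed

end

section \<open>The mean of an almost periodic function\<close>

lemma sum_list_div_bounds:
  fixes h :: "'a \<Rightarrow> real"
  assumes "as \<noteq> []"
  shows "(\<And>a. a \<in> set as \<Longrightarrow> c \<le> h a) \<Longrightarrow> c \<le> (\<Sum>a\<leftarrow>as. h a) / length as"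
    and "(\<And>a. a \<in> set as \<Longrightarrow> h a \<le> c) \<Longrightarrow> (\<Sum>a\<leftarrow>as. h a) / length as \<le> c"
proof -
  have n: "real (length as) > 0" using assms by simp
  have const: "(\<Sum>a\<leftarrow>as. c) = real (length as) * c" by (simp add: sum_list_triv)
  show "c \<le> (\<Sum>a\<leftarrow>as. h a) / length as" if "\<And>a. a \<in> set as \<Longrightarrow> c \<le> h a"
    using sum_list_mono[of as "\<lambda>_. c" h] that n const by (simp add: pos_le_divide_eq mult.commute)
  show "(\<Sum>a\<leftarrow>as. h a) / length as \<le> c" if "\<And>a. a \<in> set as \<Longrightarrow> h a \<le> c"
    using sum_list_mono[of as h "\<lambda>_. c"] that n const by (simp add: pos_divide_le_eq mult.commute)
qed

lemma sum_list_div_abs: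
  fixes h :: "'a \<Rightarrow> real"
  assumes "as \<noteq> []" "\<And>a. a \<in> set as \<Longrightarrow> \<bar>h a - c\<bar> \<le> e"
  shows "\<bar>(\<Sum>a\<leftarrow>as. h a) / length as - c\<bar> \<le> e"
  using sum_list_div_bounds(1)[OF assms(1), of "c - e" h] sum_list_div_bounds(2)[OF assms(1), of h "c + e"]
    assms(2) by (fastforce simp: abs_le_iff algebra_simps)

lemma sum_list_swap:
  fixes h :: "'a \<Rightarrow> 'b \<Rightarrow> real"
  shows "(\<Sum>a\<leftarrow>as. \<Sum>b\<leftarrow>bs. h a b) = (\<Sum>b\<leftarrow>bs. \<Sum>a\<leftarrow>as. h a b)"
  by (induction as) (auto simp: sum_list_addf)

section \<open>Almost periodic functions and left averages on an abstract group\<close>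

context group
begin

text \<open>Maak's form of almost periodicity: finitely many a approximate every middle factor z,
  uniformly in the factors on both sides. No topology on the group enters.\<close>

definition almost_periodic :: "('a \<Rightarrow> real) \<Rightarrow> bool" where
  "almost_periodic \<phi> \<longleftrightarrow> (\<forall>\<epsilon>>0. \<exists>A. finite A \<and> A \<subseteq> carrier G \<and>
     (\<forall>z\<in>carrier G. \<exists>a\<in>A. \<forall>x\<in>carrier G. \<forall>y\<in>carrier G. \<bar>\<phi> (x \<otimes> z \<otimes> y) - \<phi> (x \<otimes> a \<otimes> y)\<bar> \<le> \<epsilon>))"

lemma almost_periodicD:
  assumes "almost_periodic \<phi>" "\<epsilon> > 0"
  obtains A where "finite A" "A \<subseteq> carrier G"
    "\<forall>z\<in>carrier G. \<exists>a\<in>A. \<forall>x\<in>carrier G. \<forall>y\<in>carrier G. \<bar>\<phi> (x \<otimes> z \<otimes> y) - \<phi> (x \<otimes> a \<otimes> y)\<bar> \<le> \<epsilon>"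
proof -
  from assms(1)[unfolded almost_periodic_def, rule_format, OF assms(2)] show ?thesis
    by (elim exE conjE) (rule that)
qed

lemma almost_periodic_cong:
  assumes \<phi>: "almost_periodic \<phi>" and eq: "\<And>x. x \<in> carrier G \<Longrightarrow> \<phi> x = \<psi> x"
  shows "almost_periodic \<psi>"
  unfolding almost_periodic_def
proof (intro allI impI)
  fix \<epsilon> :: real assume "\<epsilon> > 0"
  then obtain A where A: "finite A" "A \<subseteq> carrier G"
    "\<forall>z\<in>carrier G. \<exists>a\<in>A. \<forall>x\<in>carrier G. \<forall>y\<in>carrier G. \<bar>\<phi> (x \<otimes> z \<otimes> y) - \<phi> (x \<otimes> a \<otimes> y)\<bar> \<le> \<epsilon>"
    by (rule almost_periodicD[OF \<phi>])
  have "\<exists>a\<in>A. \<forall>x\<in>carrier G. \<forall>y\<in>carrier G. \<bar>\<psi> (x \<otimes> z \<otimes> y) - \<psi> (x \<otimes> a \<otimes> y)\<bar> \<le> \<epsilon>"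
    if z: "z \<in> carrier G" for z
  proof -
    obtain a where a: "a \<in> A" "\<forall>x\<in>carrier G. \<forall>y\<in>carrier G. \<bar>\<phi> (x \<otimes> z \<otimes> y) - \<phi> (x \<otimes> a \<otimes> y)\<bar> \<le> \<epsilon>"
      using A(3) z by blast
    moreover have "a \<in> carrier G" using a A(2) by blast
    ultimately show ?thesis using z by (intro bexI[of _ a]) (simp_all flip: eq)
  qed
  then show "\<exists>A. finite A \<and> A \<subseteq> carrier G \<and> (\<forall>z\<in>carrier G. \<exists>a\<in>A. \<forall>x\<in>carrier G. \<forall>y\<in>carrier G.
      \<bar>\<psi> (x \<otimes> z \<otimes> y) - \<psi> (x \<otimes> a \<otimes> y)\<bar> \<le> \<epsilon>)"
    using A(1,2) by blast
qed

definition lavg :: "'a list \<Rightarrow> ('a \<Rightarrow> real) \<Rightarrow> 'a \<Rightarrow> real" where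
  "lavg as \<phi> y = (\<Sum>a\<leftarrow>as. \<phi> (a \<otimes> y)) / length as"

definition ravg :: "'a list \<Rightarrow> ('a \<Rightarrow> real) \<Rightarrow> 'a \<Rightarrow> real" where
  "ravg as \<phi> y = (\<Sum>a\<leftarrow>as. \<phi> (y \<otimes> a)) / length as"

definition elems :: "'a list \<Rightarrow> bool" where
  "elems as \<longleftrightarrow> as \<noteq> [] \<and> set as \<subseteq> carrier G"

text \<open>Only left averages appear here; right averages provide the comparison that makes c
  unique.\<close>

definition is_mean :: "('a \<Rightarrow> real) \<Rightarrow> real \<Rightarrow> bool" where
  "is_mean \<phi> c \<longleftrightarrow> (\<forall>\<epsilon>>0. \<exists>as. elems as \<and> (\<forall>y\<in>carrier G. \<bar>lavg as \<phi> y - c\<bar> \<le> \<epsilon>))"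

definition mean :: "('a \<Rightarrow> real) \<Rightarrow> real" where
  "mean \<phi> = (THE c. is_mean \<phi> c)"

text \<open>Averaging over \<open>as\<close> and then over \<open>bs\<close> is one average over all
  products a b, so left averages are closed under iteration.\<close>

lemma lavg_lavg:
  assumes "elems as" "elems bs" "y \<in> carrier G"
  defines "cs \<equiv> concat (map (\<lambda>b. map (\<lambda>a. a \<otimes> b) as) bs)"
  shows "elems cs" "lavg cs \<phi> y = lavg bs (lavg as \<phi>) y"
proof -
  show "elems cs" using assms by (auto simp: elems_def cs_def)
  have len: "length cs = length bs * length as"
    unfolding cs_def by (induction bs) auto
  have "(\<Sum>c\<leftarrow>cs. \<phi> (c \<otimes> y)) = (\<Sum>b\<leftarrow>bs. \<Sum>a\<leftarrow>as. \<phi> (a \<otimes> (b \<otimes> y)))"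
    using assms(2) unfolding cs_def
  proof (induction bs)
    case (Cons b bs)
    have *: "sum_list (map ((\<lambda>c. \<phi> (c \<otimes> y)) \<circ> (\<lambda>a. a \<otimes> b)) as) = (\<Sum>a\<leftarrow>as. \<phi> (a \<otimes> (b \<otimes> y)))"
      by (rule arg_cong[where f = sum_list]) (use Cons.prems assms(1,3) in \<open>auto simp: elems_def m_assoc subset_iff\<close>)
    show ?case
    proof (cases "bs = []")
      case False
      then have "elems bs" using Cons.prems by (simp add: elems_def)
      then show ?thesis using Cons.IH * by simp
    qed (simp add: *)
  qed (simp add: elems_def)
  moreover have "(\<Sum>b\<leftarrow>bs. lavg as \<phi> (b \<otimes> y)) = (\<Sum>b\<leftarrow>bs. \<Sum>a\<leftarrow>as. \<phi> (a \<otimes> (b \<otimes> y))) / length as"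
    unfolding lavg_def by (induction bs) (auto simp: add_divide_distrib)
  ultimately show "lavg cs \<phi> y = lavg bs (lavg as \<phi>) y"
    by (simp add: lavg_def[of cs] lavg_def[of bs] len)
qed

text \<open>The factor a is absorbed into x, over which the hypothesis is uniform. Hence a net for
  \<phi> is also a net for every left average of \<phi>.\<close>

lemma lavg_uniform:
  assumes "elems as" "z \<in> carrier G" "b \<in> carrier G" "y \<in> carrier G" "x \<in> carrier G"
    and "\<forall>x\<in>carrier G. \<forall>y\<in>carrier G. \<bar>\<phi> (x \<otimes> z \<otimes> y) - \<phi> (x \<otimes> b \<otimes> y)\<bar> \<le> \<epsilon>"
  shows "\<bar>lavg as \<phi> (x \<otimes> z \<otimes> y) - lavg as \<phi> (x \<otimes> b \<otimes> y)\<bar> \<le> \<epsilon>"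
proof -
  have "\<bar>\<phi> (a \<otimes> (x \<otimes> z \<otimes> y)) - \<phi> (a \<otimes> (x \<otimes> b \<otimes> y)) - 0\<bar> \<le> \<epsilon>" if "a \<in> set as" for a
    using assms(6)[rule_format, of "a \<otimes> x" y] that assms(1-5) by (auto simp: elems_def m_assoc subset_iff)
  then have "\<bar>(\<Sum>a\<leftarrow>as. \<phi> (a \<otimes> (x \<otimes> z \<otimes> y)) - \<phi> (a \<otimes> (x \<otimes> b \<otimes> y))) / length as - 0\<bar> \<le> \<epsilon>"
    using assms(1) by (intro sum_list_div_abs) (auto simp: elems_def)
  then show ?thesis by (simp add: lavg_def sum_list_subtractf diff_divide_distrib)
qed

lemma almost_periodic_lavg:
  assumes "almost_periodic \<phi>" "elems as"
  shows "almost_periodic (lavg as \<phi>)"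
  unfolding almost_periodic_def
proof (intro allI impI)
  fix \<epsilon> :: real assume "\<epsilon> > 0"
  then obtain A where A: "finite A" "A \<subseteq> carrier G"
    "\<forall>z\<in>carrier G. \<exists>a\<in>A. \<forall>x\<in>carrier G. \<forall>y\<in>carrier G. \<bar>\<phi> (x \<otimes> z \<otimes> y) - \<phi> (x \<otimes> a \<otimes> y)\<bar> \<le> \<epsilon>"
    by (rule almost_periodicD[OF assms(1)])
  have "\<exists>a\<in>A. \<forall>x\<in>carrier G. \<forall>y\<in>carrier G. \<bar>lavg as \<phi> (x \<otimes> z \<otimes> y) - lavg as \<phi> (x \<otimes> a \<otimes> y)\<bar> \<le> \<epsilon>"
    if z: "z \<in> carrier G" for z
  proof -
    obtain a where a: "a \<in> A" "\<forall>x\<in>carrier G. \<forall>y\<in>carrier G. \<bar>\<phi> (x \<otimes> z \<otimes> y) - \<phi> (x \<otimes> a \<otimes> y)\<bar> \<le> \<epsilon>"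
      using A(3)[rule_format, OF z] ..
    then have "a \<in> carrier G" using A(2) by auto
    then show ?thesis using lavg_uniform[OF assms(2) z _ _ _ a(2)] a(1) by (intro bexI[of _ a]) auto
  qed
  then show "\<exists>A. finite A \<and> A \<subseteq> carrier G \<and> (\<forall>z\<in>carrier G. \<exists>a\<in>A. \<forall>x\<in>carrier G. \<forall>y\<in>carrier G.
      \<bar>lavg as \<phi> (x \<otimes> z \<otimes> y) - lavg as \<phi> (x \<otimes> a \<otimes> y)\<bar> \<le> \<epsilon>)"
    using A by blast
qed

text \<open>Averaging over an \<open>\<epsilon>/4\<close>-net shrinks the oscillation by a factor depending only on
  the size of the net, and the same net works again for the averaged function.\<close>

lemma lavg_oscillation_step:
  assumes A: "finite A" "A \<subseteq> carrier G" "A \<noteq> {}"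
    and net: "\<forall>z\<in>carrier G. \<exists>a\<in>A. \<forall>x\<in>carrier G. \<forall>y\<in>carrier G. \<bar>\<phi> (x \<otimes> z \<otimes> y) - \<phi> (x \<otimes> a \<otimes> y)\<bar> \<le> \<epsilon> / 4"
    and as: "elems as" and osc: "\<forall>y\<in>carrier G. u \<le> lavg as \<phi> y \<and> lavg as \<phi> y \<le> u + r" and r: "r \<ge> \<epsilon>" "\<epsilon> > 0"
  shows "\<exists>as u. elems as \<and> (\<forall>y\<in>carrier G. u \<le> lavg as \<phi> y \<and> lavg as \<phi> y \<le> u + r * (1 - 1 / (4 * card A)))"
proof (cases "\<exists>y0\<in>carrier G. lavg as \<phi> y0 \<le> u + r / 2")
  case False
  \<comment> \<open>All values exceed u + r/2 in this case, so the lower bound can be raised to u +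
    r/2. The remaining factor 1/2 is at most the claimed one because the net has at least one
    element.\<close>
  have "card A \<ge> 1" using A by (simp add: Suc_leI card_gt_0_iff)
  then have "1 / (4 * real (card A)) \<le> 1 / 2" by (simp add: field_simps)
  then have "r * (1 / 2) \<le> r * (1 - 1 / (4 * card A))" using r by (intro mult_left_mono) auto
  then have "\<forall>y\<in>carrier G. u + r / 2 \<le> lavg as \<phi> y \<and> lavg as \<phi> y \<le> (u + r / 2) + r * (1 - 1 / (4 * card A))"
    using False osc by fastforce
  then show ?thesis using as by blast
next
  case True
  then obtain y0 where y0: "y0 \<in> carrier G" "lavg as \<phi> y0 \<le> u + r / 2" by auto
  obtain bs where bs: "set bs = A" "length bs = card A" using A(1) by (metis distinct_card finite_distinct_list)
  have ebs: "elems bs" using bs A by (auto simp: elems_def)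
  define h where "h = lavg as \<phi>"
  define n where "n = real (card A)"
  have n: "n > 0" using A by (simp add: n_def card_gt_0_iff)
  have "u \<le> lavg bs h y \<and> lavg bs h y \<le> u + r * (1 - 1 / (4 * n))" if y: "y \<in> carrier G" for y
  proof
    show "u \<le> lavg bs h y"
      unfolding lavg_def using ebs y osc by (intro sum_list_div_bounds) (auto simp: elems_def h_def subset_iff)
    \<comment> \<open>The element z carries y to y0, where h is at most u + r/2. A net element b
      near z then has h (b y) \<le> u + r/2 + \<epsilon>/4 \<le> u + 3r/4, because \<epsilon> \<le>
      r. This single term lowers the average of the n terms by r/(4n) below u + r.\<close>
    define z where "z = y0 \<otimes> inv y"
    have z: "z \<in> carrier G" "z \<otimes> y = y0" using y y0 by (auto simp: z_def m_assoc)
    obtain b where b: "b \<in> A" "\<forall>x\<in>carrier G. \<forall>y\<in>carrier G. \<bar>\<phi> (x \<otimes> z \<otimes> y) - \<phi> (x \<otimes> b \<otimes> y)\<bar> \<le> \<epsilon> / 4"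
      using net z by blast
    have bc: "b \<in> carrier G" using b A by auto
    have "\<bar>h (\<one> \<otimes> z \<otimes> y) - h (\<one> \<otimes> b \<otimes> y)\<bar> \<le> \<epsilon> / 4"
      unfolding h_def by (rule lavg_uniform[OF as z(1) bc y one_closed b(2)])
    then have "\<bar>h y0 - h (b \<otimes> y)\<bar> \<le> \<epsilon> / 4" using z bc y y0 by simp
    then have hb: "h (b \<otimes> y) \<le> u + r / 2 + \<epsilon> / 4" using y0(2) unfolding h_def by linarith
    have "(\<Sum>b\<leftarrow>bs. u + r - h (b \<otimes> y)) \<ge> u + r - h (b \<otimes> y)"
      using osc y bs A b by (intro member_le_sum_list) (auto simp: h_def subset_iff)
    moreover have "(\<Sum>b\<leftarrow>bs. u + r - h (b \<otimes> y)) = n * (u + r) - (\<Sum>b\<leftarrow>bs. h (b \<otimes> y))"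
      using bs by (simp add: sum_list_subtractf sum_list_triv n_def)
    ultimately have "(\<Sum>b\<leftarrow>bs. h (b \<otimes> y)) \<le> n * (u + r) - r / 4" using hb r by linarith
    then have "(\<Sum>b\<leftarrow>bs. h (b \<otimes> y)) / n \<le> (n * (u + r) - r / 4) / n" using n by (simp add: divide_right_mono)
    also have "\<dots> = u + r * (1 - 1 / (4 * n))" using n by (simp add: field_simps)
    finally show "lavg bs h y \<le> u + r * (1 - 1 / (4 * n))" by (simp add: lavg_def bs n_def)
  qed
  then show ?thesis
    using lavg_lavg(1)[OF as ebs one_closed] lavg_lavg(2)[OF as ebs]
    by (intro exI[of _ "concat (map (\<lambda>b. map (\<lambda>a. a \<otimes> b) as) bs)"] exI[of _ u]) (auto simp: h_def n_def)
qed

lemma almost_periodic_bounded: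
  assumes "almost_periodic \<phi>"
  obtains B where "B > 0" "\<forall>y\<in>carrier G. \<bar>\<phi> y\<bar> \<le> B"
proof -
  obtain A where A: "finite A" "A \<subseteq> carrier G"
    "\<forall>z\<in>carrier G. \<exists>a\<in>A. \<forall>x\<in>carrier G. \<forall>y\<in>carrier G. \<bar>\<phi> (x \<otimes> z \<otimes> y) - \<phi> (x \<otimes> a \<otimes> y)\<bar> \<le> 1"
    by (rule almost_periodicD[OF assms zero_less_one])
  have "\<bar>\<phi> z\<bar> \<le> 1 + (\<Sum>a\<in>A. \<bar>\<phi> a\<bar>)" if z: "z \<in> carrier G" for z
  proof -
    obtain a where a: "a \<in> A" "\<forall>x\<in>carrier G. \<forall>y\<in>carrier G. \<bar>\<phi> (x \<otimes> z \<otimes> y) - \<phi> (x \<otimes> a \<otimes> y)\<bar> \<le> 1"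
      using A z by blast
    have "\<bar>\<phi> z - \<phi> a\<bar> \<le> 1" using a(2)[rule_format, of \<one> \<one>] z a A by auto
    moreover have "\<bar>\<phi> a\<bar> \<le> (\<Sum>a\<in>A. \<bar>\<phi> a\<bar>)" using A a by (intro member_le_sum) auto
    ultimately show ?thesis by linarith
  qed
  moreover have "0 < 1 + (\<Sum>a\<in>A. \<bar>\<phi> a\<bar>)" by (simp add: add_pos_nonneg sum_nonneg)
  ultimately show thesis using that by blast
qed

text \<open>As long as the oscillation cannot be made smaller than \<epsilon>, every step multiplies
  its bound by the same q < 1, since one net serves all steps. The bounds 2 B q^n tend to 0, which
  is a contradiction.\<close>

lemma lavg_near_constant:
  assumes "almost_periodic \<phi>" and e: "\<epsilon> > 0"
  shows "\<exists>as c. elems as \<and> (\<forall>y\<in>carrier G. \<bar>lavg as \<phi> y - c\<bar> \<le> \<epsilon>)"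
proof -
  obtain A where A: "finite A" "A \<subseteq> carrier G"
    "\<forall>z\<in>carrier G. \<exists>a\<in>A. \<forall>x\<in>carrier G. \<forall>y\<in>carrier G. \<bar>\<phi> (x \<otimes> z \<otimes> y) - \<phi> (x \<otimes> a \<otimes> y)\<bar> \<le> \<epsilon> / 4"
    by (rule almost_periodicD[OF assms(1), of "\<epsilon> / 4"]) (use e in auto)
  have A0: "A \<noteq> {}" using A(3) one_closed by blast
  define P where "P = (\<lambda>r. \<exists>as u. elems as \<and> (\<forall>y\<in>carrier G. u \<le> lavg as \<phi> y \<and> lavg as \<phi> y \<le> u + r))"
  define q where "q = 1 - 1 / (4 * real (card A))"
  have cA: "card A \<ge> 1" using A A0 by (simp add: Suc_leI card_gt_0_iff)
  then have q: "0 \<le> q" "q < 1" by (auto simp: q_def field_simps)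
  obtain B where B: "B > 0" "\<forall>y\<in>carrier G. \<bar>\<phi> y\<bar> \<le> B" using almost_periodic_bounded[OF assms(1)] .
  have P0: "P (2 * B)"
    unfolding P_def
  proof (intro exI conjI ballI)
    show "elems [\<one>]" by (simp add: elems_def)
    show "- B \<le> lavg [\<one>] \<phi> y" "lavg [\<one>] \<phi> y \<le> -B + 2 * B" if "y \<in> carrier G" for y
      using B(2)[rule_format, OF that] that by (auto simp: lavg_def)
  qed
  have "\<exists>r. P r \<and> r < \<epsilon>"
  proof (rule ccontr)
    assume neg: "\<not> (\<exists>r. P r \<and> r < \<epsilon>)"
    have "P (2 * B * q ^ n)" for n
    proof (induction n)
      case (Suc n)
      moreover have "2 * B * q ^ n \<ge> \<epsilon>" using neg Suc by fastforce
      ultimately have "P (2 * B * q ^ n * q)"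
      proof -
        from Suc obtain as u where "elems as"
          "\<forall>y\<in>carrier G. u \<le> lavg as \<phi> y \<and> lavg as \<phi> y \<le> u + 2 * B * q ^ n" unfolding P_def by auto
        from lavg_oscillation_step[OF A(1,2) A0 A(3) this \<open>2 * B * q ^ n \<ge> \<epsilon>\<close> e]
        show ?thesis by (simp add: P_def q_def)
      qed
      then show ?case by (simp add: ac_simps)
    qed (use P0 in simp)
    moreover obtain n where "q ^ n < \<epsilon> / (2 * B)"
      using real_arch_pow_inv[of "\<epsilon> / (2 * B)" q] q e B by auto
    then have "2 * B * q ^ n < \<epsilon>" using B by (simp add: field_simps)
    ultimately show False using neg by blast
  qed
  then obtain r as u where r: "r < \<epsilon>" "elems as" "\<forall>y\<in>carrier G. u \<le> lavg as \<phi> y \<and> lavg as \<phi> y \<le> u + r"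
    unfolding P_def by blast
  then have "\<forall>y\<in>carrier G. \<bar>lavg as \<phi> y - u\<bar> \<le> \<epsilon>" by fastforce
  then show ?thesis using r by blast
qed

section \<open>Right averages, existence and uniqueness of the mean\<close>

lemma almost_periodic_inv:
  assumes "almost_periodic \<phi>"
  shows "almost_periodic (\<lambda>x. \<phi> (inv x))"
  unfolding almost_periodic_def
proof (intro allI impI)
  fix \<epsilon> :: real assume "\<epsilon> > 0"
  then obtain A where A: "finite A" "A \<subseteq> carrier G"
    "\<forall>z\<in>carrier G. \<exists>a\<in>A. \<forall>x\<in>carrier G. \<forall>y\<in>carrier G. \<bar>\<phi> (x \<otimes> z \<otimes> y) - \<phi> (x \<otimes> a \<otimes> y)\<bar> \<le> \<epsilon>"
    by (rule almost_periodicD[OF assms(1)])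
  show "\<exists>A. finite A \<and> A \<subseteq> carrier G \<and> (\<forall>z\<in>carrier G. \<exists>a\<in>A. \<forall>x\<in>carrier G. \<forall>y\<in>carrier G.
      \<bar>\<phi> (inv (x \<otimes> z \<otimes> y)) - \<phi> (inv (x \<otimes> a \<otimes> y))\<bar> \<le> \<epsilon>)"
  proof (intro exI conjI ballI)
    show "finite (m_inv G ` A)" "m_inv G ` A \<subseteq> carrier G" using A by auto
    fix z assume z: "z \<in> carrier G"
    then obtain a where a: "a \<in> A" "\<forall>x\<in>carrier G. \<forall>y\<in>carrier G. \<bar>\<phi> (x \<otimes> inv z \<otimes> y) - \<phi> (x \<otimes> a \<otimes> y)\<bar> \<le> \<epsilon>"
      using A(3) inv_closed by blast
    have "a \<in> carrier G" using a A by auto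
    then have "\<bar>\<phi> (inv (x \<otimes> z \<otimes> y)) - \<phi> (inv (x \<otimes> inv a \<otimes> y))\<bar> \<le> \<epsilon>"
      if "x \<in> carrier G" "y \<in> carrier G" for x y
      using a(2)[rule_format, of "inv y" "inv x"] that z by (simp add: inv_mult_group m_assoc)
    then show "\<exists>a\<in>m_inv G ` A. \<forall>x\<in>carrier G. \<forall>y\<in>carrier G. \<bar>\<phi> (inv (x \<otimes> z \<otimes> y)) - \<phi> (inv (x \<otimes> a \<otimes> y))\<bar> \<le> \<epsilon>"
      using a by blast
  qed
qed

text \<open>Inversion turns left averages of x \<mapsto> \<phi> (inv x) into right averages of
  \<phi>.\<close>

lemma ravg_near_constant:
  assumes "almost_periodic \<phi>" and "\<epsilon> > 0"
  shows "\<exists>as c. elems as \<and> (\<forall>y\<in>carrier G. \<bar>ravg as \<phi> y - c\<bar> \<le> \<epsilon>)"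
proof -
  obtain as c where as: "elems as" "\<forall>y\<in>carrier G. \<bar>lavg as (\<lambda>x. \<phi> (inv x)) y - c\<bar> \<le> \<epsilon>"
    using lavg_near_constant[OF almost_periodic_inv[OF assms(1)] assms(2)] by blast
  have "ravg (map (m_inv G) as) \<phi> y = lavg as (\<lambda>x. \<phi> (inv x)) (inv y)" if "y \<in> carrier G" for y
  proof -
    have "map (\<lambda>x. \<phi> (y \<otimes> inv x)) as = map (\<lambda>a. \<phi> (inv (a \<otimes> inv y))) as"
      using that as(1) by (auto simp: elems_def inv_mult_group subset_iff)
    from arg_cong[OF this, of sum_list] show ?thesis by (simp add: ravg_def lavg_def o_def)
  qed
  then have "\<forall>y\<in>carrier G. \<bar>ravg (map (m_inv G) as) \<phi> y - c\<bar> \<le> \<epsilon>" using as(2) by simp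
  moreover have "elems (map (m_inv G) as)" using as(1) by (auto simp: elems_def)
  ultimately show ?thesis by blast
qed

text \<open>Both sides are the average of \<phi> (a b) over all pairs. A left average near c and a
  right average near d are thereby forced to have c near d.\<close>

lemma lavg_ravg_comm:
  assumes "elems as" "elems bs"
  shows "(\<Sum>b\<leftarrow>bs. lavg as \<phi> b) / length bs = (\<Sum>a\<leftarrow>as. ravg bs \<phi> a) / length as"
proof -
  have "(\<Sum>b\<leftarrow>bs. lavg as \<phi> b) = (\<Sum>b\<leftarrow>bs. \<Sum>a\<leftarrow>as. \<phi> (a \<otimes> b)) / length as"
    unfolding lavg_def by (induction bs) (auto simp: add_divide_distrib)
  moreover have "(\<Sum>a\<leftarrow>as. ravg bs \<phi> a) = (\<Sum>a\<leftarrow>as. \<Sum>b\<leftarrow>bs. \<phi> (a \<otimes> b)) / length bs"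
    unfolding ravg_def by (induction as) (auto simp: add_divide_distrib)
  ultimately show ?thesis using sum_list_swap[of "\<lambda>a b. \<phi> (a \<otimes> b)" bs as] by (simp add: mult.commute)
qed

lemma lavg_ravg_le:
  assumes as: "elems as" and bs: "elems bs" and le: "\<And>x. x \<in> carrier G \<Longrightarrow> \<phi> x \<le> \<psi> x"
    and c: "\<And>y. y \<in> carrier G \<Longrightarrow> c \<le> lavg as \<phi> y" and d: "\<And>y. y \<in> carrier G \<Longrightarrow> ravg bs \<psi> y \<le> d"
  shows "c \<le> d"
proof -
  have "c \<le> (\<Sum>b\<leftarrow>bs. lavg as \<phi> b) / length bs"
    using bs c by (intro sum_list_div_bounds) (auto simp: elems_def subset_iff)
  also have "\<dots> = (\<Sum>a\<leftarrow>as. ravg bs \<phi> a) / length as" using lavg_ravg_comm[OF as bs] .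
  also have "\<dots> \<le> d"
  proof (intro sum_list_div_bounds)
    fix a assume "a \<in> set as"
    then have a: "a \<in> carrier G" using as by (auto simp: elems_def)
    have "ravg bs \<phi> a \<le> ravg bs \<psi> a"
      unfolding ravg_def using bs a le by (intro divide_right_mono sum_list_mono) (auto simp: elems_def subset_iff)
    then show "ravg bs \<phi> a \<le> d" using d[OF a] by linarith
  qed (use as in \<open>simp add: elems_def\<close>)
  finally show ?thesis .
qed

lemma lavg_ravg_close:
  assumes as: "elems as" and bs: "elems bs"
    and c: "\<And>y. y \<in> carrier G \<Longrightarrow> \<bar>lavg as \<phi> y - c\<bar> \<le> \<epsilon>" and d: "\<And>y. y \<in> carrier G \<Longrightarrow> \<bar>ravg bs \<phi> y - d\<bar> \<le> \<delta>"
  shows "\<bar>c - d\<bar> \<le> \<epsilon> + \<delta>"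
proof -
  have "\<bar>(\<Sum>b\<leftarrow>bs. lavg as \<phi> b) / length bs - c\<bar> \<le> \<epsilon>"
    using bs c by (intro sum_list_div_abs) (auto simp: elems_def subset_iff)
  moreover have "\<bar>(\<Sum>a\<leftarrow>as. ravg bs \<phi> a) / length as - d\<bar> \<le> \<delta>"
    using as d by (intro sum_list_div_abs) (auto simp: elems_def subset_iff)
  ultimately show ?thesis using lavg_ravg_comm[OF as bs, of \<phi>] by linarith
qed

lemma is_mean_exists:
  assumes ap: "almost_periodic \<phi>"
  shows "\<exists>c. is_mean \<phi> c"
proof -
  \<comment> \<open>The numbers c - \<epsilon> bound the future mean from below, one for each left
    average that is constant up to \<epsilon>. By \<open>up\<close> each is at most every c +
    \<epsilon>, so \<open>Sup S\<close> lies in all the intervals from c - \<epsilon> to c +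
    \<epsilon>.\<close>
  define S where "S = {c - \<epsilon> |c \<epsilon>. \<epsilon> > 0 \<and> (\<exists>as. elems as \<and> (\<forall>y\<in>carrier G. \<bar>lavg as \<phi> y - c\<bar> \<le> \<epsilon>))}"
  have up: "s \<le> c + \<epsilon>" if s: "s \<in> S" and as: "elems as" "\<forall>y\<in>carrier G. \<bar>lavg as \<phi> y - c\<bar> \<le> \<epsilon>" for s as c \<epsilon>
  proof (rule field_le_epsilon)
    fix \<delta> :: real assume "\<delta> > 0"
    then obtain bs d where bs: "elems bs" "\<forall>y\<in>carrier G. \<bar>ravg bs \<phi> y - d\<bar> \<le> \<delta> / 2"
      using ravg_near_constant[OF ap] by (meson half_gt_zero)
    obtain c' \<epsilon>' as' where s': "s = c' - \<epsilon>'" "elems as'" "\<forall>y\<in>carrier G. \<bar>lavg as' \<phi> y - c'\<bar> \<le> \<epsilon>'"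
      using s unfolding S_def by blast
    have "\<bar>c' - d\<bar> \<le> \<epsilon>' + \<delta> / 2" using lavg_ravg_close[OF s'(2) bs(1)] s'(3) bs(2) by blast
    moreover have "\<bar>c - d\<bar> \<le> \<epsilon> + \<delta> / 2" using lavg_ravg_close[OF as(1) bs(1)] as(2) bs(2) by blast
    ultimately show "s \<le> c + \<epsilon> + \<delta>" using s'(1) by linarith
  qed
  have "is_mean \<phi> (Sup S)"
    unfolding is_mean_def
  proof (intro allI impI)
    fix \<epsilon> :: real assume e: "\<epsilon> > 0"
    then obtain as c where as: "elems as" "\<forall>y\<in>carrier G. \<bar>lavg as \<phi> y - c\<bar> \<le> \<epsilon> / 2"
      using lavg_near_constant[OF ap] by (meson half_gt_zero)
    have inS: "c - \<epsilon> / 2 \<in> S" unfolding S_def using as e by force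
    have "Sup S \<le> c + \<epsilon> / 2" using inS up as by (intro cSup_least) auto
    moreover have "c - \<epsilon> / 2 \<le> Sup S"
      using inS up[OF _ as] by (intro cSup_upper bdd_aboveI) auto
    ultimately have "\<bar>lavg as \<phi> y - Sup S\<bar> \<le> \<epsilon>" if "y \<in> carrier G" for y
      using as(2)[rule_format, OF that] by linarith
    then show "\<exists>as. elems as \<and> (\<forall>y\<in>carrier G. \<bar>lavg as \<phi> y - Sup S\<bar> \<le> \<epsilon>)" using as(1) by blast
  qed
  then show ?thesis by blast
qed

lemma is_mean_ravg:
  assumes m: "is_mean \<phi> c" and bs: "elems bs" "\<And>y. y \<in> carrier G \<Longrightarrow> \<bar>ravg bs \<phi> y - d\<bar> \<le> \<delta>"
  shows "\<bar>c - d\<bar> \<le> \<delta>"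
proof (rule field_le_epsilon)
  fix e :: real assume "e > 0"
  then obtain as where "elems as" "\<forall>y\<in>carrier G. \<bar>lavg as \<phi> y - c\<bar> \<le> e"
    using m unfolding is_mean_def by blast
  then have "\<bar>c - d\<bar> \<le> e + \<delta>" using lavg_ravg_close bs by blast
  then show "\<bar>c - d\<bar> \<le> \<delta> + e" by linarith
qed

text \<open>Both candidates are close to the constant of one and the same right average.\<close>

lemma is_mean_unique:
  assumes ap: "almost_periodic \<phi>" and m: "is_mean \<phi> c" "is_mean \<phi> c'"
  shows "c = c'"
proof -
  have "\<bar>c - c'\<bar> \<le> 0"
  proof (rule field_le_epsilon)
    fix e :: real assume "e > 0"
    then obtain bs d where bs: "elems bs" "\<forall>y\<in>carrier G. \<bar>ravg bs \<phi> y - d\<bar> \<le> e / 2"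
      using ravg_near_constant[OF ap] by (meson half_gt_zero)
    then have "\<bar>c - d\<bar> \<le> e / 2" "\<bar>c' - d\<bar> \<le> e / 2" using is_mean_ravg m by blast+
    then show "\<bar>c - c'\<bar> \<le> 0 + e" by linarith
  qed
  then show ?thesis by simp
qed

section \<open>Order, additivity and invariance of the mean\<close>

lemma mean_eqI: "almost_periodic \<phi> \<Longrightarrow> is_mean \<phi> c \<Longrightarrow> mean \<phi> = c"
  unfolding mean_def using is_mean_unique by blast

lemma is_mean_mean: "almost_periodic \<phi> \<Longrightarrow> is_mean \<phi> (mean \<phi>)"
  using is_mean_exists mean_eqI by metis

lemma ravg_near_mean:
  assumes ap: "almost_periodic \<phi>" and e: "\<epsilon> > 0"
  shows "\<exists>bs. elems bs \<and> (\<forall>y\<in>carrier G. \<bar>ravg bs \<phi> y - mean \<phi>\<bar> \<le> \<epsilon>)"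
proof -
  obtain bs d where bs: "elems bs" "\<forall>y\<in>carrier G. \<bar>ravg bs \<phi> y - d\<bar> \<le> \<epsilon> / 2"
    using ravg_near_constant[OF ap] e by (meson half_gt_zero)
  have "\<bar>mean \<phi> - d\<bar> \<le> \<epsilon> / 2" using bs is_mean_ravg is_mean_mean[OF ap] by blast
  have "\<bar>ravg bs \<phi> y - mean \<phi>\<bar> \<le> \<epsilon>" if "y \<in> carrier G" for y
    using bs(2)[rule_format, OF that] \<open>\<bar>mean \<phi> - d\<bar> \<le> \<epsilon> / 2\<close> by linarith
  then show ?thesis using bs(1) by blast
qed

text \<open>A left average of \<phi> is compared with a right average of \<psi> through their double
  averages.\<close>

lemma mean_mono:
  assumes "almost_periodic \<phi>" "almost_periodic \<psi>" "\<And>x. x \<in> carrier G \<Longrightarrow> \<phi> x \<le> \<psi> x"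
  shows "mean \<phi> \<le> mean \<psi>"
proof (rule field_le_epsilon)
  fix e :: real assume "e > 0"
  then obtain as bs where ab: "elems as" "\<forall>y\<in>carrier G. \<bar>lavg as \<phi> y - mean \<phi>\<bar> \<le> e / 2"
      "elems bs" "\<forall>y\<in>carrier G. \<bar>ravg bs \<psi> y - mean \<psi>\<bar> \<le> e / 2"
    using is_mean_mean[OF assms(1)] ravg_near_mean[OF assms(2)] unfolding is_mean_def by (meson half_gt_zero)
  have "mean \<phi> - e / 2 \<le> mean \<psi> + e / 2"
  proof (rule lavg_ravg_le[OF ab(1,3) assms(3)])
    show "mean \<phi> - e / 2 \<le> lavg as \<phi> y" if "y \<in> carrier G" for y
      using ab(2)[rule_format, OF that] by linarith
    show "ravg bs \<psi> y \<le> mean \<psi> + e / 2" if "y \<in> carrier G" for y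
      using ab(4)[rule_format, OF that] by linarith
  qed
  then show "mean \<phi> \<le> mean \<psi> + e" by linarith
qed

lemma mean_cong:
  assumes "almost_periodic \<phi>" "almost_periodic \<psi>" "\<And>x. x \<in> carrier G \<Longrightarrow> \<phi> x = \<psi> x"
  shows "mean \<phi> = mean \<psi>"
  using mean_mono[of \<phi> \<psi>] mean_mono[of \<psi> \<phi>] assms by fastforce

lemma almost_periodic_const: "almost_periodic (\<lambda>x. c)"
  unfolding almost_periodic_def by (intro allI impI exI[of _ "{\<one>}"]) auto

lemma mean_const: "mean (\<lambda>x. c) = c"
proof (rule mean_eqI[OF almost_periodic_const])
  show "is_mean (\<lambda>x. c) c"
    unfolding is_mean_def by (intro allI impI exI[of _ "[\<one>]"]) (auto simp: elems_def lavg_def)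
qed

lemma lavg_add: "lavg as (\<lambda>x. \<phi> x + \<psi> x) y = lavg as \<phi> y + lavg as \<psi> y"
  by (simp add: lavg_def sum_list_addf add_divide_distrib)

text \<open>The list \<open>as\<close> is chosen for \<phi>, and \<open>bs\<close> for the average
  of \<psi> over \<open>as\<close>. The products serve both functions, since a further average keeps
  an almost constant function within the same bound.\<close>

lemma mean_add:
  assumes "almost_periodic \<phi>" "almost_periodic \<psi>" "almost_periodic (\<lambda>x. \<phi> x + \<psi> x)"
  shows "mean (\<lambda>x. \<phi> x + \<psi> x) = mean \<phi> + mean \<psi>"
proof (rule mean_eqI[OF assms(3)], unfold is_mean_def, intro allI impI)
  fix e :: real assume e: "e > 0"
  obtain as where as: "elems as" "\<forall>y\<in>carrier G. \<bar>lavg as \<phi> y - mean \<phi>\<bar> \<le> e / 2"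
    using is_mean_mean[OF assms(1)] e unfolding is_mean_def by (meson half_gt_zero)
  let ?\<psi> = "lavg as \<psi>"
  have m: "is_mean ?\<psi> (mean ?\<psi>)" using is_mean_mean almost_periodic_lavg assms(2) as(1) by blast
  \<comment> \<open>Left averages of a left average of \<psi> are left averages of \<psi>, so the
    two have the same mean.\<close>
  have "is_mean \<psi> (mean ?\<psi>)"
    unfolding is_mean_def
  proof (intro allI impI)
    fix d :: real assume "d > 0"
    then obtain bs where "elems bs" "\<forall>y\<in>carrier G. \<bar>lavg bs ?\<psi> y - mean ?\<psi>\<bar> \<le> d"
      using m unfolding is_mean_def by blast
    then show "\<exists>as. elems as \<and> (\<forall>y\<in>carrier G. \<bar>lavg as \<psi> y - mean ?\<psi>\<bar> \<le> d)"
      using lavg_lavg[OF as(1)] one_closed by metis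
  qed
  then have eq: "mean ?\<psi> = mean \<psi>" using mean_eqI[OF assms(2)] by simp
  obtain bs where bs: "elems bs" "\<forall>y\<in>carrier G. \<bar>lavg bs ?\<psi> y - mean \<psi>\<bar> \<le> e / 2"
    using m e unfolding is_mean_def eq by (meson half_gt_zero)
  define cs where "cs = concat (map (\<lambda>b. map (\<lambda>a. a \<otimes> b) as) bs)"
  have "\<bar>lavg cs (\<lambda>x. \<phi> x + \<psi> x) y - (mean \<phi> + mean \<psi>)\<bar> \<le> e" if y: "y \<in> carrier G" for y
  proof -
    have "\<bar>lavg bs (lavg as \<phi>) y - mean \<phi>\<bar> \<le> e / 2"
      unfolding lavg_def[of bs] using bs(1) as(2) y by (intro sum_list_div_abs) (auto simp: elems_def subset_iff)
    then show ?thesis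
      using bs(2)[rule_format, OF y] unfolding lavg_add cs_def lavg_lavg(2)[OF as(1) bs(1) y] by linarith
  qed
  then show "\<exists>as. elems as \<and> (\<forall>y\<in>carrier G. \<bar>lavg as (\<lambda>x. \<phi> x + \<psi> x) y - (mean \<phi> + mean \<psi>)\<bar> \<le> e)"
    using lavg_lavg(1)[OF as(1) bs(1) one_closed] unfolding cs_def by blast
qed

text \<open>Left translation commutes with right averages, and these determine the mean by
  \<open>is_mean_ravg\<close>.\<close>

lemma mean_left_translate:
  assumes "almost_periodic \<phi>" "almost_periodic (\<lambda>x. \<phi> (k \<otimes> x))" "k \<in> carrier G"
  shows "mean (\<lambda>x. \<phi> (k \<otimes> x)) = mean \<phi>"
proof -
  have "\<bar>mean (\<lambda>x. \<phi> (k \<otimes> x)) - mean \<phi>\<bar> \<le> 0"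
  proof (rule field_le_epsilon)
    fix e :: real assume "e > 0"
    then obtain bs where bs: "elems bs" "\<forall>y\<in>carrier G. \<bar>ravg bs \<phi> y - mean \<phi>\<bar> \<le> e"
      using ravg_near_mean[OF assms(1)] by blast
    have "ravg bs (\<lambda>x. \<phi> (k \<otimes> x)) y = ravg bs \<phi> (k \<otimes> y)" if "y \<in> carrier G" for y
    proof -
      have "map (\<lambda>a. \<phi> (k \<otimes> (y \<otimes> a))) bs = map (\<lambda>a. \<phi> (k \<otimes> y \<otimes> a)) bs"
        using bs(1) assms(3) that by (auto simp: elems_def m_assoc subset_iff)
      from arg_cong[OF this, of sum_list] show ?thesis by (simp add: ravg_def)
    qed
    then show "\<bar>mean (\<lambda>x. \<phi> (k \<otimes> x)) - mean \<phi>\<bar> \<le> 0 + e"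
      using is_mean_ravg[OF is_mean_mean[OF assms(2)] bs(1), of "mean \<phi>" e] bs(2) assms(3) by simp
  qed
  then show ?thesis by simp
qed

text \<open>An average over \<open>as\<close> becomes an average over preimages of \<open>as\<close>
  under h. Besides almost periodicity of both functions, the argument rests on algebra alone, which
  is what admits conjugations of unknown continuity.\<close>

lemma mean_automorphism:
  assumes "almost_periodic \<phi>" "almost_periodic (\<lambda>x. \<phi> (h x))"
    and h: "\<And>x y. x \<in> carrier G \<Longrightarrow> y \<in> carrier G \<Longrightarrow> h (x \<otimes> y) = h x \<otimes> h y" "h ` carrier G = carrier G"
  shows "mean (\<lambda>x. \<phi> (h x)) = mean \<phi>"
proof (rule mean_eqI[OF assms(2)], unfold is_mean_def, intro allI impI)
  fix e :: real assume "e > 0"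
  then obtain as where as: "elems as" "\<forall>y\<in>carrier G. \<bar>lavg as \<phi> y - mean \<phi>\<bar> \<le> e"
    using is_mean_mean[OF assms(1)] unfolding is_mean_def by blast
  obtain k where k: "\<And>x. x \<in> carrier G \<Longrightarrow> k x \<in> carrier G \<and> h (k x) = x"
  proof
    show "inv_into (carrier G) h x \<in> carrier G \<and> h (inv_into (carrier G) h x) = x" if "x \<in> carrier G" for x
      using that h(2) by (metis inv_into_into f_inv_into_f)
  qed
  have "lavg (map k as) (\<lambda>x. \<phi> (h x)) y = lavg as \<phi> (h y)" if "y \<in> carrier G" for y
  proof -
    have "map (\<lambda>a. \<phi> (h (k a \<otimes> y))) as = map (\<lambda>a. \<phi> (a \<otimes> h y)) as"
      using as(1) k that h(1) by (auto simp: elems_def subset_iff)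
    from arg_cong[OF this, of sum_list] show ?thesis by (simp add: lavg_def o_def)
  qed
  moreover have "h y \<in> carrier G" if "y \<in> carrier G" for y using h(2) that by blast
  ultimately have "\<forall>y\<in>carrier G. \<bar>lavg (map k as) (\<lambda>x. \<phi> (h x)) y - mean \<phi>\<bar> \<le> e" using as(2) by simp
  moreover have "elems (map k as)" using as(1) k by (auto simp: elems_def)
  ultimately show "\<exists>as. elems as \<and> (\<forall>y\<in>carrier G. \<bar>lavg as (\<lambda>x. \<phi> (h x)) y - mean \<phi>\<bar> \<le> e)" by blast
qed

end

section \<open>Invariant functionals and the Haar functional\<close>

context lch_right_top_group
begin

text \<open>The cone has no negative functions, so positivity is expressed by monotonicity.
  Monotonicity also makes m f depend only on the values of f on the carrier.\<close>

definition invariant_functional :: "'a set \<Rightarrow> (('a \<Rightarrow> real) \<Rightarrow> real) \<Rightarrow> bool" where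
  "invariant_functional N m \<longleftrightarrow>
     (\<forall>f\<in>cc N. \<forall>g\<in>cc N. m (\<lambda>x. f x + g x) = m f + m g) \<and>
     (\<forall>f\<in>cc N. \<forall>g\<in>cc N. (\<forall>x\<in>carrier G. f x \<le> g x) \<longrightarrow> m f \<le> m g) \<and>
     (\<forall>f\<in>cc N. \<forall>g\<in>carrier G. m (\<lambda>x. f (x \<otimes> g)) = m f) \<and>
     (\<exists>f\<in>cc N. m f \<noteq> 0)"

lemma
  assumes "invariant_functional N m"
  shows functional_add: "f \<in> cc N \<Longrightarrow> g \<in> cc N \<Longrightarrow> m (\<lambda>x. f x + g x) = m f + m g"
    and functional_mono: "f \<in> cc N \<Longrightarrow> g \<in> cc N \<Longrightarrow> (\<And>x. x \<in> carrier G \<Longrightarrow> f x \<le> g x) \<Longrightarrow> m f \<le> m g"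
    and functional_translate: "f \<in> cc N \<Longrightarrow> a \<in> carrier G \<Longrightarrow> m (\<lambda>x. f (x \<otimes> a)) = m f"
  using assms unfolding invariant_functional_def by auto

lemma functional_cong:
  "invariant_functional N m \<Longrightarrow> f \<in> cc N \<Longrightarrow> g \<in> cc N \<Longrightarrow> (\<And>x. x \<in> carrier G \<Longrightarrow> f x = g x) \<Longrightarrow> m f = m g"
  by (intro antisym functional_mono[of N m]) auto

lemma functional_zero:
  assumes m: "invariant_functional N m" and f: "f \<in> cc N"
  shows "m (\<lambda>x. 0) = 0"
proof -
  have z: "(\<lambda>x. 0) \<in> cc N" using cc_scale[OF f, of 0] by simp
  show ?thesis using functional_add[OF m z z] by simp
qed

lemma functional_nonneg:
  assumes m: "invariant_functional N m" and f: "f \<in> cc N"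
  shows "0 \<le> m f"
proof -
  have z: "(\<lambda>x. 0) \<in> cc N" using cc_scale[OF f, of 0] by simp
  show ?thesis using functional_mono[OF m z f] cc_nonneg[OF f] functional_zero[OF m f] by simp
qed

lemma functional_sum_list:
  assumes m: "invariant_functional N m" and h: "h \<in> cc N" and "\<And>i. i \<in> set is \<Longrightarrow> f i \<in> cc N"
  shows "m (\<lambda>x. \<Sum>i\<leftarrow>is. f i x) = (\<Sum>i\<leftarrow>is. m (f i))"
  using assms(3)
proof (induction "is")
  case Nil
  show ?case using functional_zero[OF m h] by simp
next
  case (Cons i "is")
  then show ?case
    using functional_add[OF m, of "f i" "\<lambda>x. \<Sum>i\<leftarrow>is. f i x"] cc_sum_list[OF h, of "is" f] by simp
qed

lemma functional_nat_scale:
  assumes m: "invariant_functional N m" and f: "f \<in> cc N"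
  shows "m (\<lambda>x. real n * f x) = real n * m f"
  using functional_sum_list[OF m f, of "replicate n ()" "\<lambda>_. f"] f
  by (simp add: sum_list_replicate)

lemma functional_inverse_scale:
  assumes m: "invariant_functional N m" and f: "f \<in> cc N" and n: "n > 0"
  shows "m (\<lambda>x. f x / real n) = m f / real n"
proof -
  have g: "(\<lambda>x. f x / real n) \<in> cc N" using cc_scale[OF f, of "1 / real n"] by simp
  then show ?thesis using functional_nat_scale[OF m g, of n] n by (simp add: field_simps)
qed

text \<open>Some f with m f > 0 is dominated by finitely many translates of v, and each of these has
  mass m v.\<close>

lemma functional_pos:
  assumes N: "admissible N" and m: "invariant_functional N m"
    and v: "v \<in> cc N" and x0: "x0 \<in> carrier G" "v x0 > 0"
  shows "m v > 0"
proof -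
  obtain f where f: "f \<in> cc N" "m f \<noteq> 0" using m unfolding invariant_functional_def by blast
  then have mf: "m f > 0" using functional_nonneg[OF m f(1)] by simp
  obtain gs where gs: "set gs \<subseteq> carrier G" "\<And>x. x \<in> carrier G \<Longrightarrow> f x \<le> (\<Sum>g\<leftarrow>gs. v (x \<otimes> g))"
    using cc_covered[OF N f(1) v x0] by blast
  have cc: "(\<lambda>x. v (x \<otimes> g)) \<in> cc N" if "g \<in> set gs" for g using cc_translate[OF N v] that gs by auto
  have "m f \<le> m (\<lambda>x. \<Sum>g\<leftarrow>gs. v (x \<otimes> g))"
    by (rule functional_mono[OF m f(1) cc_sum_list[OF v cc] gs(2)])
  also have "\<dots> = (\<Sum>g\<leftarrow>gs. m (\<lambda>x. v (x \<otimes> g)))" by (rule functional_sum_list[OF m v cc])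
  also have "\<dots> = (\<Sum>g\<leftarrow>gs. m v)"
    using gs(1) functional_translate[OF m v] by (intro arg_cong[where f = sum_list] map_cong) auto
  also have "\<dots> = real (length gs) * m v" by (simp add: sum_list_triv)
  finally show ?thesis using mf functional_nonneg[OF m v] by (cases "m v = 0") auto
qed

section \<open>Bump functions at the identity and left uniform continuity\<close>

lemma cc_bump:
  assumes N: "admissible N" and V: "openin T V" "\<one> \<in> V" and sat: "\<And>x n. x \<in> V \<Longrightarrow> n \<in> N \<Longrightarrow> x \<otimes> n \<in> V"
  obtains \<phi> where "\<phi> \<in> cc N" "\<phi> \<one> > 0" "\<And>x. x \<in> carrier G \<Longrightarrow> x \<notin> V \<Longrightarrow> \<phi> x = 0"
proof -
  have C1: "compactin T {\<one>}" by (simp add: topspace_T)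
  obtain f D where f: "f \<in> cc N" "\<And>x. x \<in> {\<one>} \<Longrightarrow> f x = 1" "D \<subseteq> V"
    "\<And>x. x \<in> carrier G \<Longrightarrow> f x \<noteq> 0 \<Longrightarrow> x \<in> D <#> N"
    using urysohn_cc[OF N C1 V(1) _ sat] V(2) by (metis empty_subsetI insert_subset)
  show thesis
  proof (rule that[OF f(1)])
    show "f x = 0" if "x \<in> carrier G" "x \<notin> V" for x
      using f(4)[OF that(1)] that(2) f(3) sat by (auto simp: set_mult_def)
  qed (use f(2) in auto)
qed

text \<open>The hypotheses \<open>mult\<close> and \<open>divc\<close> are what a topological group
  G/N provides, phrased with functions and compact sets in G only. For v in the compact
  neighbourhood \<open>D\<close> of the identity, all functions y \<mapsto> h (v y) are supported in
  one fixed E N, so a tube over the compact set E gives uniformity in every y.\<close>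

lemma left_uniform:
  assumes N: "admissible N" and h: "h \<in> cc N" and d: "\<delta> > 0"
    and mult: "continuous_map (prod_topology T T) euclideanreal (\<lambda>(x, y). h (x \<otimes> y))"
    and divc: "\<And>C D. compactin T C \<Longrightarrow> compactin T D \<Longrightarrow>
      \<exists>E. compactin T E \<and> (\<forall>c\<in>C. \<forall>d\<in>D. inv c \<otimes> d \<in> E <#> N)"
  obtains V where "openin T V" "\<one> \<in> V" "\<And>x n. x \<in> V \<Longrightarrow> n \<in> N \<Longrightarrow> x \<otimes> n \<in> V"
    "\<And>v y. v \<in> V \<Longrightarrow> y \<in> carrier G \<Longrightarrow> \<bar>h (v \<otimes> y) - h y\<bar> \<le> \<delta>"
proof -
  obtain W D where W: "openin T W" "compactin T D" "\<one> \<in> W" "W \<subseteq> D"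
    using lc unfolding locally_compact_space_def topspace_T by (meson one_closed)
  obtain S where S: "compactin T S" "\<And>x. x \<in> carrier G \<Longrightarrow> h x \<noteq> 0 \<Longrightarrow> x \<in> S <#> N"
    using cc_supp[OF h] by blast
  obtain E where E: "compactin T E" "\<forall>c\<in>D. \<forall>d\<in>S. inv c \<otimes> d \<in> E <#> N"
    using divc[OF W(2) S(1)] by blast
  have Ec: "E \<subseteq> carrier G" using carrier_compactin[OF E(1)] by auto
  have off: "h (v \<otimes> y) = 0" if v: "v \<in> D" and y: "y \<in> carrier G" "y \<notin> E <#> N" for v y
  proof (rule ccontr)
    assume "h (v \<otimes> y) \<noteq> 0"
    have vc: "v \<in> carrier G" using v carrier_compactin[OF W(2)] by auto
    then obtain s n where sn: "s \<in> S" "n \<in> N" "v \<otimes> y = s \<otimes> n"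
      using S(2)[of "v \<otimes> y"] \<open>h (v \<otimes> y) \<noteq> 0\<close> y by (auto simp: set_mult_def)
    have c: "s \<in> carrier G" "n \<in> carrier G" using sn carrier_compactin[OF S(1)] admissible_subset[OF N] by auto
    have "y = inv v \<otimes> (v \<otimes> y)" using vc y by (simp flip: m_assoc)
    also have "\<dots> = inv v \<otimes> s \<otimes> n" using sn vc c by (simp add: m_assoc)
    finally have "y = inv v \<otimes> s \<otimes> n" .
    then show False using set_mult_closed_right[OF N Ec, of "inv v \<otimes> s" n] E(2) v sn y by auto
  qed
  have cont: "continuous_map (prod_topology T T) euclideanreal (\<lambda>(x, v). h (v \<otimes> x))"
    using continuous_map_compose[OF _ mult, of "prod_topology T T" "\<lambda>p. (snd p, fst p)"]
    by (simp add: o_def continuous_map_pairedI continuous_map_fst continuous_map_snd case_prod_unfold)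
  obtain V where V: "openin T V" "\<one> \<in> V" "\<And>x v. x \<in> E \<Longrightarrow> v \<in> V \<Longrightarrow> \<bar>h (v \<otimes> x) - h (\<one> \<otimes> x)\<bar> < \<delta>"
    using continuous_map_tube[OF cont E(1), of \<one> \<delta>] d by (auto simp: topspace_T)
  define V' where "V' = (V \<inter> W) <#> N"
  have VWc: "V \<inter> W \<subseteq> carrier G" using carrier_openin[OF V(1)] by auto
  have key: "\<bar>h (v \<otimes> y) - h y\<bar> \<le> \<delta>" if v: "v \<in> V \<inter> W" and y: "y \<in> carrier G" for v y
  proof (cases "y \<in> E <#> N")
    case False
    moreover have "v \<in> D" "\<one> \<in> D" using v W by auto
    ultimately show ?thesis using off[of v y] off[of \<one> y] y d by simp
  next
    case True
    then obtain e n where en: "e \<in> E" "n \<in> N" "y = e \<otimes> n" by (auto simp: set_mult_def)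
    then have "h y = h e" "h (v \<otimes> y) = h (v \<otimes> e)"
      using cc_inv[OF h, of e n] cc_inv[OF h, of "v \<otimes> e" n] Ec VWc v admissible_subset[OF N]
      by (auto simp: m_assoc subset_iff)
    then show ?thesis using V(3)[OF en(1), of v] v Ec en by (auto simp: subset_iff)
  qed
  show thesis
  proof (rule that[of V'])
    show "openin T V'" unfolding V'_def using V W admissible_subset[OF N] by (intro openin_set_mult) auto
    show "\<one> \<in> V'" unfolding V'_def using subset_set_mult[OF N VWc] V W by auto
    show "x \<otimes> n \<in> V'" if "x \<in> V'" "n \<in> N" for x n
      using set_mult_closed_right[OF N VWc] that unfolding V'_def by auto
    fix v y assume v: "v \<in> V'" and y: "y \<in> carrier G"
    obtain w n where w: "w \<in> V \<inter> W" "n \<in> N" "v = w \<otimes> n" using v by (auto simp: V'_def set_mult_def)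
    have c: "w \<in> carrier G" "n \<in> carrier G" using w VWc admissible_subset[OF N] by auto
    \<comment> \<open>Enlarging the neighbourhood by N changes nothing: the factor n moves to the
      right of y as a conjugate, which lies in N, and h is N-invariant.\<close>
    have "v \<otimes> y = (w \<otimes> y) \<otimes> (inv y \<otimes> n \<otimes> y)"
      using w(3) c y by (simp add: m_assoc) (simp flip: m_assoc)
    then have "h (v \<otimes> y) = h (w \<otimes> y)"
      using cc_inv[OF h, of "w \<otimes> y"] admissible_conj'[OF N w(2) y] c y by simp
    then show "\<bar>h (v \<otimes> y) - h y\<bar> \<le> \<delta>" using key[OF w(1) y] by simp
  qed
qed

section \<open>Covering numbers\<close>

definition covers :: "('a \<Rightarrow> real) \<Rightarrow> ('a \<Rightarrow> real) \<Rightarrow> (real \<times> 'a) list \<Rightarrow> bool" where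
  "covers \<phi> f l \<longleftrightarrow> (\<forall>p\<in>set l. 0 \<le> fst p \<and> snd p \<in> carrier G) \<and>
     (\<forall>x\<in>carrier G. f x \<le> (\<Sum>p\<leftarrow>l. fst p * \<phi> (x \<otimes> snd p)))"

text \<open>This is Weil's covering number (f : \<phi>); a covering is encoded as a list of pairs of
  a coefficient and a translating element.\<close>

definition cov :: "('a \<Rightarrow> real) \<Rightarrow> ('a \<Rightarrow> real) \<Rightarrow> real" where
  "cov \<phi> f = Inf {(\<Sum>p\<leftarrow>l. fst p) |l. covers \<phi> f l}"

lemma covers_sum_nonneg: "covers \<phi> f l \<Longrightarrow> 0 \<le> (\<Sum>p\<leftarrow>l. fst p)"
  by (intro sum_list_nonneg) (auto simp: covers_def)

lemma covers_exists:
  assumes N: "admissible N" and f: "f \<in> cc N" and v: "\<phi> \<in> cc N" and x0: "x0 \<in> carrier G" "\<phi> x0 > 0"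
  shows "\<exists>l. covers \<phi> f l"
proof -
  obtain gs where "set gs \<subseteq> carrier G" "\<And>x. x \<in> carrier G \<Longrightarrow> f x \<le> (\<Sum>g\<leftarrow>gs. \<phi> (x \<otimes> g))"
    using cc_covered[OF N f v x0] by blast
  then have "covers \<phi> f (map (\<lambda>g. (1, g)) gs)" by (auto simp: covers_def o_def)
  then show ?thesis ..
qed

lemma cov_le: "covers \<phi> f l \<Longrightarrow> cov \<phi> f \<le> (\<Sum>p\<leftarrow>l. fst p)"
  unfolding cov_def by (intro cInf_lower bdd_belowI[of _ 0]) (auto simp: covers_sum_nonneg)

lemma cov_greatest:
  assumes "covers \<phi> f l0" "\<And>l. covers \<phi> f l \<Longrightarrow> b \<le> (\<Sum>p\<leftarrow>l. fst p)"
  shows "b \<le> cov \<phi> f"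
  unfolding cov_def using assms by (intro cInf_greatest) auto

lemma cov_approx:
  assumes "covers \<phi> f l0" "\<epsilon> > 0"
  obtains l where "covers \<phi> f l" "(\<Sum>p\<leftarrow>l. fst p) < cov \<phi> f + \<epsilon>"
proof (rule ccontr)
  assume "\<not> thesis"
  then have "cov \<phi> f + \<epsilon> \<le> (\<Sum>p\<leftarrow>l. fst p)" if "covers \<phi> f l" for l using that not_less \<open>\<And>l. \<lbrakk>covers \<phi> f l; (\<Sum>p\<leftarrow>l. fst p) < cov \<phi> f + \<epsilon>\<rbrakk> \<Longrightarrow> thesis\<close> by blast
  then have "cov \<phi> f + \<epsilon> \<le> cov \<phi> f" using cov_greatest[OF assms(1)] by blast
  then show False using assms(2) by simp
qed

lemma cov_nonneg: "covers \<phi> f l \<Longrightarrow> 0 \<le> cov \<phi> f"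
  using cov_greatest covers_sum_nonneg by blast

lemma cov_mono:
  assumes "covers \<phi> g l" "\<And>x. x \<in> carrier G \<Longrightarrow> f x \<le> g x"
  shows "cov \<phi> f \<le> cov \<phi> g"
proof (rule cov_greatest[OF assms(1)])
  fix l assume "covers \<phi> g l"
  then have "covers \<phi> f l" using assms(2) by (fastforce simp: covers_def)
  then show "cov \<phi> f \<le> (\<Sum>p\<leftarrow>l. fst p)" by (rule cov_le)
qed

lemma covers_append: "covers \<phi> f k \<Longrightarrow> covers \<phi> g l \<Longrightarrow> covers \<phi> (\<lambda>x. f x + g x) (k @ l)"
  by (auto simp: covers_def intro!: add_mono)

lemma cov_add:
  assumes "covers \<phi> f k" "covers \<phi> g l"
  shows "cov \<phi> (\<lambda>x. f x + g x) \<le> cov \<phi> f + cov \<phi> g"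
proof (rule field_le_epsilon)
  fix e :: real assume "e > 0"
  then have e2: "e / 2 > 0" by simp
  obtain k' where k: "covers \<phi> f k'" "(\<Sum>p\<leftarrow>k'. fst p) < cov \<phi> f + e / 2" using cov_approx[OF assms(1) e2] .
  obtain l' where l: "covers \<phi> g l'" "(\<Sum>p\<leftarrow>l'. fst p) < cov \<phi> g + e / 2" using cov_approx[OF assms(2) e2] .
  show "cov \<phi> (\<lambda>x. f x + g x) \<le> cov \<phi> f + cov \<phi> g + e"
    using cov_le[OF covers_append[OF k(1) l(1)]] k(2) l(2) by simp
qed

lemma covers_scale:
  assumes "covers \<phi> f l" "c \<ge> 0"
  shows "covers \<phi> (\<lambda>x. c * f x) (map (\<lambda>p. (c * fst p, snd p)) l)"
proof -
  have "(\<Sum>p\<leftarrow>l. c * fst p * \<phi> (x \<otimes> snd p)) = c * (\<Sum>p\<leftarrow>l. fst p * \<phi> (x \<otimes> snd p))" for x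
    by (simp add: mult.assoc sum_list_const_mult)
  then show ?thesis using assms by (auto simp: covers_def o_def intro!: mult_left_mono)
qed

lemma cov_scale:
  assumes "covers \<phi> f l" "c \<ge> 0"
  shows "cov \<phi> (\<lambda>x. c * f x) \<le> c * cov \<phi> f"
proof (cases "c = 0")
  case True
  have "covers \<phi> (\<lambda>x. c * f x) []" using True by (simp add: covers_def)
  from cov_le[OF this] show ?thesis using True by simp
next
  case False
  then have c: "c > 0" using assms(2) by simp
  have "cov \<phi> (\<lambda>x. c * f x) / c \<le> cov \<phi> f"
  proof (rule cov_greatest[OF assms(1)])
    fix l assume "covers \<phi> f l"
    from cov_le[OF covers_scale[OF this assms(2)]]
    have "cov \<phi> (\<lambda>x. c * f x) \<le> c * (\<Sum>p\<leftarrow>l. fst p)" by (simp add: o_def sum_list_const_mult)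
    then show "cov \<phi> (\<lambda>x. c * f x) / c \<le> (\<Sum>p\<leftarrow>l. fst p)" using c by (simp add: field_simps)
  qed
  then show ?thesis using c by (simp add: field_simps)
qed

lemma covers_translate:
  assumes "covers \<phi> f l" and g: "g \<in> carrier G"
  shows "covers \<phi> (\<lambda>x. f (x \<otimes> g)) (map (\<lambda>p. (fst p, g \<otimes> snd p)) l)"
  unfolding covers_def
proof (intro conjI ballI)
  fix x assume x: "x \<in> carrier G"
  have "f (x \<otimes> g) \<le> (\<Sum>p\<leftarrow>l. fst p * \<phi> (x \<otimes> g \<otimes> snd p))" using assms x by (auto simp: covers_def)
  also have "\<dots> = (\<Sum>p\<leftarrow>map (\<lambda>p. (fst p, g \<otimes> snd p)) l. fst p * \<phi> (x \<otimes> snd p))"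
    unfolding map_map using assms x
    by (intro arg_cong[where f = sum_list] map_cong) (auto simp: covers_def m_assoc)
  finally show "f (x \<otimes> g) \<le> \<dots>" .
qed (use assms in \<open>auto simp: covers_def\<close>)

lemma cov_translate_le:
  assumes "covers \<phi> f l" and g: "g \<in> carrier G"
  shows "cov \<phi> (\<lambda>x. f (x \<otimes> g)) \<le> cov \<phi> f"
proof (rule cov_greatest[OF assms(1)])
  fix l assume "covers \<phi> f l"
  from cov_le[OF covers_translate[OF this g]] show "cov \<phi> (\<lambda>x. f (x \<otimes> g)) \<le> (\<Sum>p\<leftarrow>l. fst p)"
    by (simp add: o_def)
qed

lemma cov_translate:
  assumes "covers \<phi> f l" and g: "g \<in> carrier G"
  shows "cov \<phi> (\<lambda>x. f (x \<otimes> g)) = cov \<phi> f"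
proof (rule antisym[OF cov_translate_le[OF assms]])
  have "cov \<phi> f \<le> cov \<phi> (\<lambda>x. f (x \<otimes> inv g \<otimes> g))"
  proof (rule cov_mono)
    show "covers \<phi> (\<lambda>x. f (x \<otimes> inv g \<otimes> g)) (map (\<lambda>p. (fst p, inv g \<otimes> snd p)) (map (\<lambda>p. (fst p, g \<otimes> snd p)) l))"
      using covers_translate[OF covers_translate[OF assms], of "inv g"] g by simp
  qed (use g in \<open>simp add: m_assoc\<close>)
  also have "\<dots> \<le> cov \<phi> (\<lambda>x. f (x \<otimes> g))"
    using cov_translate_le[OF covers_translate[OF assms], of "inv g"] g by simp
  finally show "cov \<phi> f \<le> cov \<phi> (\<lambda>x. f (x \<otimes> g))" .
qed

lemma covers_trans:
  assumes k: "covers \<psi> f k" and l: "covers \<phi> \<psi> l"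
  shows "covers \<phi> f (concat (map (\<lambda>p. map (\<lambda>q. (fst p * fst q, snd p \<otimes> snd q)) l) k))"
proof -
  have "(\<Sum>p\<leftarrow>k. fst p * \<psi> (x \<otimes> snd p))
      \<le> (\<Sum>p\<leftarrow>concat (map (\<lambda>p. map (\<lambda>q. (fst p * fst q, snd p \<otimes> snd q)) l) k). fst p * \<phi> (x \<otimes> snd p))"
    if x: "x \<in> carrier G" and "\<forall>p\<in>set k. 0 \<le> fst p \<and> snd p \<in> carrier G" for x
    using that(2)
  proof (induction k)
    case (Cons p k)
    have p: "0 \<le> fst p" "snd p \<in> carrier G" using Cons.prems by auto
    have "\<psi> (x \<otimes> snd p) \<le> (\<Sum>q\<leftarrow>l. fst q * \<phi> (x \<otimes> snd p \<otimes> snd q))" using l x p by (auto simp: covers_def)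
    then have "fst p * \<psi> (x \<otimes> snd p) \<le> fst p * (\<Sum>q\<leftarrow>l. fst q * \<phi> (x \<otimes> snd p \<otimes> snd q))"
      using p by (intro mult_left_mono) auto
    also have "\<dots> = (\<Sum>q\<leftarrow>l. fst p * fst q * \<phi> (x \<otimes> (snd p \<otimes> snd q)))"
      unfolding sum_list_const_mult[symmetric] using l x p
      by (intro arg_cong[where f = sum_list] map_cong) (auto simp: covers_def m_assoc)
    finally show ?case using Cons by (auto simp: o_def intro!: add_mono)
  qed simp
  then show ?thesis using k l unfolding covers_def by (fastforce intro: mult_nonneg_nonneg)
qed

text \<open>Substituting a covering of \<psi> into a covering of f multiplies the sums of
  coefficients. The estimate later bounds the normalised covering numbers independently of
  \<phi>.\<close>

lemma cov_trans:
  assumes k: "covers \<psi> f k" and l: "covers \<phi> \<psi> l"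
  shows "cov \<phi> f \<le> cov \<psi> f * cov \<phi> \<psi>"
proof -
  have 1: "cov \<phi> f \<le> (\<Sum>p\<leftarrow>k. fst p) * (\<Sum>p\<leftarrow>l. fst p)" if "covers \<psi> f k" "covers \<phi> \<psi> l" for k l
  proof -
    have "(\<Sum>p\<leftarrow>concat (map (\<lambda>p. map (\<lambda>q. (fst p * fst q, snd p \<otimes> snd q)) l) k). fst p)
        = (\<Sum>p\<leftarrow>k. fst p) * (\<Sum>p\<leftarrow>l. fst p)"
      by (induction k) (auto simp: o_def sum_list_const_mult algebra_simps)
    then show ?thesis using cov_le[OF covers_trans[OF that]] by simp
  qed
  have 2: "cov \<phi> f \<le> (\<Sum>p\<leftarrow>k. fst p) * cov \<phi> \<psi>" if kk: "covers \<psi> f k" for k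
  proof (cases "(\<Sum>p\<leftarrow>k. fst p) = 0")
    case True
    then show ?thesis using 1[OF kk l] by simp
  next
    case False
    then have s: "(\<Sum>p\<leftarrow>k. fst p) > 0" using covers_sum_nonneg[OF kk] by simp
    have "cov \<phi> f / (\<Sum>p\<leftarrow>k. fst p) \<le> cov \<phi> \<psi>"
      using 1[OF kk] s by (intro cov_greatest[OF l]) (simp add: field_simps)
    then show ?thesis using s by (simp add: field_simps)
  qed
  show ?thesis
  proof (cases "cov \<phi> \<psi> = 0")
    case True
    then show ?thesis using 2[OF k] by simp
  next
    case False
    then have s: "cov \<phi> \<psi> > 0" using cov_nonneg[OF l] by simp
    have "cov \<phi> f / cov \<phi> \<psi> \<le> cov \<psi> f"
      using 2 s by (intro cov_greatest[OF k]) (simp add: field_simps)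
    then show ?thesis using s by (simp add: field_simps)
  qed
qed

text \<open>Evaluation at x shows that the coefficients of any covering sum to at least f x divided
  by the bound of \<phi>.\<close>

lemma cov_pos:
  assumes N: "admissible N" and \<phi>: "\<phi> \<in> cc N" and l: "covers \<phi> f l" and x: "x \<in> carrier G" "f x > 0"
  shows "cov \<phi> f > 0"
proof -
  obtain B where B: "B > 0" "\<And>x. x \<in> carrier G \<Longrightarrow> \<phi> x \<le> B" using cc_bounded[OF N \<phi>] by blast
  have "f x / B \<le> cov \<phi> f"
  proof (rule cov_greatest[OF l])
    fix l assume l: "covers \<phi> f l"
    then have "f x \<le> (\<Sum>p\<leftarrow>l. fst p * \<phi> (x \<otimes> snd p))" using x by (auto simp: covers_def)
    also have "\<dots> \<le> (\<Sum>p\<leftarrow>l. fst p * B)"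
      using l x B(2) by (intro sum_list_mono mult_left_mono) (auto simp: covers_def)
    also have "\<dots> = (\<Sum>p\<leftarrow>l. fst p) * B" by (simp add: sum_list_mult_const)
    finally show "f x / B \<le> (\<Sum>p\<leftarrow>l. fst p)" using B by (simp add: field_simps)
  qed
  moreover have "f x / B > 0" using x B by simp
  ultimately show ?thesis by linarith
qed

text \<open>Here f is a slight enlargement of f1 + f2, and the quotients of f1 and f2 by it are left
  uniformly continuous. For \<phi> supported in V a covering of f is therefore split between f1 and
  f2 by weighting each coefficient with the value of the quotient at the inverse of its translating
  element. The error is measured in units of \<open>cov \<phi> f0\<close>, which is the later
  normalisation.\<close>

lemma cov_almost_additive:
  assumes N: "admissible N" and f1: "f1 \<in> cc N" and f2: "f2 \<in> cc N" and f0: "f0 \<in> cc N" "x0 \<in> carrier G" "f0 x0 > 0"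
    and e: "\<epsilon> > 0"
    and mult: "\<And>h. h \<in> cc N \<Longrightarrow> continuous_map (prod_topology T T) euclideanreal (\<lambda>(x, y). h (x \<otimes> y))"
    and divc: "\<And>C D. compactin T C \<Longrightarrow> compactin T D \<Longrightarrow>
      \<exists>E. compactin T E \<and> (\<forall>c\<in>C. \<forall>d\<in>D. inv c \<otimes> d \<in> E <#> N)"
  obtains V where "openin T V" "\<one> \<in> V" "\<And>x n. x \<in> V \<Longrightarrow> n \<in> N \<Longrightarrow> x \<otimes> n \<in> V"
    "\<And>\<phi> x. \<phi> \<in> cc N \<Longrightarrow> x \<in> carrier G \<Longrightarrow> \<phi> x > 0 \<Longrightarrow> (\<And>x. x \<in> carrier G \<Longrightarrow> x \<notin> V \<Longrightarrow> \<phi> x = 0) \<Longrightarrow>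
       cov \<phi> f1 + cov \<phi> f2 \<le> cov \<phi> (\<lambda>x. f1 x + f2 x) + \<epsilon> * cov \<phi> f0"
proof -
  have f12: "(\<lambda>x. f1 x + f2 x) \<in> cc N" using cc_add[OF f1 f2] .
  obtain C where C: "compactin T C" "\<And>x. x \<in> carrier G \<Longrightarrow> f1 x + f2 x \<noteq> 0 \<Longrightarrow> x \<in> C <#> N"
    using cc_supp[OF f12] by blast
  have Cc: "C \<subseteq> carrier G" using carrier_compactin[OF C(1)] by auto
  have opc: "openin T (carrier G)" using openin_topspace[of T] topspace_T by simp
  obtain F where F: "F \<in> cc N" "\<And>x. x \<in> C \<Longrightarrow> F x = 1"
    using urysohn_cc[OF N C(1) opc Cc] admissible_subset[OF N] by (metis m_closed)
  have F1: "F x = 1" if x: "x \<in> C <#> N" for x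
  proof -
    obtain c n where "c \<in> C" "n \<in> N" "x = c \<otimes> n" using x by (auto simp: set_mult_def)
    then show ?thesis using F(2) cc_inv[OF F(1)] Cc by (auto simp: subset_iff)
  qed
  obtain l12 where l12: "covers f0 (\<lambda>x. f1 x + f2 x) l12" using covers_exists[OF N f12 f0] by blast
  obtain lF where lF: "covers f0 F lF" using covers_exists[OF N F(1) f0] by blast
  define \<alpha> where "\<alpha> = cov f0 (\<lambda>x. f1 x + f2 x)"
  define \<beta> where "\<beta> = cov f0 F"
  have ab: "\<alpha> \<ge> 0" "\<beta> \<ge> 0" unfolding \<alpha>_def \<beta>_def using cov_nonneg l12 lF by auto
  \<comment> \<open>The final estimate expands (1 + 2\<delta>)(a + \<delta> b) and bounds it by a +
    \<delta> (2a + 3b) using \<delta> \<le> 1, where a \<le> \<alpha> s and b \<le> \<beta> s for s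
    = \<open>cov \<phi> f0\<close>. The summand 1 keeps the denominator positive.\<close>
  define \<delta> where "\<delta> = min 1 (\<epsilon> / (2 * \<alpha> + 3 * \<beta> + 1))"
  have d: "\<delta> > 0" "\<delta> \<le> 1" "\<delta> * (2 * \<alpha> + 3 * \<beta>) \<le> \<epsilon>"
  proof -
    show "\<delta> > 0" "\<delta> \<le> 1" using ab e by (auto simp: \<delta>_def add_nonneg_pos)
    have "\<delta> * (2 * \<alpha> + 3 * \<beta>) \<le> \<epsilon> / (2 * \<alpha> + 3 * \<beta> + 1) * (2 * \<alpha> + 3 * \<beta> + 1)"
      using ab e by (intro mult_mono) (auto simp: \<delta>_def)
    also have "\<dots> = \<epsilon>" using ab by simp
    finally show "\<delta> * (2 * \<alpha> + 3 * \<beta>) \<le> \<epsilon>" .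
  qed
  define f where "f = (\<lambda>x. f1 x + f2 x + \<delta> * F x)"
  have dF: "(\<lambda>x. \<delta> * F x) \<in> cc N" using cc_scale[OF F(1)] d by simp
  have f: "f \<in> cc N" unfolding f_def using cc_add[OF f12 dF] .
  text \<open>Dividing by \<open>max f \<delta>\<close> instead of \<open>f\<close> keeps the quotients continuous where \<open>f\<close> vanishes.\<close>
  define h where "h = (\<lambda>g x. g x / max (f x) \<delta> :: real)"
  have hcc: "h g \<in> cc N" and hle: "\<And>x. x \<in> carrier G \<Longrightarrow> g x \<le> h g x * f x"
    if g: "g \<in> cc N" "\<And>x. x \<in> carrier G \<Longrightarrow> g x \<le> f1 x + f2 x" for g
  proof -
    have nz: "max (f x) \<delta> \<noteq> 0" for x using d by auto
    have "continuous_map T euclideanreal (\<lambda>x. max (f x) \<delta>)"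
      using cc_cont[OF f] by (intro continuous_map_real_max) auto
    then show "h g \<in> cc N"
      unfolding h_def using nz d cc_nonneg[OF g(1)] cc_inv[OF g(1)] cc_inv[OF f] cc_cont[OF g(1)]
      by (intro cc_dominated[OF g(1)]) (auto intro!: continuous_map_real_divide divide_nonneg_nonneg simp: le_max_iff_disj)
    show "g x \<le> h g x * f x" if x: "x \<in> carrier G" for x
    proof (cases "x \<in> C <#> N")
      case True
      then have "f x \<ge> \<delta>" using F1[OF True] cc_nonneg[OF f12 x] by (simp add: f_def)
      then show ?thesis using d by (simp add: h_def max_def)
    next
      case False
      then have "f1 x + f2 x = 0" using C(2)[OF x] by blast
      then have "g x \<le> 0" using g(2)[OF x] by simp
      then have "g x = 0" using cc_nonneg[OF g(1) x] by simp
      then show ?thesis by (simp add: h_def)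
    qed
  qed
  have 1: "f1 x \<le> f1 x + f2 x" "f2 x \<le> f1 x + f2 x" if "x \<in> carrier G" for x
    using cc_nonneg[OF f1 that] cc_nonneg[OF f2 that] by auto
  note h1 = hcc[OF f1 1(1)] hle[OF f1 1(1)] and h2 = hcc[OF f2 1(2)] hle[OF f2 1(2)]
  have hsum: "h f1 x + h f2 x \<le> 1" if "x \<in> carrier G" for x
  proof -
    have "f1 x + f2 x \<le> max (f x) \<delta>" using cc_nonneg[OF dF that] by (simp add: f_def)
    then show ?thesis using d by (simp add: h_def flip: add_divide_distrib)
  qed
  obtain V1 where V1: "openin T V1" "\<one> \<in> V1" "\<And>x n. x \<in> V1 \<Longrightarrow> n \<in> N \<Longrightarrow> x \<otimes> n \<in> V1"
    "\<And>v y. v \<in> V1 \<Longrightarrow> y \<in> carrier G \<Longrightarrow> \<bar>h f1 (v \<otimes> y) - h f1 y\<bar> \<le> \<delta>"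
    using left_uniform[OF N h1(1) d(1) mult[OF h1(1)] divc] by blast
  obtain V2 where V2: "openin T V2" "\<one> \<in> V2" "\<And>x n. x \<in> V2 \<Longrightarrow> n \<in> N \<Longrightarrow> x \<otimes> n \<in> V2"
    "\<And>v y. v \<in> V2 \<Longrightarrow> y \<in> carrier G \<Longrightarrow> \<bar>h f2 (v \<otimes> y) - h f2 y\<bar> \<le> \<delta>"
    using left_uniform[OF N h2(1) d(1) mult[OF h2(1)] divc] by blast
  show thesis
  proof (rule that[of "V1 \<inter> V2"])
    fix \<phi> x1 assume \<phi>: "\<phi> \<in> cc N" "x1 \<in> carrier G" "\<phi> x1 > 0"
      and supp: "\<And>x. x \<in> carrier G \<Longrightarrow> x \<notin> V1 \<inter> V2 \<Longrightarrow> \<phi> x = 0"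
    note ex = covers_exists[OF N _ \<phi>]
    \<comment> \<open>Let s be the translating element of a term. If \<phi> (x s) is nonzero then x
      s lies in V, so the quotient at x = (x s) inv s differs by at most \<delta> from its value at
      inv s. This makes the new coefficients independent of x.\<close>
    have part: "covers \<phi> g (map (\<lambda>p. (fst p * (h g (inv (snd p)) + \<delta>), snd p)) l)"
      if l: "covers \<phi> f l" and g: "g \<in> cc N" "h g \<in> cc N" "\<And>x. x \<in> carrier G \<Longrightarrow> g x \<le> h g x * f x"
        "\<And>v y. v \<in> V1 \<inter> V2 \<Longrightarrow> y \<in> carrier G \<Longrightarrow> \<bar>h g (v \<otimes> y) - h g y\<bar> \<le> \<delta>" for g l
      unfolding covers_def
    proof (intro conjI ballI)
      fix x assume x: "x \<in> carrier G"
      have "g x \<le> h g x * (\<Sum>p\<leftarrow>l. fst p * \<phi> (x \<otimes> snd p))"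
        using g(3)[OF x] l x cc_nonneg[OF g(2) x] unfolding covers_def
        by (meson mult_left_mono order_trans)
      also have "\<dots> = (\<Sum>p\<leftarrow>l. h g x * (fst p * \<phi> (x \<otimes> snd p)))" by (simp add: sum_list_const_mult)
      also have "\<dots> \<le> (\<Sum>p\<leftarrow>l. fst p * (h g (inv (snd p)) + \<delta>) * \<phi> (x \<otimes> snd p))"
      proof (rule sum_list_mono)
        fix p assume "p \<in> set l"
        then have p: "0 \<le> fst p" "snd p \<in> carrier G" using l by (auto simp: covers_def)
        show "h g x * (fst p * \<phi> (x \<otimes> snd p)) \<le> fst p * (h g (inv (snd p)) + \<delta>) * \<phi> (x \<otimes> snd p)"
        proof (cases "\<phi> (x \<otimes> snd p) = 0")
          case False
          then have "x \<otimes> snd p \<in> V1 \<inter> V2" using supp x p by blast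
          from g(4)[OF this, of "inv (snd p)"] have "h g x \<le> h g (inv (snd p)) + \<delta>"
            using x p by (simp add: m_assoc)
          then have "h g x * (fst p * \<phi> (x \<otimes> snd p)) \<le> (h g (inv (snd p)) + \<delta>) * (fst p * \<phi> (x \<otimes> snd p))"
            using x p cc_nonneg[OF \<phi>(1)] by (intro mult_right_mono) auto
          then show ?thesis by (simp add: ac_simps)
        qed simp
      qed
      finally show "g x \<le> (\<Sum>p\<leftarrow>map (\<lambda>p. (fst p * (h g (inv (snd p)) + \<delta>), snd p)) l. fst p * \<phi> (x \<otimes> snd p))"
        by (simp add: o_def)
    qed (use l cc_nonneg[OF g(2)] d in \<open>auto simp: covers_def intro!: mult_nonneg_nonneg add_nonneg_nonneg\<close>)
    have le: "(cov \<phi> f1 + cov \<phi> f2) / (1 + 2 * \<delta>) \<le> cov \<phi> f"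
    proof -
      obtain l0 where "covers \<phi> f l0" using ex[OF f] by blast
      then show ?thesis
      proof (rule cov_greatest)
        fix l assume l: "covers \<phi> f l"
        have "cov \<phi> f1 \<le> (\<Sum>p\<leftarrow>l. fst p * (h f1 (inv (snd p)) + \<delta>))"
          using cov_le[OF part[OF l f1 h1]] V1(4) by (simp add: o_def)
        moreover have "cov \<phi> f2 \<le> (\<Sum>p\<leftarrow>l. fst p * (h f2 (inv (snd p)) + \<delta>))"
          using cov_le[OF part[OF l f2 h2]] V2(4) by (simp add: o_def)
        ultimately have "cov \<phi> f1 + cov \<phi> f2 \<le>
            (\<Sum>p\<leftarrow>l. fst p * (h f1 (inv (snd p)) + \<delta>) + fst p * (h f2 (inv (snd p)) + \<delta>))"
          by (simp add: sum_list_addf)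
        also have "\<dots> \<le> (\<Sum>p\<leftarrow>l. fst p * (1 + 2 * \<delta>))"
        proof (rule sum_list_mono)
          fix p assume "p \<in> set l"
          then have p: "0 \<le> fst p" "snd p \<in> carrier G" using l by (auto simp: covers_def)
          have "fst p * (h f1 (inv (snd p)) + h f2 (inv (snd p)) + 2 * \<delta>) \<le> fst p * (1 + 2 * \<delta>)"
            using hsum[of "inv (snd p)"] p by (intro mult_left_mono) auto
          then show "fst p * (h f1 (inv (snd p)) + \<delta>) + fst p * (h f2 (inv (snd p)) + \<delta>) \<le> fst p * (1 + 2 * \<delta>)"
            by (simp add: algebra_simps)
        qed
        also have "\<dots> = (\<Sum>p\<leftarrow>l. fst p) * (1 + 2 * \<delta>)" by (simp add: sum_list_mult_const)
        finally show "(cov \<phi> f1 + cov \<phi> f2) / (1 + 2 * \<delta>) \<le> (\<Sum>p\<leftarrow>l. fst p)"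
          using d by (simp add: pos_divide_le_eq)
      qed
    qed
    define a where "a = cov \<phi> (\<lambda>x. f1 x + f2 x)"
    define b where "b = cov \<phi> F"
    define s where "s = cov \<phi> f0"
    obtain k0 where k0: "covers \<phi> f0 k0" using ex[OF f0(1)] by blast
    obtain k12 where k12: "covers \<phi> (\<lambda>x. f1 x + f2 x) k12" using ex[OF f12] by blast
    obtain kF where kF: "covers \<phi> F kF" using ex[OF F(1)] by blast
    have s: "s \<ge> 0" "b \<ge> 0" "a \<ge> 0" unfolding s_def b_def a_def using cov_nonneg k0 kF k12 by auto
    have "cov \<phi> f \<le> a + cov \<phi> (\<lambda>x. \<delta> * F x)"
      unfolding f_def a_def using covers_scale[OF kF, of \<delta>] d by (intro cov_add[OF k12]) auto
    also have "\<dots> \<le> a + \<delta> * b" unfolding b_def using cov_scale[OF kF, of \<delta>] d by simp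
    finally have fb: "cov \<phi> f \<le> a + \<delta> * b" .
    have aa: "a \<le> \<alpha> * s" unfolding a_def \<alpha>_def s_def using cov_trans[OF l12 k0] .
    have bb: "b \<le> \<beta> * s" unfolding b_def \<beta>_def s_def using cov_trans[OF lF k0] .
    have "cov \<phi> f1 + cov \<phi> f2 \<le> (1 + 2 * \<delta>) * cov \<phi> f"
      using le d by (simp add: pos_divide_le_eq mult.commute)
    also have "\<dots> \<le> (1 + 2 * \<delta>) * (a + \<delta> * b)" using fb d by (intro mult_left_mono) auto
    also have "\<dots> = a + \<delta> * (2 * a + b + 2 * \<delta> * b)" by (simp add: algebra_simps)
    also have "\<dots> \<le> a + \<delta> * (2 * a + 3 * b)"
      using d s mult_right_mono[OF d(2) s(2)] by (intro add_left_mono mult_left_mono) auto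
    also have "\<dots> \<le> a + \<delta> * (2 * (\<alpha> * s) + 3 * (\<beta> * s))"
      using d aa bb by (intro add_left_mono mult_left_mono) auto
    also have "\<dots> = a + \<delta> * (2 * \<alpha> + 3 * \<beta>) * s" by (simp add: algebra_simps)
    also have "\<dots> \<le> a + \<epsilon> * s" using d s by (intro add_left_mono mult_right_mono) auto
    finally show "cov \<phi> f1 + cov \<phi> f2 \<le> cov \<phi> (\<lambda>x. f1 x + f2 x) + \<epsilon> * cov \<phi> f0"
      by (simp add: a_def s_def)
  qed (use V1 V2 in auto)
qed

text \<open>Tychonoff's theorem replaces convergence: the normalised covering functionals lie in a
  product of compact intervals, and m is a common adherent point of them as the support of \<phi>
  shrinks. Closed conditions that hold for all sufficiently small supports pass to m by
  \<open>lim\<close>.\<close>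

lemma haar_functional:
  assumes N: "admissible N"
    and mult: "\<And>h. h \<in> cc N \<Longrightarrow> continuous_map (prod_topology T T) euclideanreal (\<lambda>(x, y). h (x \<otimes> y))"
    and divc: "\<And>C D. compactin T C \<Longrightarrow> compactin T D \<Longrightarrow>
      \<exists>E. compactin T E \<and> (\<forall>c\<in>C. \<forall>d\<in>D. inv c \<otimes> d \<in> E <#> N)"
  shows "\<exists>m. invariant_functional N m"
proof -
  have opc: "openin T (carrier G)" using openin_topspace[of T] topspace_T by simp
  obtain f0 where f0: "f0 \<in> cc N" "f0 \<one> > 0"
    using cc_bump[OF N opc one_closed] admissible_subset[OF N] by (metis m_closed)
  note f0' = f0(1) one_closed f0(2)
  \<comment> \<open>The value 0 off \<open>cc N\<close> confines \<open>J \<phi>\<close> to a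
    compact product indexed by all functions.\<close>
  define J where "J = (\<lambda>\<phi> f. if f \<in> cc N then cov \<phi> f / cov \<phi> f0 else 0)"
  \<comment> \<open>Neighbourhoods saturated under N are the neighbourhoods of the identity of G/N;
    they are closed under finite intersections, which gives the finite intersection property
    below.\<close>
  define nbhd where "nbhd = (\<lambda>V. openin T V \<and> \<one> \<in> V \<and> (\<forall>x n. x \<in> V \<longrightarrow> n \<in> N \<longrightarrow> x \<otimes> n \<in> V))"
  define small where "small = (\<lambda>V. {\<phi> \<in> cc N. \<phi> \<one> > 0 \<and> (\<forall>x\<in>carrier G. x \<notin> V \<longrightarrow> \<phi> x = 0)})"
  define X where "X = PiE UNIV (\<lambda>f. {0..(if f \<in> cc N then cov f0 f else 0)})"
  have ex: "\<exists>l. covers \<phi> f l" if "\<phi> \<in> cc N" "\<phi> \<one> > 0" "f \<in> cc N" for \<phi> f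
    using covers_exists[OF N that(3,1) one_closed that(2)] .
  have s0: "cov \<phi> f0 > 0" if "\<phi> \<in> cc N" "\<phi> \<one> > 0" for \<phi>
    using ex[OF that f0(1)] cov_pos[where f = f0, OF N that(1) _ one_closed f0(2)] by blast
  have JX: "J \<phi> \<in> X" if \<phi>: "\<phi> \<in> cc N" "\<phi> \<one> > 0" for \<phi>
  proof -
    have "0 \<le> cov \<phi> f / cov \<phi> f0 \<and> cov \<phi> f / cov \<phi> f0 \<le> cov f0 f" if f: "f \<in> cc N" for f
    proof -
      obtain l k k0 where "covers f0 f l" "covers \<phi> f k" "covers \<phi> f0 k0"
        using ex[OF f0 f] ex[OF \<phi> f] ex[OF \<phi> f0(1)] by blast
      then show ?thesis using cov_trans[of f0 f l \<phi> k0] cov_nonneg[of \<phi> f k] s0[OF \<phi>]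
        by (simp add: pos_divide_le_eq)
    qed
    then show ?thesis by (auto simp: X_def J_def)
  qed
  have small_ne: "small V \<noteq> {}" if "nbhd V" for V
  proof -
    have V: "openin T V" "\<one> \<in> V" "\<And>x n. x \<in> V \<Longrightarrow> n \<in> N \<Longrightarrow> x \<otimes> n \<in> V" using that by (auto simp: nbhd_def)
    obtain \<phi> where "\<phi> \<in> cc N" "\<phi> \<one> > 0" "\<And>x. x \<in> carrier G \<Longrightarrow> x \<notin> V \<Longrightarrow> \<phi> x = 0"
      using cc_bump[OF N V] by blast
    then show ?thesis by (auto simp: small_def)
  qed
  have "compact X"
  proof -
    have "compactin (product_topology (\<lambda>_. euclideanreal) UNIV) X"
      unfolding X_def compactin_PiE by auto
    then show ?thesis by (simp add: euclidean_product_topology)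
  qed
  have "X \<inter> \<Inter>((\<lambda>V. closure (J ` small V)) ` Collect nbhd) \<noteq> {}"
  proof (rule compact_imp_fip[OF \<open>compact X\<close>])
    fix \<F> assume F: "finite \<F>" "\<F> \<subseteq> (\<lambda>V. closure (J ` small V)) ` Collect nbhd"
    obtain \<V> where V: "finite \<V>" "\<V> \<subseteq> Collect nbhd" "\<F> = (\<lambda>V. closure (J ` small V)) ` \<V>"
      using F by (meson finite_subset_image)
    define W where "W = carrier G \<inter> \<Inter>\<V>"
    have "nbhd W"
    proof -
      have "openin T (\<Inter>(insert (carrier G) \<V>))"
        using V opc by (intro openin_Inter) (auto simp: nbhd_def)
      then have "openin T W" by (simp add: W_def)
      moreover have "\<one> \<in> W" using V by (auto simp: nbhd_def W_def)
      moreover have "x \<otimes> n \<in> W" if "x \<in> W" "n \<in> N" for x n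
        using that V(2) admissible_subset[OF N] unfolding nbhd_def W_def by blast
      ultimately show ?thesis unfolding nbhd_def by blast
    qed
    then obtain \<phi> where \<phi>: "\<phi> \<in> small W" using small_ne by blast
    have "\<phi> \<in> small V" if "V \<in> \<V>" for V using that \<phi> by (auto simp: small_def W_def)
    then have "J \<phi> \<in> closure (J ` small V)" if "V \<in> \<V>" for V using that closure_subset by blast
    moreover have "J \<phi> \<in> X" using \<phi> JX by (auto simp: small_def)
    ultimately show "X \<inter> \<Inter>\<F> \<noteq> {}" using V(3) by blast
  qed auto
  then obtain m where m: "\<And>V. nbhd V \<Longrightarrow> m \<in> closure (J ` small V)" by auto
  have lim: "P m" if "nbhd V" "closed {m. P m}" "\<And>\<phi>. \<phi> \<in> small V \<Longrightarrow> P (J \<phi>)" for P V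
    using m[OF that(1)] closure_minimal[of "J ` small V" "{m. P m}"] that(2,3) by blast
  have ev: "continuous_on UNIV (\<lambda>m :: ('a \<Rightarrow> real) \<Rightarrow> real. m f)" for f by simp
  have nG: "nbhd (carrier G)" using opc admissible_subset[OF N] by (auto simp: nbhd_def)
  have cc: "\<phi> \<in> cc N" "\<phi> \<one> > 0" if "\<phi> \<in> small V" for \<phi> V using that by (auto simp: small_def)
  have "m (\<lambda>x. f x + g x) = m f + m g" if f: "f \<in> cc N" and g: "g \<in> cc N" for f g
  proof (rule antisym)
    note fg = cc_add[OF f g]
    show "m (\<lambda>x. f x + g x) \<le> m f + m g"
    proof (rule lim[OF nG])
      show "closed {m :: ('a \<Rightarrow> real) \<Rightarrow> real. m (\<lambda>x. f x + g x) \<le> m f + m g}" by (rule closed_Collect_le[OF ev continuous_on_add[OF ev ev]])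
      fix \<phi> assume "\<phi> \<in> small (carrier G)"
      note \<phi> = cc[OF this]
      obtain l k where "covers \<phi> f l" "covers \<phi> g k" using ex[OF \<phi> f] ex[OF \<phi> g] by blast
      from cov_add[OF this] show "J \<phi> (\<lambda>x. f x + g x) \<le> J \<phi> f + J \<phi> g"
        using s0[OF \<phi>] f g fg by (simp add: J_def divide_right_mono flip: add_divide_distrib)
    qed
    show "m f + m g \<le> m (\<lambda>x. f x + g x)"
    proof (rule field_le_epsilon)
      fix e :: real assume e: "e > 0"
      obtain V where V: "openin T V" "\<one> \<in> V" "\<And>x n. x \<in> V \<Longrightarrow> n \<in> N \<Longrightarrow> x \<otimes> n \<in> V"
        "\<And>\<phi> x. \<phi> \<in> cc N \<Longrightarrow> x \<in> carrier G \<Longrightarrow> \<phi> x > 0 \<Longrightarrow> (\<And>x. x \<in> carrier G \<Longrightarrow> x \<notin> V \<Longrightarrow> \<phi> x = 0) \<Longrightarrow>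
          cov \<phi> f + cov \<phi> g \<le> cov \<phi> (\<lambda>x. f x + g x) + e * cov \<phi> f0"
        using cov_almost_additive[OF N f g f0' e mult divc] by blast
      have nV: "nbhd V" using V(1-3) by (auto simp: nbhd_def)
      show "m f + m g \<le> m (\<lambda>x. f x + g x) + e"
      proof (rule lim[OF nV])
        show "closed {m :: ('a \<Rightarrow> real) \<Rightarrow> real. m f + m g \<le> m (\<lambda>x. f x + g x) + e}"
          by (rule closed_Collect_le[OF continuous_on_add[OF ev ev] continuous_on_add[OF ev continuous_on_const]])
        fix \<phi> assume sm: "\<phi> \<in> small V"
        note \<phi> = cc[OF sm]
        have "cov \<phi> f + cov \<phi> g \<le> cov \<phi> (\<lambda>x. f x + g x) + e * cov \<phi> f0"
          using V(4)[OF \<phi>(1) one_closed \<phi>(2)] sm by (auto simp: small_def)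
        then have "(cov \<phi> f + cov \<phi> g) / cov \<phi> f0 \<le> (cov \<phi> (\<lambda>x. f x + g x) + e * cov \<phi> f0) / cov \<phi> f0"
          using s0[OF \<phi>] by (intro divide_right_mono) auto
        then show "J \<phi> f + J \<phi> g \<le> J \<phi> (\<lambda>x. f x + g x) + e"
          using s0[OF \<phi>] f g fg by (simp add: J_def add_divide_distrib)
      qed
    qed
  qed
  moreover have "m f \<le> m g" if f: "f \<in> cc N" and g: "g \<in> cc N" and le: "\<forall>x\<in>carrier G. f x \<le> g x" for f g
  proof (rule lim[OF nG])
    show "closed {m :: ('a \<Rightarrow> real) \<Rightarrow> real. m f \<le> m g}" by (intro closed_Collect_le ev)
    fix \<phi> assume "\<phi> \<in> small (carrier G)"
    note \<phi> = cc[OF this]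
    obtain k where "covers \<phi> g k" using ex[OF \<phi> g] by blast
    then show "J \<phi> f \<le> J \<phi> g"
      using cov_mono le s0[OF \<phi>] f g by (simp add: J_def divide_right_mono)
  qed
  moreover have "m (\<lambda>x. f (x \<otimes> g)) = m f" if f: "f \<in> cc N" and g: "g \<in> carrier G" for f g
  proof (rule lim[OF nG])
    show "closed {m :: ('a \<Rightarrow> real) \<Rightarrow> real. m (\<lambda>x. f (x \<otimes> g)) = m f}" by (intro closed_Collect_eq ev)
    fix \<phi> assume "\<phi> \<in> small (carrier G)"
    note \<phi> = cc[OF this]
    obtain k where "covers \<phi> f k" using ex[OF \<phi> f] by blast
    then show "J \<phi> (\<lambda>x. f (x \<otimes> g)) = J \<phi> f"
      using cov_translate[OF _ g] cc_translate[OF N f g] f by (simp add: J_def)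
  qed
  moreover have "m f0 \<noteq> 0"
  proof -
    have "m f0 = 1"
    proof (rule lim[OF nG])
      show "closed {m :: ('a \<Rightarrow> real) \<Rightarrow> real. m f0 = 1}" by (intro closed_Collect_eq ev continuous_on_const)
      fix \<phi> assume "\<phi> \<in> small (carrier G)"
      from s0[OF cc[OF this]] show "J \<phi> f0 = 1" using f0 by (simp add: J_def)
    qed
    then show ?thesis by simp
  qed
  ultimately have "invariant_functional N m"
    using f0(1) unfolding invariant_functional_def by blast
  then show ?thesis by blast
qed

end

section \<open>From functionals to Radon measures\<close>

locale radon_functional = lch_right_top_group +
  fixes m :: "('a \<Rightarrow> real) \<Rightarrow> real"
  assumes one_adm: "admissible {\<one>}" and m: "invariant_functional {\<one>} m"
begin

text \<open>The relation f \<prec> U of the Riesz representation theorem, with the support witnessed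
  by a compact D inside U.\<close>

definition below :: "('a \<Rightarrow> real) \<Rightarrow> 'a set \<Rightarrow> bool" where
  "below f U \<longleftrightarrow> f \<in> cc {\<one>} \<and> (\<forall>x\<in>carrier G. f x \<le> 1) \<and>
     (\<exists>D. compactin T D \<and> D \<subseteq> U \<and> (\<forall>x\<in>carrier G. f x \<noteq> 0 \<longrightarrow> x \<in> D))"

definition open_content :: "'a set \<Rightarrow> ennreal" where
  "open_content U = (SUP f\<in>{f. below f U}. ennreal (m f))"

definition outer :: "'a set \<Rightarrow> ennreal" where
  "outer E = (INF U\<in>{U. openin T U \<and> E \<subseteq> U}. open_content U)"

lemma set_mult_one: "D \<subseteq> carrier G \<Longrightarrow> D <#> {\<one>} = D"
  by (auto simp: set_mult_def subset_iff)

lemma ccI1: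
  assumes "continuous_map T euclideanreal f" "\<And>x. x \<in> carrier G \<Longrightarrow> 0 \<le> f x"
    "compactin T C" "\<And>x. x \<in> carrier G \<Longrightarrow> f x \<noteq> 0 \<Longrightarrow> x \<in> C"
  shows "f \<in> cc {\<one>}"
  using assms carrier_compactin[OF assms(3)] set_mult_one[of C] by (intro ccI[where C = C]) auto

lemma urysohn_below:
  assumes "compactin T C" "openin T U" "C \<subseteq> U"
  obtains f where "below f U" "\<And>x. x \<in> C \<Longrightarrow> f x = 1"
proof -
  have *: "x \<otimes> n \<in> U" if "x \<in> U" "n \<in> {\<one>}" for x n
    using that carrier_openin[OF assms(2)] by simp
  obtain f D where f: "f \<in> cc {\<one>}" "\<And>x. x \<in> carrier G \<Longrightarrow> f x \<le> 1" "\<And>x. x \<in> C \<Longrightarrow> f x = 1"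
    "compactin T D" "D \<subseteq> U" "\<And>x. x \<in> carrier G \<Longrightarrow> f x \<noteq> 0 \<Longrightarrow> x \<in> D <#> {\<one>}"
    using urysohn_cc[OF one_adm assms *] by blast
  have "D <#> {\<one>} = D" using set_mult_one carrier_compactin[OF f(4)] by blast
  then have "below f U" using f unfolding below_def by blast
  then show thesis using that f(3) by blast
qed

lemma below_zero: "below (\<lambda>x. 0) U"
  unfolding below_def by (auto intro!: ccI1[of _ "{}"] exI[of _ "{}"])

lemma below_mono: "below f U \<Longrightarrow> U \<subseteq> V \<Longrightarrow> below f V"
  unfolding below_def by blast

lemma below_cc: "below f U \<Longrightarrow> f \<in> cc {\<one>}"
  by (simp add: below_def)

lemma open_content_upper: "below f U \<Longrightarrow> ennreal (m f) \<le> open_content U"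
  unfolding open_content_def by (rule SUP_upper) simp

lemma open_content_mono: "U \<subseteq> V \<Longrightarrow> open_content U \<le> open_content V"
  unfolding open_content_def using below_mono by (intro SUP_subset_mono) auto

lemma outer_open: "openin T U \<Longrightarrow> outer U = open_content U"
  unfolding outer_def by (intro antisym INF_greatest INF_lower open_content_mono) auto

lemma outer_mono: "E \<subseteq> F \<Longrightarrow> outer E \<le> outer F"
  unfolding outer_def by (intro INF_superset_mono) auto

lemma outer_empty: "outer {} = 0"
proof -
  have "m f = 0" if "below f {}" for f
  proof -
    have "f x = 0" if "x \<in> carrier G" for x using that \<open>below f {}\<close> unfolding below_def by blast
    then show ?thesis
      using functional_cong[OF m below_cc[OF that] below_cc[OF below_zero]] functional_zero[OF m below_cc[OF that]]
      by simp
  qed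
  then have "open_content {} \<le> 0" unfolding open_content_def by (intro SUP_least) auto
  then show ?thesis using outer_open[of "{}"] by simp
qed

text \<open>The function f is split by a cutoff w and its complement 1 - w. Since u is doubled
  before it is cut at 1, w equals 1 wherever u \<ge> 1/2. Hence f (1 - w) is supported in the
  compact set F, and F lies in V because u = 1 on D - V.\<close>

lemma below_split:
  assumes f: "below f (U \<union> V)" and U: "openin T U" and V: "openin T V"
  obtains f1 f2 where "below f1 U" "below f2 V" "\<And>x. x \<in> carrier G \<Longrightarrow> f x = f1 x + f2 x"
proof -
  obtain D where D: "compactin T D" "D \<subseteq> U \<union> V" "\<And>x. x \<in> carrier G \<Longrightarrow> f x \<noteq> 0 \<Longrightarrow> x \<in> D"
    using f unfolding below_def by blast
  have f01: "0 \<le> f x" "f x \<le> 1" if "x \<in> carrier G" for x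
    using f that cc_nonneg[OF below_cc[OF f]] by (auto simp: below_def)
  have "closedin T (topspace T - V)" using V by blast
  then have "compactin T ((topspace T - V) \<inter> D)" using D(1) closed_Int_compactin by blast
  moreover have "(topspace T - V) \<inter> D \<subseteq> U" using D by auto
  ultimately obtain u where u: "below u U" "\<And>x. x \<in> (topspace T - V) \<inter> D \<Longrightarrow> u x = 1"
    using urysohn_below[OF _ U] by blast
  obtain E where E: "compactin T E" "E \<subseteq> U" "\<And>x. x \<in> carrier G \<Longrightarrow> u x \<noteq> 0 \<Longrightarrow> x \<in> E"
    using u(1) unfolding below_def by blast
  define w where "w = (\<lambda>x. min 1 (2 * u x))"
  have wc: "continuous_map T euclideanreal w"
    unfolding w_def using cc_cont[OF below_cc[OF u(1)]]
    by (intro continuous_map_real_min continuous_map_real_mult) auto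
  have w01: "0 \<le> w x" "w x \<le> 1" if "x \<in> carrier G" for x
    using cc_nonneg[OF below_cc[OF u(1)] that] by (auto simp: w_def)
  note fc = cc_cont[OF below_cc[OF f]]
  define F where "F = D \<inter> {x \<in> topspace T. u x \<in> {..1/2}}"
  have F: "compactin T F"
  proof -
    have "closedin T {x \<in> topspace T. u x \<in> {..1/2}}"
      by (rule closedin_continuous_map_preimage[OF cc_cont[OF below_cc[OF u(1)]]]) simp
    then show ?thesis unfolding F_def using D(1) compact_Int_closedin by blast
  qed
  show thesis
  proof (rule that)
    show "below (\<lambda>x. f x * w x) U"
      unfolding below_def
    proof (intro conjI ballI exI[of _ E])
      show "(\<lambda>x. f x * w x) \<in> cc {\<one>}"
        using f01 w01 E(1,3) by (intro ccI1[of _ E] continuous_map_real_mult fc wc) (auto simp: w_def)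
      show "f x * w x \<le> 1" if "x \<in> carrier G" for x using f01[OF that] w01[OF that] by (simp add: mult_le_one)
      show "f x * w x \<noteq> 0 \<longrightarrow> x \<in> E" if "x \<in> carrier G" for x using E(3)[OF that] by (auto simp: w_def)
    qed (use E in auto)
    have supp: "x \<in> F" if "x \<in> carrier G" "f x * (1 - w x) \<noteq> 0" for x
      using D(3)[OF that(1)] that by (auto simp: F_def w_def topspace_T min_def split: if_splits)
    show "below (\<lambda>x. f x * (1 - w x)) V"
      unfolding below_def
    proof (intro conjI ballI exI[of _ F])
      show "(\<lambda>x. f x * (1 - w x)) \<in> cc {\<one>}"
        using f01 w01 supp
        by (intro ccI1[OF _ _ F] continuous_map_real_mult fc wc continuous_map_diff) auto
      show "f x * (1 - w x) \<le> 1" if "x \<in> carrier G" for x using f01[OF that] w01[OF that] by (simp add: mult_le_one)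
      show "F \<subseteq> V"
      proof
        fix x assume x: "x \<in> F"
        then have "u x \<noteq> 1" "x \<in> D" "x \<in> topspace T" by (auto simp: F_def)
        then show "x \<in> V" using u(2)[of x] by auto
      qed
    qed (use supp F in auto)
  qed (simp add: algebra_simps)
qed

lemma open_content_Un:
  assumes "openin T U" "openin T V"
  shows "open_content (U \<union> V) \<le> open_content U + open_content V"
  unfolding open_content_def[of "U \<union> V"]
proof (rule SUP_least)
  fix f assume "f \<in> {f. below f (U \<union> V)}"
  then have f: "below f (U \<union> V)" by simp
  obtain f1 f2 where f12: "below f1 U" "below f2 V" "\<And>x. x \<in> carrier G \<Longrightarrow> f x = f1 x + f2 x"
    using below_split[OF f assms] by blast
  note c = below_cc[OF f12(1)] below_cc[OF f12(2)]
  have "m f = m f1 + m f2"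
    using functional_cong[OF m below_cc[OF f] cc_add[OF c]] f12(3) functional_add[OF m c] by simp
  then have "ennreal (m f) = ennreal (m f1) + ennreal (m f2)"
    using functional_nonneg[OF m c(1)] functional_nonneg[OF m c(2)] by simp
  also have "\<dots> \<le> open_content U + open_content V" using f12 by (intro add_mono open_content_upper)
  finally show "ennreal (m f) \<le> open_content U + open_content V" .
qed

lemma open_content_empty: "open_content {} = 0"
  using outer_empty outer_open[of "{}"] by simp

lemma open_content_UN_finite:
  assumes "finite I" "\<And>i. i \<in> I \<Longrightarrow> openin T (U i)"
  shows "open_content (\<Union>i\<in>I. U i) \<le> (\<Sum>i\<in>I. open_content (U i))"
  using assms
proof (induction I)
  case (insert i I)
  have "open_content (U i \<union> (\<Union>i\<in>I. U i)) \<le> open_content (U i) + open_content (\<Union>i\<in>I. U i)"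
    using insert by (intro open_content_Un) auto
  also have "\<dots> \<le> open_content (U i) + (\<Sum>i\<in>I. open_content (U i))"
    using insert by (intro add_left_mono) auto
  finally show ?case using insert by simp
qed (simp add: open_content_empty)

text \<open>The support of a test function is compact, hence covered by finitely many of the sets U
  i.\<close>

lemma open_content_UN:
  assumes U: "\<And>i::nat. openin T (U i)"
  shows "open_content (\<Union>i. U i) \<le> (\<Sum>i. open_content (U i))"
  unfolding open_content_def[of "\<Union>i. U i"]
proof (rule SUP_least)
  fix f assume "f \<in> {f. below f (\<Union>i. U i)}"
  then have "below f (\<Union>i. U i)" by simp
  then obtain D where D: "compactin T D" "D \<subseteq> (\<Union>i. U i)" "\<forall>x\<in>carrier G. f x \<noteq> 0 \<longrightarrow> x \<in> D"
      and f: "f \<in> cc {\<one>}" "\<forall>x\<in>carrier G. f x \<le> 1"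
    unfolding below_def by blast
  obtain \<F> where F: "finite \<F>" "\<F> \<subseteq> range U" "D \<subseteq> \<Union>\<F>"
    using compactinD[OF D(1), of "range U"] U D(2) by blast
  then obtain I where I: "finite I" "\<F> = U ` I" by (meson finite_subset_image subset_UNIV)
  have "below f (\<Union>i\<in>I. U i)" unfolding below_def using D F I f by blast
  then have "ennreal (m f) \<le> open_content (\<Union>i\<in>I. U i)" by (rule open_content_upper)
  also have "\<dots> \<le> (\<Sum>i\<in>I. open_content (U i))" using I U by (intro open_content_UN_finite) auto
  also have "\<dots> \<le> (\<Sum>i. open_content (U i))" using I by (intro sum_le_suminf) auto
  finally show "ennreal (m f) \<le> (\<Sum>i. open_content (U i))" .
qed

lemma outer_UN: "outer (\<Union>i::nat. A i) \<le> (\<Sum>i. outer (A i))"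
proof (rule ennreal_le_epsilon)
  fix e :: real assume fin: "(\<Sum>i. outer (A i)) < top_class.top" and e: "e > 0"
  have ei: "e * (1 / 2) ^ Suc i > 0" for i using e by simp
  have "\<exists>U. openin T U \<and> A i \<subseteq> U \<and> open_content U \<le> outer (A i) + ennreal (e * (1 / 2) ^ Suc i)" for i
  proof -
    have "outer (A i) \<le> (\<Sum>i. outer (A i))" using sum_le_suminf[of "\<lambda>i. outer (A i)" "{i}"] by simp
    then have "outer (A i) < top_class.top" using fin by simp
    then have "outer (A i) < outer (A i) + ennreal (e * (1 / 2) ^ Suc i)"
      using ei[of i] by (metis add.right_neutral ennreal_add_left_cancel_less ennreal_less_zero_iff infinity_ennreal_def)
    then obtain U where "openin T U" "A i \<subseteq> U" "open_content U < outer (A i) + ennreal (e * (1 / 2) ^ Suc i)"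
      unfolding outer_def[of "A i"] INF_less_iff by blast
    then show ?thesis by (meson less_imp_le)
  qed
  then obtain U where U: "\<And>i. openin T (U i)" "\<And>i. A i \<subseteq> U i"
      "\<And>i. open_content (U i) \<le> outer (A i) + ennreal (e * (1 / 2) ^ Suc i)"
    by metis
  have "outer (\<Union>i. A i) \<le> open_content (\<Union>i. U i)"
    using U by (subst outer_open[symmetric]) (auto intro!: outer_mono)
  also have "\<dots> \<le> (\<Sum>i. open_content (U i))" by (rule open_content_UN[OF U(1)])
  also have "\<dots> \<le> (\<Sum>i. outer (A i) + ennreal (e * (1 / 2) ^ Suc i))"
    using U(3) by (intro suminf_le) auto
  also have "\<dots> = (\<Sum>i. outer (A i)) + (\<Sum>i. ennreal (e * (1 / 2) ^ Suc i))"
    by (rule suminf_add[symmetric]) auto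
  also have "(\<Sum>i. ennreal (e * (1 / 2) ^ Suc i)) = ennreal e"
  proof -
    have "(\<lambda>i. e * (1 / 2) ^ Suc i) sums (e * 1)" by (intro sums_mult power_half_series)
    then show ?thesis using e by (intro suminf_ennreal_eq) auto
  qed
  finally show "outer (\<Union>i. A i) \<le> (\<Sum>i. outer (A i)) + ennreal e" .
qed

lemma outer_Un: "outer (A \<union> B) \<le> outer A + outer B"
proof -
  define F where "F = (\<lambda>i::nat. if i = 0 then A else if i = 1 then B else {})"
  have "(\<Union>i. F i) = A \<union> B" by (auto simp: F_def split: if_splits)
  moreover have "(\<Sum>i. outer (F i)) = (\<Sum>i\<in>{0, 1}. outer (F i))"
    by (rule suminf_finite) (auto simp: F_def outer_empty)
  ultimately show ?thesis using outer_UN[of F] by (simp add: F_def)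
qed

text \<open>If f is below V \<inter> U with support in D, then V - U is contained in the open set V
  - D, and a test function g below V - D has support disjoint from D. So f + g stays at most 1 and
  is again below V.\<close>

lemma outer_caratheodory_open:
  assumes U: "openin T U" and V: "openin T V"
  shows "open_content (V \<inter> U) + outer (V - U) \<le> open_content V"
proof -
  have 1: "ennreal (m f) + outer (V - U) \<le> open_content V" if f: "below f (V \<inter> U)" for f
  proof -
    obtain D where D: "compactin T D" "D \<subseteq> V \<inter> U" "\<And>x. x \<in> carrier G \<Longrightarrow> f x \<noteq> 0 \<Longrightarrow> x \<in> D"
      using f unfolding below_def by blast
    have VD: "openin T (V - D)" using V compactin_imp_closedin[OF haus D(1)] by blast
    have "outer (V - U) \<le> open_content (V - D)"
      unfolding outer_open[OF VD, symmetric] using D by (intro outer_mono) auto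
    then have "ennreal (m f) + outer (V - U) \<le> ennreal (m f) + open_content (V - D)" by (intro add_left_mono)
    also have "\<dots> = (SUP g\<in>{g. below g (V - D)}. ennreal (m f) + ennreal (m g))"
      unfolding open_content_def using below_zero[of "V - D"] by (subst ennreal_SUP_add_right) auto
    also have "\<dots> \<le> open_content V"
    proof (rule SUP_least)
      fix g assume "g \<in> {g. below g (V - D)}"
      then have g: "below g (V - D)" by simp
      obtain E where E: "compactin T E" "E \<subseteq> V - D" "\<And>x. x \<in> carrier G \<Longrightarrow> g x \<noteq> 0 \<Longrightarrow> x \<in> E"
        using g unfolding below_def by blast
      note c = below_cc[OF f] below_cc[OF g]
      have "below (\<lambda>x. f x + g x) V"
        unfolding below_def
      proof (intro conjI ballI exI[of _ "D \<union> E"])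
        show "compactin T (D \<union> E)" using D E by (simp add: compactin_Un)
        show "f x + g x \<le> 1" if "x \<in> carrier G" for x
          using D(3)[OF that] E(2) E(3)[OF that] f g that unfolding below_def by (cases "f x = 0") force+
        show "f x + g x \<noteq> 0 \<longrightarrow> x \<in> D \<union> E" if "x \<in> carrier G" for x
          using D(3)[OF that] E(3)[OF that] by (cases "f x = 0"; cases "g x = 0") auto
      qed (use D E cc_add[OF c] in auto)
      then have "ennreal (m (\<lambda>x. f x + g x)) \<le> open_content V" by (rule open_content_upper)
      then show "ennreal (m f) + ennreal (m g) \<le> open_content V"
        using functional_add[OF m c] functional_nonneg[OF m c(1)] functional_nonneg[OF m c(2)] by simp
    qed
    finally show ?thesis .
  qed
  have "open_content (V \<inter> U) + outer (V - U) = (SUP f\<in>{f. below f (V \<inter> U)}. ennreal (m f) + outer (V - U))"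
    unfolding open_content_def using below_zero by (intro ennreal_SUP_add_left[symmetric]) auto
  also have "\<dots> \<le> open_content V" using 1 by (intro SUP_least) auto
  finally show ?thesis .
qed

lemma outer_caratheodory:
  assumes U: "openin T U"
  shows "outer (E \<inter> U) + outer (E - U) = outer E"
proof (rule antisym)
  show "outer (E \<inter> U) + outer (E - U) \<le> outer E"
    unfolding outer_def[of E]
  proof (rule INF_greatest)
    fix V assume "V \<in> {V. openin T V \<and> E \<subseteq> V}"
    then have V: "openin T V" "E \<subseteq> V" by auto
    have "outer (E \<inter> U) + outer (E - U) \<le> outer (V \<inter> U) + outer (V - U)"
      using V by (intro add_mono outer_mono) auto
    also have "outer (V \<inter> U) = open_content (V \<inter> U)" using U V by (intro outer_open) auto
    also have "open_content (V \<inter> U) + outer (V - U) \<le> open_content V" by (rule outer_caratheodory_open[OF U V(1)])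
    finally show "outer (E \<inter> U) + outer (E - U) \<le> open_content V" .
  qed
  show "outer E \<le> outer (E \<inter> U) + outer (E - U)"
    using outer_Un[of "E \<inter> U" "E - U"] by (simp add: Un_Diff_Int Int_Diff_Un)
qed

section \<open>The Borel measure and its regularity\<close>

definition haar :: "'a measure" where
  "haar = measure_of (topspace T) {U. openin T U} outer"

lemma sets_haar: "sets haar = sets (borel_of T)"
  unfolding haar_def borel_of_def by (simp add: sets_measure_of_conv)

text \<open>Caratheodory's theorem makes \<open>outer\<close> a measure on its measurable sets;
  these contain the open sets, hence all Borel sets.\<close>

lemma emeasure_haar:
  assumes "E \<in> sets haar"
  shows "emeasure haar E = outer E"
proof -
  let ?\<Omega> = "topspace T" and ?M = "sigma_sets (topspace T) {U. openin T U}"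
  have sub: "{U. openin T U} \<subseteq> Pow ?\<Omega>" using openin_subset by auto
  interpret P: sigma_algebra ?\<Omega> "Pow ?\<Omega>" by (rule sigma_algebra_Pow)
  let ?L = "lambda_system ?\<Omega> (Pow ?\<Omega>) outer"
  have "outer_measure_space (Pow ?\<Omega>) outer"
    unfolding outer_measure_space_def positive_def increasing_def countably_subadditive_def
    using outer_empty outer_mono outer_UN by auto
  then have ms: "measure_space ?\<Omega> ?L outer" by (rule P.caratheodory_lemma)
  then interpret L: sigma_algebra ?\<Omega> ?L by (simp add: measure_space_def)
  have "{U. openin T U} \<subseteq> ?L"
    using outer_caratheodory openin_subset[of T] by (auto simp: P.lambda_system_eq)
  then have MsubL: "?M \<subseteq> ?L" by (rule L.sigma_sets_subset)
  have "countably_additive ?M outer" "positive ?M outer"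
    using ms MsubL by (auto simp: measure_space_def countably_additive_def positive_def)
  moreover have "E \<in> ?M" using assms sub by (simp add: haar_def)
  ultimately show ?thesis
    unfolding haar_def using emeasure_measure_of[of _ ?\<Omega> "{U. openin T U}" outer E] sub assms sets_measure_of[OF sub, of outer]
    by (simp add: haar_def)
qed

lemma open_in_sets: "openin T U \<Longrightarrow> U \<in> sets haar"
  unfolding haar_def by (subst sets_measure_of) (auto dest: openin_subset)

lemma compact_in_sets:
  assumes "compactin T K"
  shows "K \<in> sets haar"
proof -
  have sp: "space haar = topspace T" unfolding haar_def by (subst space_measure_of) (auto dest: openin_subset)
  have "openin T (topspace T - K)" using compactin_imp_closedin[OF haus assms] by blast
  then have "space haar - (topspace T - K) \<in> sets haar" by (intro sets.compl_sets open_in_sets)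
  then show ?thesis using compactin_subset_topspace[OF assms] sp by (simp add: double_diff)
qed

lemma outer_compact_finite:
  assumes K: "compactin T K"
  shows "outer K < \<infinity>"
proof -
  have opc: "openin T (carrier G)" using openin_topspace[of T] topspace_T by simp
  have Kc: "K \<subseteq> carrier G" using carrier_compactin[OF K] by auto
  obtain f where f: "below f (carrier G)" "\<And>x. x \<in> K \<Longrightarrow> f x = 1" using urysohn_below[OF K opc Kc] by blast
  note fc = below_cc[OF f(1)]
  \<comment> \<open>A test function below U is at most 1 and vanishes off U, so it lies under 2 f.
    This bounds the content of U by the mass of f + f.\<close>
  define U where "U = {x \<in> carrier G. f x > 1/2}"
  have U: "openin T U" unfolding U_def by (rule cc_positive_set[OF fc])
  have "outer K \<le> open_content U" 
  proof -
    have "K \<subseteq> U" using f(2) Kc by (auto simp: U_def)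
    from outer_mono[OF this] show ?thesis using outer_open[OF U] by simp
  qed
  also have "\<dots> \<le> ennreal (m (\<lambda>x. f x + f x))"
    unfolding open_content_def
  proof (intro SUP_least ennreal_leI)
    fix g assume "g \<in> {g. below g U}"
    then have g: "below g U" by simp
    have "g x \<le> f x + f x" if x: "x \<in> carrier G" for x
    proof (cases "g x = 0")
      case True
      then show ?thesis using cc_nonneg[OF fc x] by simp
    next
      case False
      then have "x \<in> U" using g x unfolding below_def by blast
      moreover have "g x \<le> 1" using g x by (simp add: below_def)
      ultimately show ?thesis by (simp add: U_def)
    qed
    then show "m g \<le> m (\<lambda>x. f x + f x)" using functional_mono[OF m below_cc[OF g] cc_add[OF fc fc]] by blast
  qed
  also have "\<dots> < \<infinity>" by simp
  finally show ?thesis .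
qed

lemma radon_measure_haar: "radon_measure T haar"
  unfolding radon_measure_def
proof (intro conjI allI ballI impI)
  show "sets haar = sets (borel_of T)" by (rule sets_haar)
  show "emeasure haar K < \<infinity>" if "compactin T K" for K
    using outer_compact_finite[OF that] emeasure_haar[OF compact_in_sets[OF that]] by simp
  show "emeasure haar E = (INF U\<in>{U. openin T U \<and> E \<subseteq> U}. emeasure haar U)" if E: "E \<in> sets haar" for E
    unfolding emeasure_haar[OF E] outer_def[of E]
    by (intro INF_cong) (auto simp: emeasure_haar open_in_sets outer_open)
  show "emeasure haar U = (SUP K\<in>{K. compactin T K \<and> K \<subseteq> U}. emeasure haar K)" if U: "openin T U" for U
  proof (rule antisym)
    show "(SUP K\<in>{K. compactin T K \<and> K \<subseteq> U}. emeasure haar K) \<le> emeasure haar U"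
      using open_in_sets[OF U] by (intro SUP_least emeasure_mono) auto
    show "emeasure haar U \<le> (SUP K\<in>{K. compactin T K \<and> K \<subseteq> U}. emeasure haar K)"
      unfolding emeasure_haar[OF open_in_sets[OF U]] outer_open[OF U] open_content_def
    proof (rule SUP_least)
      fix f assume "f \<in> {f. below f U}"
      then obtain D where D: "compactin T D" "D \<subseteq> U" "\<forall>x\<in>carrier G. f x \<noteq> 0 \<longrightarrow> x \<in> D"
        and f: "f \<in> cc {\<one>}" "\<forall>x\<in>carrier G. f x \<le> 1"
        unfolding below_def by blast
      \<comment> \<open>The function f is below every open set that contains D, so m f is a lower
        bound of the infimum that defines the outer measure of D.\<close>
      have "ennreal (m f) \<le> outer D"
        unfolding outer_def
      proof (rule INF_greatest)
        fix V assume "V \<in> {V. openin T V \<and> D \<subseteq> V}"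
        then have "below f V" unfolding below_def using D f by blast
        then show "ennreal (m f) \<le> open_content V" by (rule open_content_upper)
      qed
      also have "\<dots> = emeasure haar D" using emeasure_haar[OF compact_in_sets[OF D(1)]] by simp
      also have "\<dots> \<le> (SUP K\<in>{K. compactin T K \<and> K \<subseteq> U}. emeasure haar K)" using D by (intro SUP_upper) auto
      finally show "ennreal (m f) \<le> (SUP K\<in>{K. compactin T K \<and> K \<subseteq> U}. emeasure haar K)" .
    qed
  qed
qed

section \<open>Right invariance and nontriviality of the measure\<close>

lemma r_coset_cancel: "E \<subseteq> carrier G \<Longrightarrow> g \<in> carrier G \<Longrightarrow> E #> g #> inv g = E"
  by (simp add: coset_mult_assoc)

lemma open_content_translate_le:
  assumes U: "openin T U" and g: "g \<in> carrier G"
  shows "open_content U \<le> open_content (U #> g)"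
  unfolding open_content_def[of U]
proof (rule SUP_least)
  fix f assume "f \<in> {f. below f U}"
  then obtain D where D: "compactin T D" "D \<subseteq> U" "\<And>x. x \<in> carrier G \<Longrightarrow> f x \<noteq> 0 \<Longrightarrow> x \<in> D"
    and f: "f \<in> cc {\<one>}" "\<And>x. x \<in> carrier G \<Longrightarrow> f x \<le> 1"
    unfolding below_def by blast
  have "below (\<lambda>x. f (x \<otimes> inv g)) (U #> g)"
    unfolding below_def
  proof (intro conjI ballI exI[of _ "D #> g"])
    show "(\<lambda>x. f (x \<otimes> inv g)) \<in> cc {\<one>}" using cc_translate[OF one_adm f(1)] g by simp
    show "compactin T (D #> g)" using compactin_r_coset[OF D(1) g] .
    show "D #> g \<subseteq> U #> g" using D(2) by (auto simp: r_coset_def)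
    show "f (x \<otimes> inv g) \<noteq> 0 \<longrightarrow> x \<in> D #> g" if "x \<in> carrier G" for x
    proof
      assume "f (x \<otimes> inv g) \<noteq> 0"
      then have "x \<otimes> inv g \<in> D" using D(3) that g by auto
      then have "x \<otimes> inv g \<otimes> g \<in> D #> g" by (auto simp: r_coset_def)
      then show "x \<in> D #> g" using that g by (simp add: m_assoc)
    qed
  qed (use f(2) g in auto)
  then show "ennreal (m f) \<le> open_content (U #> g)"
    using open_content_upper functional_translate[OF m f(1), of "inv g"] g by fastforce
qed

lemma outer_translate_le:
  assumes E: "E \<subseteq> carrier G" and g: "g \<in> carrier G"
  shows "outer E \<le> outer (E #> g)"
  unfolding outer_def[of "E #> g"]
proof (rule INF_greatest)
  fix V assume "V \<in> {V. openin T V \<and> E #> g \<subseteq> V}"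
  then have V: "openin T V" "E #> g \<subseteq> V" by auto
  have Vc: "V \<subseteq> carrier G" using carrier_openin[OF V(1)] by auto
  have Vg: "openin T (V #> inv g)" using openin_r_coset[OF V(1)] g by simp
  have "E #> g #> inv g \<subseteq> V #> inv g" using V(2) by (auto simp: r_coset_def)
  then have "E \<subseteq> V #> inv g" using r_coset_cancel[OF E g] by simp
  then have "outer E \<le> open_content (V #> inv g)" using outer_mono outer_open[OF Vg] by metis
  also have "\<dots> \<le> open_content (V #> inv g #> g)" by (rule open_content_translate_le[OF Vg g])
  also have "V #> inv g #> g = V" using r_coset_cancel[OF Vc, of "inv g"] g by simp
  finally show "outer E \<le> open_content V" .
qed

lemma outer_translate:
  assumes E: "E \<subseteq> carrier G" and g: "g \<in> carrier G"
  shows "outer (E #> g) = outer E"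
proof (rule antisym)
  have "E #> g \<subseteq> carrier G" using E g by (simp add: r_coset_subset_G)
  then show "outer (E #> g) \<le> outer E"
    using outer_translate_le[of "E #> g" "inv g"] r_coset_cancel[OF E g] g by simp
qed (rule outer_translate_le[OF assms])

lemma r_coset_borel:
  assumes E: "E \<in> sets (borel_of T)" and g: "g \<in> carrier G"
  shows "E #> g \<in> sets (borel_of T)"
proof -
  let ?M = "sigma_sets (topspace T) {U. openin T U}"
  have M: "sets (borel_of T) = ?M"
    unfolding borel_of_def by (subst sets_measure_of) (auto dest: openin_subset)
  have inj: "x = y" if "x \<otimes> g = y \<otimes> g" "x \<in> carrier G" "y \<in> carrier G" for x y using that g by simp
  have "E \<in> ?M" using E M by simp
  then have "E #> g \<in> ?M"
  proof induction
    case (Basic U)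
    then show ?case using openin_r_coset g by (intro sigma_sets.Basic) auto
  next
    case Empty
    then show ?case by (simp add: r_coset_def sigma_sets.Empty)
  next
    case (Compl A)
    have Ac: "A \<subseteq> carrier G" using Compl(1) sigma_sets_into_sp[of "{U. openin T U}" "topspace T" A] topspace_T openin_subset by blast
    have "(topspace T - A) #> g = topspace T - (A #> g)"
    proof (intro subset_antisym subsetI)
      fix x assume "x \<in> (topspace T - A) #> g"
      then show "x \<in> topspace T - (A #> g)"
        using inj Ac g by (fastforce simp: r_coset_def topspace_T)
    next
      fix x assume x: "x \<in> topspace T - (A #> g)"
      then have "x = x \<otimes> inv g \<otimes> g" using g by (simp add: topspace_T m_assoc)
      moreover have "x \<otimes> inv g \<notin> A" using x calculation by (auto simp: r_coset_def)
      ultimately show "x \<in> (topspace T - A) #> g"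
        using x g by (auto simp: r_coset_def topspace_T intro!: bexI[of _ "x \<otimes> inv g"])
    qed
    then show ?case using Compl(2) sigma_sets.Compl by metis
  next
    case (Union A)
    have "(\<Union>i. A i) #> g = (\<Union>i. A i #> g)" by (auto simp: r_coset_def)
    then show ?case using sigma_sets.Union[OF Union(2)] by simp
  qed
  then show ?thesis using M by simp
qed

lemma right_haar_measure_haar: "right_haar_measure G T haar"
  unfolding right_haar_measure_def
proof (intro conjI ballI)
  show "radon_measure T haar" by (rule radon_measure_haar)
  show "emeasure haar (topspace T) \<noteq> 0"
  proof -
    obtain f where f: "f \<in> cc {\<one>}" "m f \<noteq> 0" using m unfolding invariant_functional_def by blast
    then have mf: "m f > 0" using functional_nonneg[OF m f(1)] by simp
    obtain B where B: "B > 0" "\<And>x. x \<in> carrier G \<Longrightarrow> f x \<le> B" using cc_bounded[OF one_adm f(1)] by blast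
    \<comment> \<open>Test functions must be at most 1, so f is divided by a number above its bound.
      An integer is chosen because scaling by 1/n follows at once from additivity.\<close>
    obtain n where n: "B < real n" using reals_Archimedean2 by blast
    have n0: "n > 0" using n B(1) by (cases n) auto
    define g where "g = (\<lambda>x. f x / real n)"
    have g: "g \<in> cc {\<one>}" using cc_scale[OF f(1), of "1 / real n"] by (simp add: g_def)
    obtain C where C: "compactin T C" "\<And>x. x \<in> carrier G \<Longrightarrow> g x \<noteq> 0 \<Longrightarrow> x \<in> C <#> {\<one>}"
      using cc_supp[OF g] by blast
    have Cc: "C \<subseteq> topspace T" using C(1) compactin_subset_topspace by blast
    have "f x \<le> real n" if "x \<in> carrier G" for x using B(2)[OF that] n by simp
    then have "g x \<le> 1" if "x \<in> carrier G" for x using that n0 by (simp add: g_def)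
    moreover have "x \<in> C" if "x \<in> carrier G" "g x \<noteq> 0" for x
      using C(2)[OF that] set_mult_one Cc topspace_T by simp
    ultimately have "below g (topspace T)" unfolding below_def using g C(1) Cc by blast
    then have "ennreal (m g) \<le> outer (topspace T)" using open_content_upper outer_open by simp
    moreover have "m g > 0" unfolding g_def functional_inverse_scale[OF m f(1) n0] using mf n0 by simp
    ultimately show ?thesis using emeasure_haar[OF open_in_sets[OF openin_topspace]] by auto
  qed
  fix g E assume g: "g \<in> carrier G" and E: "E \<in> sets (borel_of T)"
  have "E \<subseteq> carrier G"
    using sets.sets_into_space[OF E] unfolding borel_of_def by (simp add: space_measure_of_conv topspace_T)
  then show "emeasure haar (E #> g) = emeasure haar E"
    using emeasure_haar E r_coset_borel[OF E g] outer_translate g sets_haar by simp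
qed

end

section \<open>Averaging over a compact layer\<close>

lemma continuous_map_realI:
  fixes h :: "'a \<Rightarrow> real"
  assumes "\<And>x \<epsilon>. x \<in> topspace X \<Longrightarrow> \<epsilon> > 0 \<Longrightarrow> \<exists>V. openin X V \<and> x \<in> V \<and> (\<forall>y\<in>V. \<bar>h y - h x\<bar> < \<epsilon>)"
  shows "continuous_map X euclideanreal h"
  unfolding continuous_map_def
proof (intro conjI allI impI)
  fix U :: "real set" assume "openin euclideanreal U"
  then have U: "open U" by simp
  show "openin X {x \<in> topspace X. h x \<in> U}"
  proof (subst openin_subopen, intro ballI)
    fix x assume "x \<in> {x \<in> topspace X. h x \<in> U}"
    then have x: "x \<in> topspace X" "h x \<in> U" by auto
    then obtain e where e: "e > 0" "\<And>y. dist y (h x) < e \<Longrightarrow> y \<in> U" using U unfolding open_dist by blast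
    obtain V where V: "openin X V" "x \<in> V" "\<forall>y\<in>V. \<bar>h y - h x\<bar> < e" using assms[OF x(1) e(1)] by blast
    then have "V \<subseteq> {x \<in> topspace X. h x \<in> U}"
      using e(2) openin_subset[OF V(1)] by (auto simp: dist_real_def)
    then show "\<exists>S. openin X S \<and> x \<in> S \<and> S \<subseteq> {x \<in> topspace X. h x \<in> U}" using V by blast
  qed
qed auto

section \<open>Proper maps between quotients\<close>

context lch_right_top_group
begin

text \<open>Properness of G/N \<rightarrow> G/K for N contained in K, expressed in G: the preimage
  of the image of a compact C is covered by the image of a compact D.\<close>

definition proper_over :: "'a set \<Rightarrow> 'a set \<Rightarrow> bool" where
  "proper_over K N \<longleftrightarrow> (\<forall>C. compactin T C \<longrightarrow> (\<exists>D. compactin T D \<and> C <#> K \<subseteq> D <#> N))"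

lemma proper_overD:
  assumes "proper_over K N" "compactin T C"
  obtains D where "compactin T D" "C <#> K \<subseteq> D <#> N"
  using assms unfolding proper_over_def by blast

lemma proper_over_trans: "proper_over K N \<Longrightarrow> proper_over N M \<Longrightarrow> proper_over K M"
  unfolding proper_over_def by (meson order_trans)

lemma proper_over_subset: "K \<subseteq> N \<Longrightarrow> proper_over K N"
  unfolding proper_over_def set_mult_def by blast

text \<open>Continuity, positivity and invariance are inherited; the support condition is the one
  that properness has to supply.\<close>

lemma cc_mono:
  assumes p: "proper_over K N" and NK: "N \<subseteq> K" and f: "f \<in> cc K"
  shows "f \<in> cc N"
proof -
  obtain C where C: "compactin T C" "\<And>x. x \<in> carrier G \<Longrightarrow> f x \<noteq> 0 \<Longrightarrow> x \<in> C <#> K"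
    using cc_supp[OF f] by blast
  obtain D where D: "compactin T D" "C <#> K \<subseteq> D <#> N" using proper_overD[OF p C(1)] .
  show ?thesis
    by (rule ccI[OF cc_cont[OF f] cc_nonneg[OF f] _ D(1)]) (use cc_inv[OF f] NK C(2) D(2) in auto)
qed

lemma l_coset_mult:
  assumes N: "admissible N" and "x \<in> carrier G" "y \<in> carrier G"
  shows "(x <#\<^bsub>G\<^esub> N) <#> (y <#\<^bsub>G\<^esub> N) = (x \<otimes> y) <#\<^bsub>G\<^esub> N"
proof -
  interpret N: normal N G using N by (simp add: admissible_def)
  have "N #> z = z <#\<^bsub>G\<^esub> N" if "z \<in> carrier G" for z using N.coset_eq that by simp
  then show ?thesis using N.rcos_sum[of x y] assms by simp
qed

end

section \<open>The action of a layer, and almost periodicity of its orbits\<close>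

locale compact_layer = lch_right_top_group +
  fixes K N :: "'a set"
  assumes K: "admissible K" and N: "admissible N" and NK: "N \<subseteq> K" and K_compact: "compactin T K"
    and joint: "continuous_map
      (prod_topology (coset_space N) (coset_topology G T K N)) (coset_space N) (\<lambda>(A, B). A <#> B)"
begin

abbreviation (input) "TK \<equiv> subtopology T K"

lemma K_sub: "K \<subseteq> carrier G"
  using admissible_subset[OF K] by blast

lemma N_sub: "N \<subseteq> carrier G"
  using admissible_subset[OF N] by blast

lemma topspace_TK: "topspace TK = K"
  using K_sub topspace_T by auto

lemma coset_cont_K: "continuous_map TK (coset_topology G T K N) (\<lambda>x. x <#\<^bsub>G\<^esub> N)"
  unfolding coset_topology_def by (rule quotient_imp_continuous_map[OF quotient_map_quotient_topology])

text \<open>The left factor has to be continuous only modulo N, and so is the product. The lemma can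
  therefore be applied repeatedly to attach further factors from K on the right.\<close>

lemma coset_mult_cont:
  assumes "continuous_map Z (coset_space N) (\<lambda>z. a z <#\<^bsub>G\<^esub> N)" "continuous_map Z TK b"
    and "\<And>z. z \<in> topspace Z \<Longrightarrow> a z \<in> carrier G"
  shows "continuous_map Z (coset_space N) (\<lambda>z. (a z \<otimes> b z) <#\<^bsub>G\<^esub> N)"
proof -
  have "continuous_map Z (coset_topology G T K N) (\<lambda>z. b z <#\<^bsub>G\<^esub> N)"
    using continuous_map_compose[OF assms(2) coset_cont_K] by (simp add: o_def)
  then have "continuous_map Z (coset_space N) ((\<lambda>(A, B). A <#> B) \<circ> (\<lambda>z. (a z <#\<^bsub>G\<^esub> N, b z <#\<^bsub>G\<^esub> N)))"
    using assms(1) by (intro continuous_map_compose[OF _ joint] continuous_map_pairedI)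
  moreover have "((\<lambda>(A, B). A <#> B) \<circ> (\<lambda>z. (a z <#\<^bsub>G\<^esub> N, b z <#\<^bsub>G\<^esub> N))) z = (a z \<otimes> b z) <#\<^bsub>G\<^esub> N"
    if z: "z \<in> topspace Z" for z
  proof -
    have "b z \<in> topspace TK" using assms(2) z by (auto simp: continuous_map_def)
    then have "b z \<in> carrier G" using topspace_TK K_sub by auto
    then show ?thesis using l_coset_mult[OF N assms(3)[OF z]] by simp
  qed
  ultimately show ?thesis by (rule continuous_map_eq)
qed

lemma coset_cont_T: "continuous_map T (coset_space N) (\<lambda>x. x <#\<^bsub>G\<^esub> N)"
  by (rule quotient_imp_continuous_map[OF quotient_map_coset])

lemma joint_cont:
  assumes f: "f \<in> cc N"
  shows "continuous_map (prod_topology TK T) euclideanreal (\<lambda>(k, x). f (x \<otimes> k))"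
proof -
  obtain F where F: "continuous_map (coset_space N) euclideanreal F" "\<And>x. x \<in> carrier G \<Longrightarrow> F (x <#\<^bsub>G\<^esub> N) = f x"
    using cc_factor[OF N cc_cont[OF f] cc_inv[OF f]] by blast
  have "continuous_map (prod_topology TK T) (coset_space N) (\<lambda>z. (snd z \<otimes> fst z) <#\<^bsub>G\<^esub> N)"
    using continuous_map_compose[OF continuous_map_snd coset_cont_T]
    by (intro coset_mult_cont continuous_map_fst) (auto simp: o_def topspace_T)
  from continuous_map_compose[OF this F(1)]
  have "continuous_map (prod_topology TK T) euclideanreal (\<lambda>z. F ((snd z \<otimes> fst z) <#\<^bsub>G\<^esub> N))"
    by (simp add: o_def)
  then show ?thesis
    by (rule continuous_map_eq) (use F(2) K_sub topspace_T in auto)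
qed

text \<open>The product x k z l is built from the constant x by three applications of
  \<open>coset_mult_cont\<close>.\<close>

lemma joint_cont3:
  assumes f: "f \<in> cc N" and x: "x \<in> carrier G"
  shows "continuous_map (prod_topology (prod_topology TK TK) TK) euclideanreal
    (\<lambda>((k, l), z). f (x \<otimes> (k \<otimes> z \<otimes> l)))"
proof -
  obtain F where F: "continuous_map (coset_space N) euclideanreal F" "\<And>x. x \<in> carrier G \<Longrightarrow> F (x <#\<^bsub>G\<^esub> N) = f x"
    using cc_factor[OF N cc_cont[OF f] cc_inv[OF f]] by blast
  let ?Z = "prod_topology (prod_topology TK TK) TK"
  have 1: "continuous_map ?Z TK (\<lambda>p. fst (fst p))" "continuous_map ?Z TK (\<lambda>p. snd (fst p))" "continuous_map ?Z TK snd"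
    using continuous_map_compose[OF continuous_map_fst continuous_map_fst, of TK TK TK]
      continuous_map_compose[OF continuous_map_fst continuous_map_snd, of TK TK TK]
    by (auto simp: o_def continuous_map_snd)
  have car: "fst (fst p) \<in> carrier G" "snd (fst p) \<in> carrier G" "snd p \<in> carrier G" if "p \<in> topspace ?Z" for p
    using that K_sub by auto
  have "continuous_map ?Z (coset_space N)
      (\<lambda>p. (x \<otimes> fst (fst p) \<otimes> snd p \<otimes> snd (fst p)) <#\<^bsub>G\<^esub> N)"
    using car x by (intro coset_mult_cont 1) (auto simp: topspace_coset_space)
  from continuous_map_compose[OF this F(1)]
  have "continuous_map ?Z euclideanreal (\<lambda>p. F ((x \<otimes> fst (fst p) \<otimes> snd p \<otimes> snd (fst p)) <#\<^bsub>G\<^esub> N))"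
    by (simp add: o_def)
  then show ?thesis
  proof (rule continuous_map_eq)
    fix p assume "p \<in> topspace ?Z"
    from car[OF this] x
    show "F ((x \<otimes> fst (fst p) \<otimes> snd p \<otimes> snd (fst p)) <#\<^bsub>G\<^esub> N) = (\<lambda>((k, l), z). f (x \<otimes> (k \<otimes> z \<otimes> l))) p"
      by (simp add: F(2) case_prod_unfold m_assoc)
  qed
qed

text \<open>By joint continuity the image of K x C under (k, c) \<mapsto> c k N is compact in G/N,
  and it lifts to a compact subset of G.\<close>

lemma layer_proper: "proper_over K N"
  unfolding proper_over_def
proof (intro allI impI)
  fix C assume C: "compactin T C"
  have "continuous_map (prod_topology TK T) (coset_space N) (\<lambda>z. (snd z \<otimes> fst z) <#\<^bsub>G\<^esub> N)"
    using continuous_map_compose[OF continuous_map_snd coset_cont_T]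
    by (intro coset_mult_cont continuous_map_fst) (auto simp: o_def topspace_T)
  moreover have "compactin (prod_topology TK T) (K \<times> C)"
    using C K_compact by (simp add: compactin_Times compactin_subtopology)
  ultimately have "compactin (coset_space N) ((\<lambda>z. (snd z \<otimes> fst z) <#\<^bsub>G\<^esub> N) ` (K \<times> C))"
    using image_compactin by blast
  then obtain D where D: "compactin T D" "(\<lambda>z. (snd z \<otimes> fst z) <#\<^bsub>G\<^esub> N) ` (K \<times> C) \<subseteq> (\<lambda>x. x <#\<^bsub>G\<^esub> N) ` D"
    by (rule compactin_coset_space_lift[OF N])
  have Dc: "D \<subseteq> carrier G" using carrier_compactin[OF D(1)] by auto
  have "C <#> K \<subseteq> D <#> N"
  proof
    fix y assume "y \<in> C <#> K"
    then obtain c k where ck: "c \<in> C" "k \<in> K" "y = c \<otimes> k" by (auto simp: set_mult_def)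
    have yc: "y \<in> carrier G" using ck carrier_compactin[OF C] K_sub by auto
    have "(k, c) \<in> K \<times> C" using ck by simp
    then have "y <#\<^bsub>G\<^esub> N \<in> (\<lambda>x. x <#\<^bsub>G\<^esub> N) ` D" using D(2) ck(3) by force
    then obtain d where d: "d \<in> D" "d <#\<^bsub>G\<^esub> N = y <#\<^bsub>G\<^esub> N" by auto
    then have "inv d \<otimes> y \<in> N" using l_coset_eq_iff[OF N _ yc, of d] Dc by auto
    then show "y \<in> D <#> N" using set_mult_mem_iff[OF N Dc yc] d(1) by blast
  qed
  then show "\<exists>D. compactin T D \<and> C <#> K \<subseteq> D <#> N" using D(1) by blast
qed

text \<open>K as an abstract group, so that the mean defined without topology applies to it.\<close>

definition KG where "KG = G\<lparr>carrier := K\<rparr>"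

sublocale KG: group KG
  unfolding KG_def using subgroup.subgroup_is_group[OF admissible_subgroup[OF K] is_group] .

lemma KG_simps [simp]: "carrier KG = K" "x \<otimes>\<^bsub>KG\<^esub> y = x \<otimes> y"
  by (simp_all add: KG_def)

text \<open>Tubes over the compact set K x K of outer factors (k, l) give neighbourhoods of z on
  which f (x k z l) is nearly constant uniformly in k and l. A finite subcover of K is the required
  net.\<close>

lemma almost_periodic_orbit:
  assumes f: "f \<in> cc N" and x: "x \<in> carrier G"
  shows "KG.almost_periodic (\<lambda>k. f (x \<otimes> k))"
  unfolding KG.almost_periodic_def KG_simps
proof (intro allI impI)
  fix \<epsilon> :: real assume e: "\<epsilon> > 0"
  have KK: "compactin (prod_topology TK TK) (K \<times> K)" and KK': "compactin TK K"
    using K_compact by (simp_all add: compactin_Times compactin_subtopology)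
  have "\<exists>V. openin TK V \<and> z \<in> V \<and> (\<forall>v\<in>V. \<forall>k\<in>K. \<forall>l\<in>K. \<bar>f (x \<otimes> (k \<otimes> v \<otimes> l)) - f (x \<otimes> (k \<otimes> z \<otimes> l))\<bar> \<le> \<epsilon>)"
    if z: "z \<in> K" for z
  proof -
    have "z \<in> topspace TK" using z topspace_TK by simp
    then obtain V where V: "openin TK V" "z \<in> V"
      "\<And>p v. p \<in> K \<times> K \<Longrightarrow> v \<in> V \<Longrightarrow>
        \<bar>(\<lambda>((k, l), z). f (x \<otimes> (k \<otimes> z \<otimes> l))) (p, v) - (\<lambda>((k, l), z). f (x \<otimes> (k \<otimes> z \<otimes> l))) (p, z)\<bar> < \<epsilon>"
      using continuous_map_tube[OF joint_cont3[OF f x] KK _ e, of z] by blast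
    have "\<bar>f (x \<otimes> (k \<otimes> v \<otimes> l)) - f (x \<otimes> (k \<otimes> z \<otimes> l))\<bar> \<le> \<epsilon>" if "v \<in> V" "k \<in> K" "l \<in> K" for v k l
      using V(3)[of "(k, l)" v] that by simp
    then show ?thesis using V(1,2) by blast
  qed
  then obtain V where V: "\<And>z. z \<in> K \<Longrightarrow> openin TK (V z) \<and> z \<in> V z"
    "\<And>z v k l. z \<in> K \<Longrightarrow> v \<in> V z \<Longrightarrow> k \<in> K \<Longrightarrow> l \<in> K \<Longrightarrow> \<bar>f (x \<otimes> (k \<otimes> v \<otimes> l)) - f (x \<otimes> (k \<otimes> z \<otimes> l))\<bar> \<le> \<epsilon>"
    by metis
  obtain A where A: "finite A" "A \<subseteq> K" "K \<subseteq> (\<Union>z\<in>A. V z)"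
    by (rule compactin_finite_subcover_points[OF KK' V(1)])
  have "\<exists>a\<in>A. \<forall>k\<in>K. \<forall>l\<in>K. \<bar>f (x \<otimes> (k \<otimes> z \<otimes> l)) - f (x \<otimes> (k \<otimes> a \<otimes> l))\<bar> \<le> \<epsilon>" if z: "z \<in> K" for z
  proof -
    obtain a where a: "a \<in> A" "z \<in> V a" using A(3) z by blast
    then have "a \<in> K" using A(2) by blast
    then show ?thesis using V(2) a by blast
  qed
  then show "\<exists>A. finite A \<and> A \<subseteq> K \<and> (\<forall>z\<in>K. \<exists>a\<in>A. \<forall>k\<in>K. \<forall>l\<in>K.
      \<bar>f (x \<otimes> (k \<otimes> z \<otimes> l)) - f (x \<otimes> (k \<otimes> a \<otimes> l))\<bar> \<le> \<epsilon>)"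
    using A(1,2) by blast
qed

section \<open>Averaging over the cosets of K\<close>

definition fibre_mean :: "('a \<Rightarrow> real) \<Rightarrow> 'a \<Rightarrow> real" where
  "fibre_mean f x = KG.mean (\<lambda>k. f (x \<otimes> k))"

lemma fibre_mean_mono:
  assumes "f \<in> cc N" "g \<in> cc N" "x \<in> carrier G" "\<And>x. x \<in> carrier G \<Longrightarrow> f x \<le> g x"
  shows "fibre_mean f x \<le> fibre_mean g x"
  unfolding fibre_mean_def using assms K_sub
  by (intro KG.mean_mono almost_periodic_orbit) auto

lemma fibre_mean_add:
  assumes "f \<in> cc N" "g \<in> cc N" "x \<in> carrier G"
  shows "fibre_mean (\<lambda>x. f x + g x) x = fibre_mean f x + fibre_mean g x"
  unfolding fibre_mean_def
  using KG.mean_add[OF almost_periodic_orbit[OF assms(1,3)] almost_periodic_orbit[OF assms(2,3)]]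
    almost_periodic_orbit[OF cc_add[OF assms(1,2)] assms(3)] by simp

lemma fibre_mean_const:
  assumes "f \<in> cc N" "x \<in> carrier G" "\<And>k. k \<in> K \<Longrightarrow> f (x \<otimes> k) = c"
  shows "fibre_mean f x = c"
  unfolding fibre_mean_def
  using KG.mean_cong[OF almost_periodic_orbit[OF assms(1,2)] KG.almost_periodic_const, of c] assms(3)
    KG.mean_const by simp

lemma fibre_mean_perturb:
  assumes f: "f \<in> cc N" and "x \<in> carrier G" "y \<in> carrier G" "\<And>k. k \<in> K \<Longrightarrow> f (x \<otimes> k) \<le> f (y \<otimes> k) + \<epsilon>"
  shows "fibre_mean f x \<le> fibre_mean f y + \<epsilon>"
proof -
  note ap = almost_periodic_orbit[OF f]
  have ap': "KG.almost_periodic (\<lambda>k. f (y \<otimes> k) + \<epsilon>)"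
    using ap[OF assms(3)] unfolding KG.almost_periodic_def by simp
  have "KG.mean (\<lambda>k. f (x \<otimes> k)) \<le> KG.mean (\<lambda>k. f (y \<otimes> k) + \<epsilon>)"
    using assms by (intro KG.mean_mono ap ap') auto
  also have "\<dots> = KG.mean (\<lambda>k. f (y \<otimes> k)) + \<epsilon>"
    using KG.mean_add[OF ap[OF assms(3)] KG.almost_periodic_const ap'] KG.mean_const by simp
  finally show ?thesis by (simp add: fibre_mean_def)
qed

text \<open>A tube over K makes nearby orbit functions uniformly close, which gives continuity; left
  invariance of the mean gives invariance under K.\<close>

lemma fibre_mean_cc:
  assumes f: "f \<in> cc N"
  shows "fibre_mean f \<in> cc K"
proof -
  obtain C where C: "compactin T C" "\<And>x. x \<in> carrier G \<Longrightarrow> f x \<noteq> 0 \<Longrightarrow> x \<in> C <#> N"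
    using cc_supp[OF f] by blast
  have Cc: "C \<subseteq> carrier G" using carrier_compactin[OF C(1)] by auto
  show ?thesis
  proof (rule ccI[OF _ _ _ C(1)])
    show "continuous_map T euclideanreal (fibre_mean f)"
    proof (rule continuous_map_realI)
      fix x :: 'a and \<epsilon> :: real assume x: "x \<in> topspace T" and "\<epsilon> > 0"
      then have e: "\<epsilon> / 2 > 0" by simp
      have KK': "compactin TK K" using K_compact by (simp add: compactin_subtopology)
      obtain V where V: "openin T V" "x \<in> V" "\<And>k v. k \<in> K \<Longrightarrow> v \<in> V \<Longrightarrow>
          \<bar>(\<lambda>(k, x). f (x \<otimes> k)) (k, v) - (\<lambda>(k, x). f (x \<otimes> k)) (k, x)\<bar> < \<epsilon> / 2"
        using continuous_map_tube[OF joint_cont[OF f] KK' x e] by blast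
      have "\<bar>fibre_mean f y - fibre_mean f x\<bar> < \<epsilon>" if y: "y \<in> V" for y
      proof -
        have c: "x \<in> carrier G" "y \<in> carrier G" using x y carrier_openin[OF V(1)] topspace_T by auto
        have d: "\<bar>f (y \<otimes> k) - f (x \<otimes> k)\<bar> < \<epsilon> / 2" if "k \<in> K" for k using V(3)[OF that y] by simp
        have "f (y \<otimes> k) \<le> f (x \<otimes> k) + \<epsilon> / 2" "f (x \<otimes> k) \<le> f (y \<otimes> k) + \<epsilon> / 2" if "k \<in> K" for k
          using d[OF that] by linarith+
        then have "fibre_mean f y \<le> fibre_mean f x + \<epsilon> / 2" "fibre_mean f x \<le> fibre_mean f y + \<epsilon> / 2"
          using c by (auto intro!: fibre_mean_perturb[OF f])
        then show ?thesis using \<open>\<epsilon> > 0\<close> by linarith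
      qed
      then show "\<exists>V. openin T V \<and> x \<in> V \<and> (\<forall>y\<in>V. \<bar>fibre_mean f y - fibre_mean f x\<bar> < \<epsilon>)" using V by blast
    qed
    show "0 \<le> fibre_mean f x" if x: "x \<in> carrier G" for x
    proof -
      have "KG.mean (\<lambda>k. 0) \<le> KG.mean (\<lambda>k. f (x \<otimes> k))"
        using cc_nonneg[OF f] x K_sub by (intro KG.mean_mono KG.almost_periodic_const almost_periodic_orbit[OF f]) auto
      then show ?thesis using KG.mean_const[of 0] by (simp add: fibre_mean_def)
    qed
    show "fibre_mean f (x \<otimes> k) = fibre_mean f x" if x: "x \<in> carrier G" and k: "k \<in> K" for x k
    proof -
      have kc: "k \<in> carrier G" using k K_sub by auto
      have ap1: "KG.almost_periodic (\<lambda>l. f (x \<otimes> k \<otimes> l))" using almost_periodic_orbit[OF f, of "x \<otimes> k"] x kc by simp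
      note ap2 = almost_periodic_orbit[OF f x]
      have eq: "f (x \<otimes> k \<otimes> l) = f (x \<otimes> (k \<otimes> l))" if "l \<in> K" for l using that x kc K_sub by (auto simp: m_assoc)
      \<comment> \<open>Almost periodicity of the left translate is read off from the orbit through
        x k.\<close>
      have ap3: "KG.almost_periodic (\<lambda>l. f (x \<otimes> (k \<otimes>\<^bsub>KG\<^esub> l)))"
        by (rule KG.almost_periodic_cong[OF ap1]) (simp add: eq)
      have "KG.mean (\<lambda>l. f (x \<otimes> k \<otimes> l)) = KG.mean (\<lambda>l. f (x \<otimes> (k \<otimes>\<^bsub>KG\<^esub> l)))"
        using eq by (intro KG.mean_cong ap1 ap3) auto
      also have "\<dots> = KG.mean (\<lambda>l. f (x \<otimes> l))"
        using KG.mean_left_translate[OF ap2 ap3] k by simp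
      finally show ?thesis by (simp add: fibre_mean_def)
    qed
    show "x \<in> C <#> K" if x: "x \<in> carrier G" and nz: "fibre_mean f x \<noteq> 0" for x
    proof -
      obtain k where k: "k \<in> K" "f (x \<otimes> k) \<noteq> 0" using fibre_mean_const[OF f x, of 0] nz by auto
      then have "x \<otimes> k \<in> C <#> N" using C(2) x K_sub by auto
      then have "x \<otimes> k \<in> C <#> K" using NK by (auto simp: set_mult_def)
      then show ?thesis using set_mult_right_imp[OF K Cc _ k(1) x] by blast
    qed
  qed
qed

text \<open>Since x k g = (x g)(inv g k g), right translation of f amounts to the automorphism k
  \<mapsto> inv g k g of K, under which the mean is invariant. Both functions of k are almost
  periodic because they are orbit functions, at x of the translated function and at x g of f,
  whether or not the automorphism is continuous.\<close>

lemma fibre_mean_translate: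
  assumes f: "f \<in> cc N" and g: "g \<in> carrier G" and x: "x \<in> carrier G"
  shows "fibre_mean (\<lambda>x. f (x \<otimes> g)) x = fibre_mean f (x \<otimes> g)"
proof -
  define h where "h = (\<lambda>k. inv g \<otimes> k \<otimes> g)"
  have eq: "f (x \<otimes> k \<otimes> g) = f (x \<otimes> g \<otimes> h k)" if "k \<in> K" for k
  proof -
    have "k \<in> carrier G" using that K_sub by auto
    then have "x \<otimes> k \<otimes> g = x \<otimes> g \<otimes> h k" using x g by (simp add: h_def m_assoc) (simp flip: m_assoc)
    then show ?thesis by simp
  qed
  have ap1: "KG.almost_periodic (\<lambda>k. f (x \<otimes> k \<otimes> g))"
    using almost_periodic_orbit[OF cc_translate[OF N f g] x] .
  have ap2: "KG.almost_periodic (\<lambda>k. f (x \<otimes> g \<otimes> k))" using almost_periodic_orbit[OF f] x g by simp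
  have ap3: "KG.almost_periodic (\<lambda>k. f (x \<otimes> g \<otimes> h k))"
    by (rule KG.almost_periodic_cong[OF ap1]) (simp add: eq)
  have "KG.mean (\<lambda>k. f (x \<otimes> k \<otimes> g)) = KG.mean (\<lambda>k. f (x \<otimes> g \<otimes> h k))"
    using eq by (intro KG.mean_cong ap1 ap3) auto
  also have "\<dots> = KG.mean (\<lambda>k. f (x \<otimes> g \<otimes> k))"
  proof (rule KG.mean_automorphism[OF ap2 ap3], unfold KG_simps)
    show "h (k \<otimes> l) = h k \<otimes> h l" if "k \<in> K" "l \<in> K" for k l
    proof -
      have c: "k \<in> carrier G" "l \<in> carrier G" using that K_sub by auto
      have "g \<otimes> (inv g \<otimes> (l \<otimes> g)) = l \<otimes> g" using c g by (simp flip: m_assoc)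
      then show ?thesis using c g by (simp add: h_def m_assoc)
    qed
    have hK: "h k \<in> K" if "k \<in> K" for k using admissible_conj'[OF K that g] by (simp add: h_def)
    have "k \<in> h ` K" if k: "k \<in> K" for k
    proof -
      have "k = h (g \<otimes> k \<otimes> inv g)"
        using k K_sub g by (auto simp: h_def m_assoc subset_iff) (simp flip: m_assoc)
      then show ?thesis using admissible_conj[OF K k g] by blast
    qed
    then show "h ` K = K" using hK by auto
  qed
  finally show ?thesis by (simp add: fibre_mean_def)
qed

text \<open>The extension is m composed with the fibre mean, which changes nothing on the carrier
  for functions already constant on the cosets of K.\<close>

lemma functional_extends_layer:
  assumes m: "invariant_functional K m"
  obtains m' where "invariant_functional N m'" "\<And>f. f \<in> cc K \<Longrightarrow> m' f = m f"
proof (rule that[of "\<lambda>f. m (fibre_mean f)"])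
  have ext: "m (fibre_mean f) = m f" if f: "f \<in> cc K" for f
  proof -
    have fN: "f \<in> cc N" using cc_mono[OF layer_proper NK f] .
    have "fibre_mean f x = f x" if "x \<in> carrier G" for x
      using fibre_mean_const[OF fN that] cc_inv[OF f that] by simp
    then show ?thesis using functional_cong[OF m fibre_mean_cc[OF fN] f] by simp
  qed
  then show "m (fibre_mean f) = m f" if "f \<in> cc K" for f using that by simp
  show "invariant_functional N (\<lambda>f. m (fibre_mean f))"
    unfolding invariant_functional_def
  proof (intro conjI ballI impI)
    fix f g assume f: "f \<in> cc N" and g: "g \<in> cc N"
    note c = fibre_mean_cc[OF f] fibre_mean_cc[OF g]
    show "m (fibre_mean (\<lambda>x. f x + g x)) = m (fibre_mean f) + m (fibre_mean g)"
      using functional_cong[OF m fibre_mean_cc[OF cc_add[OF f g]] cc_add[OF c]]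
        fibre_mean_add[OF f g] functional_add[OF m c] by simp
    show "m (fibre_mean f) \<le> m (fibre_mean g)" if "\<forall>x\<in>carrier G. f x \<le> g x"
      using functional_mono[OF m c] fibre_mean_mono[OF f g] that by simp
  next
    fix f g assume f: "f \<in> cc N" and g: "g \<in> carrier G"
    note c = fibre_mean_cc[OF f]
    show "m (fibre_mean (\<lambda>x. f (x \<otimes> g))) = m (fibre_mean f)"
      using functional_cong[OF m fibre_mean_cc[OF cc_translate[OF N f g]] cc_translate[OF K c g]]
        fibre_mean_translate[OF f g] functional_translate[OF m c g] by simp
  next
    obtain f where f: "f \<in> cc K" "m f \<noteq> 0" using m unfolding invariant_functional_def by blast
    then have "m (fibre_mean f) \<noteq> 0" using ext by simp
    then show "\<exists>f\<in>cc N. m (fibre_mean f) \<noteq> 0" using cc_mono[OF layer_proper NK f(1)] by blast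
  qed
qed

end

section \<open>Limits of functionals\<close>

locale functional_chain = lch_right_top_group +
  fixes I :: "'i::linorder set" and L :: "'i \<Rightarrow> 'a set" and m :: "'i \<Rightarrow> ('a \<Rightarrow> real) \<Rightarrow> real" and N :: "'a set"
  assumes I_ne: "I \<noteq> {}" and adm: "\<And>i. i \<in> I \<Longrightarrow> admissible (L i)" and admN: "admissible N"
    and N_eq: "N = (\<Inter>i\<in>I. L i)"
    and anti: "\<And>i j. i \<in> I \<Longrightarrow> j \<in> I \<Longrightarrow> i \<le> j \<Longrightarrow> L j \<subseteq> L i"
    and comp: "\<And>i. i \<in> I \<Longrightarrow> compactin T (L i)"
    and proper: "\<And>i j. i \<in> I \<Longrightarrow> j \<in> I \<Longrightarrow> i \<le> j \<Longrightarrow> proper_over (L i) (L j)"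
    and func: "\<And>i. i \<in> I \<Longrightarrow> invariant_functional (L i) (m i)"
    and coherent: "\<And>i j f. i \<in> I \<Longrightarrow> j \<in> I \<Longrightarrow> i \<le> j \<Longrightarrow> f \<in> cc (L i) \<Longrightarrow> m j f = m i f"
begin

lemma N_sub: "i \<in> I \<Longrightarrow> N \<subseteq> L i"
  using N_eq by auto

lemma cc_chain: "i \<in> I \<Longrightarrow> j \<in> I \<Longrightarrow> i \<le> j \<Longrightarrow> f \<in> cc (L i) \<Longrightarrow> f \<in> cc (L j)"
  using cc_mono[OF proper anti] .

section \<open>Compactness along the chain of subgroups\<close>

text \<open>The sets y L i form a decreasing chain of closed sets that all meet C, and a common
  point x has inv x y in every L i, hence in N. Closure of L i under inverses (\<open>swap\<close>)
  lets the condition on y be read as one on x.\<close>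

lemma set_mult_Inter:
  assumes C: "compactin T C" and y: "y \<in> carrier G" and all: "\<And>i. i \<in> I \<Longrightarrow> y \<in> C <#> L i"
  shows "y \<in> C <#> N"
proof -
  have Cc: "C \<subseteq> carrier G" using carrier_compactin[OF C] by auto
  have y1: "compactin T {y}" using y topspace_T by simp
  have swap: "x \<in> {y} <#> L i \<longleftrightarrow> inv x \<otimes> y \<in> L i" if "x \<in> carrier G" "i \<in> I" for x i
  proof -
    have "inv (inv y \<otimes> x) = inv x \<otimes> y" "inv (inv x \<otimes> y) = inv y \<otimes> x"
      using that y by (simp_all add: inv_mult_group)
    then have "inv y \<otimes> x \<in> L i \<longleftrightarrow> inv x \<otimes> y \<in> L i"
      using subgroup.m_inv_closed[OF admissible_subgroup[OF adm[OF that(2)]]] by metis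
    then show ?thesis using set_mult_mem_iff[OF adm[OF that(2)] _ that(1), of "{y}"] y by simp
  qed
  have "\<exists>x\<in>C. \<forall>i\<in>I. x \<in> {y} <#> L i"
  proof (rule compact_chain_Inter[OF C I_ne])
    fix i assume i: "i \<in> I"
    obtain c where "c \<in> C" "inv c \<otimes> y \<in> L i"
      using set_mult_mem_iff[OF adm[OF i] Cc y] all[OF i] by blast
    then have "c \<in> C \<inter> ({y} <#> L i)" using swap[OF _ i] Cc by auto
    then show "closedin T ({y} <#> L i) \<and> C \<inter> ({y} <#> L i) \<noteq> {}"
      using closedin_compact_set_mult[OF adm[OF i] y1] by blast
  next
    fix i j assume "i \<in> I" "j \<in> I" "i \<le> j"
    then show "{y} <#> L j \<subseteq> {y} <#> L i" using anti[of i j] by (auto simp: set_mult_def)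
  qed
  then obtain x where x: "x \<in> C" "\<forall>i\<in>I. x \<in> {y} <#> L i" by blast
  then have "inv x \<otimes> y \<in> N" unfolding N_eq using swap Cc by auto
  then show ?thesis using set_mult_mem_iff[OF admN Cc y] x(1) by blast
qed

text \<open>By normality the left coset x L i is a right translate of a compact set.\<close>

lemma singleton_set_mult_compact:
  assumes i: "i \<in> I" and x: "x \<in> carrier G"
  shows "compactin T ({x} <#> L i)"
proof -
  interpret Li: normal "L i" G using adm[OF i] by (simp add: admissible_def)
  have "{x} <#> L i = L i #> x" using Li.coset_eq x by (simp add: set_mult_def l_coset_def)
  then show ?thesis using compactin_r_coset[OF comp[OF i] x] by simp
qed

text \<open>If no x L i were contained in V, the closed sets x L i - V would have a common point by
  compactness, and that point would lie in x N but outside V.\<close>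

lemma coset_in_open:
  assumes V: "openin T V" and x: "x \<in> carrier G" and sub: "{x} <#> N \<subseteq> V"
  shows "\<exists>i\<in>I. {x} <#> L i \<subseteq> V"
proof (rule ccontr)
  assume "\<not> ?thesis"
  then have neg: "\<And>i. i \<in> I \<Longrightarrow> ({x} <#> L i) - V \<noteq> {}" by blast
  have x1: "compactin T {x}" using x topspace_T by simp
  obtain i0 where i0: "i0 \<in> I" using I_ne by blast
  have mono: "{x} <#> L j \<subseteq> {x} <#> L i" if "i \<in> I" "j \<in> I" "i \<le> j" for i j
    using anti[OF that] by (auto simp: set_mult_def)
  have "\<exists>y\<in>{x} <#> L i0. \<forall>i\<in>I. y \<in> ({x} <#> L i) - V"
  proof (rule compact_chain_Inter[OF singleton_set_mult_compact[OF i0 x] I_ne])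
    fix i assume i: "i \<in> I"
    have "closedin T (({x} <#> L i) - V)"
      using closedin_compact_set_mult[OF adm[OF i] x1] V by (simp add: closedin_diff)
    moreover have "max i i0 \<in> I" using i i0 by (simp add: max_def)
    then have "({x} <#> L i0) \<inter> (({x} <#> L i) - V) \<noteq> {}"
      using neg[of "max i i0"] mono[OF i, of "max i i0"] mono[OF i0, of "max i i0"] by fastforce
    ultimately show "closedin T (({x} <#> L i) - V) \<and> ({x} <#> L i0) \<inter> (({x} <#> L i) - V) \<noteq> {}" ..
  qed (use mono in blast)
  then obtain y where y: "y \<in> {x} <#> L i0" "\<forall>i\<in>I. y \<in> ({x} <#> L i) - V" by blast
  have "y \<in> carrier G" using y(1) x set_mult_subset_carrier[OF adm[OF i0], of "{x}"] by auto
  then have "y \<in> {x} <#> N" using set_mult_Inter[OF x1] y(2) by blast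
  then show False using sub y(2) i0 by blast
qed

lemma functional_chain_max:
  assumes "i \<in> I" "j \<in> I"
  obtains k where "k \<in> I" "i \<le> k" "j \<le> k"
  using assms by (metis max.cobounded1 max.cobounded2 max_def)

section \<open>Properness at limits\<close>

text \<open>For countable cofinality this is Baire's theorem.\<close>

lemma open_in_compact_countable:
  assumes U: "openin T U" "\<one> \<in> U" "U \<subseteq> C" and C: "compactin T C"
    and s: "\<And>n::nat. s n \<in> I" "\<And>i. i \<in> I \<Longrightarrow> \<exists>n. i \<le> s n"
  shows "\<exists>i\<in>I. \<exists>W. openin T W \<and> W \<noteq> {} \<and> W <#> L i \<subseteq> C <#> N"
proof (rule ccontr)
  assume neg: "\<not> ?thesis"
  have Cc: "C \<subseteq> carrier G" using carrier_compactin[OF C] by auto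
  have CN: "closedin T (C <#> N)" by (rule closedin_compact_set_mult[OF admN C])
  \<comment> \<open>F n is closed, because its complement is the saturation under L (s n) of the
    open complement of C N. The interior of an F n would serve as W, so by assumption all these
    interiors are empty.\<close>
  define F where "F = (\<lambda>n. {x \<in> carrier G. {x} <#> L (s n) \<subseteq> C <#> N})"
  have F: "closedin T (F n) \<and> T interior_of (F n) = {}" for n
  proof
    note a = adm[OF s(1)[of n]]
    have "F n = topspace T - ((topspace T - (C <#> N)) <#> L (s n))"
    proof (intro subset_antisym subsetI)
      fix x assume x: "x \<in> F n"
      have "x \<notin> (topspace T - (C <#> N)) <#> L (s n)"
      proof
        assume "x \<in> (topspace T - (C <#> N)) <#> L (s n)"
        then obtain z l where z: "z \<in> carrier G" "z \<notin> C <#> N" "l \<in> L (s n)" "x = z \<otimes> l"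
          by (auto simp: set_mult_def topspace_T)
        have l: "l \<in> carrier G" "inv l \<in> L (s n)"
          using z(3) admissible_subset[OF a] subgroup.m_inv_closed[OF admissible_subgroup[OF a]] by auto
        then have "x \<otimes> inv l = z" using z by (simp add: m_assoc)
        then have "z \<in> {x} <#> L (s n)" using l by (auto simp: set_mult_def)
        then show False using x z(2) by (auto simp: F_def)
      qed
      then show "x \<in> topspace T - ((topspace T - (C <#> N)) <#> L (s n))"
        using x by (simp add: F_def topspace_T)
    next
      fix x assume x: "x \<in> topspace T - ((topspace T - (C <#> N)) <#> L (s n))"
      then have xc: "x \<in> carrier G" by (simp add: topspace_T)
      have "x \<otimes> l \<in> C <#> N" if l: "l \<in> L (s n)" for l
      proof (rule ccontr)
        assume "x \<otimes> l \<notin> C <#> N"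
        have lc: "l \<in> carrier G" "inv l \<in> L (s n)"
          using l admissible_subset[OF a] subgroup.m_inv_closed[OF admissible_subgroup[OF a]] by auto
        have "x \<otimes> l \<in> topspace T - (C <#> N)" using \<open>x \<otimes> l \<notin> C <#> N\<close> xc lc by (simp add: topspace_T)
        then have "x \<otimes> l \<otimes> inv l \<in> (topspace T - (C <#> N)) <#> L (s n)" using lc(2) by (auto simp: set_mult_def)
        then show False using x xc lc by (simp add: m_assoc)
      qed
      then show "x \<in> F n" using xc by (auto simp: F_def set_mult_def)
    qed
    moreover have "openin T ((topspace T - (C <#> N)) <#> L (s n))"
      using CN admissible_subset[OF a] by (intro openin_set_mult) auto
    ultimately show "closedin T (F n)" by (simp only: closedin_diff closedin_topspace)
    have "T interior_of (F n) <#> L (s n) \<subseteq> C <#> N"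
      using interior_of_subset[of T "F n"] by (fastforce simp: F_def set_mult_def)
    then show "T interior_of (F n) = {}" using neg s(1)[of n] openin_interior_of by blast
  qed
  \<comment> \<open>For x in U the coset x N lies in the open set U N, so some x L i does too, and
    cofinality of s replaces i by some s n.\<close>
  have "U \<subseteq> \<Union>(range F)"
  proof
    fix x assume x: "x \<in> U"
    then have xc: "x \<in> carrier G" using carrier_openin[OF U(1)] by blast
    have "openin T (U <#> N)" using U(1) admissible_subset[OF admN] by (intro openin_set_mult) auto
    moreover have "{x} <#> N \<subseteq> U <#> N" using x by (auto simp: set_mult_def)
    ultimately obtain i where i: "i \<in> I" "{x} <#> L i \<subseteq> U <#> N" using coset_in_open[OF _ xc] by blast
    obtain n where "i \<le> s n" using s(2)[OF i(1)] by blast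
    then have "{x} <#> L (s n) \<subseteq> {x} <#> L i" using anti[OF i(1) s(1)] by (auto simp: set_mult_def)
    moreover have "U <#> N \<subseteq> C <#> N" using U(3) by (auto simp: set_mult_def)
    ultimately have "x \<in> F n" using i(2) xc by (auto simp: F_def)
    then show "x \<in> \<Union>(range F)" by blast
  qed
  then have "U \<subseteq> T interior_of \<Union>(range F)" using U(1) interior_of_maximal by blast
  moreover have "T interior_of \<Union>(range F) = {}"
    using F lc locally_compact_Hausdorff_imp_regular_space[OF lc haus] by (intro Baire_category_alt) auto
  ultimately show False using U(2) by blast
qed

text \<open>For uncountable cofinality the values \<open>c i\<close>, the masses of the sets \<open>C <#> L i\<close>, are eventually constant,
  so nothing open is lost in the intersection.\<close>

lemma open_in_compact_uncountable:
  assumes U: "openin T U" "U \<subseteq> C" and C: "compactin T C"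
    and nocof: "\<And>s::nat \<Rightarrow> 'i. (\<And>n. s n \<in> I) \<Longrightarrow> \<exists>i\<in>I. \<forall>n. s n \<le> i"
  shows "\<exists>i\<in>I. U <#> L i \<subseteq> C <#> N"
proof -
  have Cc: "C \<subseteq> carrier G" using carrier_compactin[OF C] by auto
  have opc: "openin T (carrier G)" using openin_topspace[of T] topspace_T by simp
  define S where "S = (\<lambda>i. {m j f |j f. j \<in> I \<and> f \<in> cc (L j) \<and> (\<forall>x\<in>C <#> L i. 1 \<le> f x)})"
  define c where "c = (\<lambda>i. Inf (S i))"
  have S_ne: "S i \<noteq> {}" if i: "i \<in> I" for i
  proof -
    obtain f where f: "f \<in> cc (L i)" "\<And>x. x \<in> C \<Longrightarrow> f x = 1"
      using urysohn_cc[OF adm[OF i] C opc Cc] admissible_subset[OF adm[OF i]] by (metis m_closed)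
    have "1 \<le> f x" if "x \<in> C <#> L i" for x
      using that f(2) cc_inv[OF f(1)] Cc by (auto simp: set_mult_def subset_iff)
    then show ?thesis using f(1) i unfolding S_def by blast
  qed
  have S_nonneg: "0 \<le> r" if "r \<in> S i" for r i using that functional_nonneg[OF func] unfolding S_def by blast
  then have bdd: "bdd_below (S i)" for i by (meson bdd_belowI)
  have c_anti: "c j \<le> c i" if ij: "i \<in> I" "j \<in> I" "i \<le> j" for i j
  proof -
    have "C <#> L j \<subseteq> C <#> L i" using anti[OF ij] by (auto simp: set_mult_def)
    then have "S i \<subseteq> S j" unfolding S_def by blast
    then show ?thesis unfolding c_def using S_ne[OF ij(1)] bdd by (intro cInf_superset_mono) auto
  qed
  have c_nonneg: "0 \<le> c i" if "i \<in> I" for i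
    unfolding c_def using S_ne[OF that] S_nonneg by (intro cInf_greatest) auto
  define a where "a = Inf (c ` I)"
  have bddc: "bdd_below (c ` I)" using c_nonneg by (meson bdd_belowI2)
  \<comment> \<open>A sequence of indices along which c approaches its infimum has an upper bound i0
    in I by \<open>nocof\<close>, and c is constant from i0 on.\<close>
  have "\<exists>i\<in>I. c i < a + 1 / real (Suc n)" for n
    using cInf_lessD[of "c ` I" "a + 1 / real (Suc n)"] I_ne by (auto simp: a_def)
  then obtain s where s: "\<And>n. s n \<in> I" "\<And>n. c (s n) < a + 1 / real (Suc n)" by metis
  obtain i0 where i0: "i0 \<in> I" "\<And>n. s n \<le> i0" using nocof[of s] s(1) by blast
  have const: "c i = c i0" if i: "i \<in> I" "i0 \<le> i" for i
  proof (rule antisym[OF c_anti[OF i0(1) i]])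
    have "c i0 \<le> a"
    proof (rule field_le_epsilon)
      fix e :: real assume "e > 0"
      then obtain n where n: "1 / real (Suc n) < e" using nat_approx_posE by blast
      have "c i0 \<le> c (s n)" using c_anti[OF s(1) i0(1) i0(2)] .
      then show "c i0 \<le> a + e" using s(2)[of n] n by linarith
    qed
    also have "a \<le> c i" unfolding a_def using i bddc by (intro cInf_lower) auto
    finally show "c i0 \<le> c i" .
  qed
  have "U <#> L i0 \<subseteq> C <#> N"
  proof (rule ccontr)
    assume "\<not> ?thesis"
    then obtain x where x: "x \<in> U <#> L i0" "x \<notin> C <#> N" by blast
    have UL: "U <#> L i0 \<subseteq> carrier G"
      using set_mult_subset_carrier[OF adm[OF i0(1)]] carrier_openin[OF U(1)] by blast
    then have xc: "x \<in> carrier G" using x by auto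
    obtain i1 where i1: "i1 \<in> I" "x \<notin> C <#> L i1" using set_mult_Inter[OF C xc] x(2) by blast
    obtain i where i: "i \<in> I" "i0 \<le> i" "i1 \<le> i" using functional_chain_max[OF i0(1) i1(1)] by blast
    have "C <#> L i \<subseteq> C <#> L i1" using anti[OF i1(1) i(1,3)] by (auto simp: set_mult_def)
    then have xi: "x \<notin> C <#> L i" using i1(2) by blast
    \<comment> \<open>A point of U L i0 outside C N is already outside some C L i. The set V around
      it is open and saturated under L i, so it supports a bump v of positive mass.\<close>
    define V where "V = (U <#> L i0) - (C <#> L i)"
    have V: "openin T V"
      unfolding V_def using openin_set_mult[OF U(1), of "L i0"] admissible_subset[OF adm[OF i0(1)]]
        closedin_compact_set_mult[OF adm[OF i(1)] C] by blast
    have satV: "y \<otimes> n \<in> V" if y: "y \<in> V" and n: "n \<in> L i" for y n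
    proof -
      have yc: "y \<in> carrier G" using y UL by (auto simp: V_def)
      have "n \<in> L i0" using anti[OF i0(1) i(1,2)] n by auto
      then have "y \<otimes> n \<in> U <#> L i0"
        using set_mult_closed_right[OF adm[OF i0(1)] _ _] y carrier_openin[OF U(1)] by (auto simp: V_def)
      moreover have "y \<otimes> n \<notin> C <#> L i"
        using set_mult_right_imp[OF adm[OF i(1)] Cc _ n yc] y by (auto simp: V_def)
      ultimately show ?thesis by (simp add: V_def)
    qed
    have x1: "compactin T {x}" "{x} \<subseteq> V" using xc topspace_T x xi by (auto simp: V_def)
    obtain v D where v: "v \<in> cc (L i)" "\<And>y. y \<in> carrier G \<Longrightarrow> v y \<le> 1" "\<And>y. y \<in> {x} \<Longrightarrow> v y = 1"
      "D \<subseteq> V" "\<And>y. y \<in> carrier G \<Longrightarrow> v y \<noteq> 0 \<Longrightarrow> y \<in> D <#> L i"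
      using urysohn_cc[OF adm[OF i(1)] x1(1) V x1(2) satV] by metis
    have vV: "y \<in> V" if "y \<in> carrier G" "v y \<noteq> 0" for y
      using v(5)[OF that] v(4) satV by (auto simp: set_mult_def)
    have vpos: "m i v > 0" using functional_pos[OF adm[OF i(1)] func[OF i(1)] v(1) xc] v(3) by simp
    \<comment> \<open>A near minimiser f for c i0 dominates v, because V is contained in C L i0.
      Then f - v is still at least 1 on C L i, where v vanishes, and its mass is below c i0 = c i,
      which is impossible.\<close>
    have "\<exists>r\<in>S i0. r < c i0 + m i v"
      using cInf_lessD[OF S_ne[OF i0(1)], of "c i0 + m i v"] vpos by (simp add: c_def)
    then obtain j f where f: "j \<in> I" "f \<in> cc (L j)" "\<forall>x\<in>C <#> L i0. 1 \<le> f x" "m j f < c i0 + m i v"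
      unfolding S_def by blast
    obtain k where k: "k \<in> I" "i \<le> k" "j \<le> k" using functional_chain_max[OF i(1) f(1)] by blast
    have fk: "f \<in> cc (L k)" and vk: "v \<in> cc (L k)"
      using cc_chain[OF f(1) k(1,3) f(2)] cc_chain[OF i(1) k(1,2) v(1)] by auto
    define g where "g = (\<lambda>y. f y - v y)"
    have vf: "v y \<le> f y" if y: "y \<in> carrier G" for y
    proof (cases "v y = 0")
      case True
      then show ?thesis using cc_nonneg[OF fk y] by simp
    next
      case False
      then have "y \<in> C <#> L i0" using vV[OF y] U(2) by (auto simp: V_def set_mult_def)
      then show ?thesis using f(3) v(2)[OF y] by fastforce
    qed
    have g: "g \<in> cc (L k)"
    proof (rule cc_dominated[OF fk])
      show "continuous_map T euclideanreal g" unfolding g_def by (intro continuous_map_diff cc_cont[OF fk] cc_cont[OF vk])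
      show "0 \<le> g y" if "y \<in> carrier G" for y using vf[OF that] by (simp add: g_def)
      show "g (y \<otimes> n) = g y" if "y \<in> carrier G" "n \<in> L k" for y n
        using cc_inv[OF fk that] cc_inv[OF vk that] by (simp add: g_def)
      show "g y = 0" if "y \<in> carrier G" "f y = 0" for y
        using vf[OF that(1)] cc_nonneg[OF vk that(1)] that(2) by (simp add: g_def)
    qed
    have "1 \<le> g y" if y: "y \<in> C <#> L i" for y
    proof -
      have yc: "y \<in> carrier G" using y set_mult_subset_carrier[OF adm[OF i(1)] Cc] by auto
      have "y \<in> C <#> L i0" using y anti[OF i0(1) i(1,2)] by (auto simp: set_mult_def)
      moreover have "v y = 0" using vV[OF yc] y by (auto simp: V_def)
      ultimately show ?thesis using f(3) by (simp add: g_def)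
    qed
    then have "m k g \<in> S i" unfolding S_def using k(1) g by blast
    then have "c i \<le> m k g" unfolding c_def using bdd by (intro cInf_lower)
    moreover have "m k f = m k g + m k v"
      using functional_add[OF func[OF k(1)] g vk] by (simp add: g_def)
    moreover have "m k f = m j f" "m k v = m i v" 
      using coherent[OF f(1) k(1,3) f(2)] coherent[OF i(1) k(1,2) v(1)] by simp_all
    ultimately show False using const[OF i(1,2)] f(4) by linarith
  qed
  then show ?thesis using i0(1) by blast
qed

text \<open>One nonempty open W with W L j \<subseteq> C N suffices: a compact E is covered by
  finitely many right translates of W, and translating the inclusion puts E L j into the product of
  the corresponding translates of C with N.\<close>

lemma proper_limit:
  assumes i: "i \<in> I"
  shows "proper_over (L i) N"
proof -
  obtain U C where UC: "openin T U" "compactin T C" "\<one> \<in> U" "U \<subseteq> C"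
    using lc unfolding locally_compact_space_def topspace_T by (meson one_closed)
  have "\<exists>i\<in>I. \<exists>W. openin T W \<and> W \<noteq> {} \<and> W <#> L i \<subseteq> C <#> N"
  proof (cases "\<exists>s::nat \<Rightarrow> 'i. (\<forall>n. s n \<in> I) \<and> (\<forall>i\<in>I. \<exists>n. i \<le> s n)")
    case True
    then obtain s :: "nat \<Rightarrow> 'i" where "\<And>n. s n \<in> I" "\<And>i. i \<in> I \<Longrightarrow> \<exists>n. i \<le> s n" by blast
    then show ?thesis using open_in_compact_countable[OF UC(1,3,4,2)] by blast
  next
    case False
    then have "\<exists>i\<in>I. \<forall>n. s n \<le> i" if "\<And>n. s n \<in> I" for s :: "nat \<Rightarrow> 'i"
      using that by (meson linear)
    then show ?thesis using open_in_compact_uncountable[OF UC(1,4,2)] UC(1,3) by blast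
  qed
  then obtain j W where W: "j \<in> I" "openin T W" "W \<noteq> {}" "W <#> L j \<subseteq> C <#> N" by blast
  \<comment> \<open>The indices are comparable: for i \<le> j this is properness along the chain,
    and otherwise L i is contained in L j.\<close>
  have ij: "proper_over (L i) (L j)"
    using proper[OF i W(1)] proper_over_subset[OF anti[OF W(1) i]] by (meson linear)
  have "proper_over (L j) N"
    unfolding proper_over_def
  proof (intro allI impI)
    fix E assume E: "compactin T E"
    have Ec: "E \<subseteq> carrier G" using carrier_compactin[OF E] by auto
    have Cc: "C \<subseteq> carrier G" using carrier_compactin[OF UC(2)] by auto
    obtain w where w: "w \<in> W" using W(3) by blast
    have Wc: "W \<subseteq> carrier G" using carrier_openin[OF W(2)] by auto
    then have wc: "w \<in> carrier G" using w by auto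
    define g where "g = (\<lambda>e. inv w \<otimes> e)"
    have g: "g e \<in> carrier G" "w \<otimes> g e = e" if "e \<in> E" for e
      using that Ec wc by (auto simp: g_def subset_iff simp flip: m_assoc)
    obtain F where F: "finite F" "F \<subseteq> E" "E \<subseteq> (\<Union>e\<in>F. W #> g e)"
    proof (rule compactin_finite_subcover_points[OF E, of "\<lambda>e. W #> g e"])
      fix e assume e: "e \<in> E"
      have "w \<otimes> g e \<in> W #> g e" using w by (auto simp: r_coset_def)
      then show "openin T (W #> g e) \<and> e \<in> W #> g e" using g[OF e] openin_r_coset[OF W(2)] by simp
    qed auto
    have "E <#> L j \<subseteq> (\<Union>e\<in>F. C #> g e) <#> N"
    proof
      fix y assume "y \<in> E <#> L j"
      then obtain e0 l where el: "e0 \<in> E" "l \<in> L j" "y = e0 \<otimes> l" by (auto simp: set_mult_def)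
      then obtain e where e: "e \<in> F" "e0 \<in> W #> g e" using F(3) by blast
      have ge: "g e \<in> carrier G" using g(1) e(1) F(2) by blast
      have yc: "y \<in> carrier G" using el Ec admissible_subset[OF adm[OF W(1)]] by auto
      have yW: "y \<in> (W #> g e) <#> L j" using e el by (auto simp: set_mult_def)
      have "y \<otimes> inv (g e) \<in> W <#> L j"
        using set_mult_translate[OF adm[OF W(1)] Wc _ yc, of "inv (g e)"] yW ge by simp
      then have "y \<otimes> inv (g e) \<in> C <#> N" using W(4) by blast
      then have "y \<in> (C #> g e) <#> N"
        using set_mult_translate[OF admN Cc _ yc, of "inv (g e)"] ge by simp
      then show "y \<in> (\<Union>e\<in>F. C #> g e) <#> N" using e(1) by (auto simp: set_mult_def)
    qed
    moreover have "compactin T (\<Union>e\<in>F. C #> g e)"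
      using F g(1) compactin_r_coset[OF UC(2)] by (intro compactin_Union) auto
    ultimately show "\<exists>D. compactin T D \<and> E <#> L j \<subseteq> D <#> N" by blast
  qed
  then show ?thesis using proper_over_trans[OF ij] by blast
qed

section \<open>The functional on the union of the cones\<close>

definition cc_union :: "('a \<Rightarrow> real) set" where
  "cc_union = (\<Union>i\<in>I. cc (L i))"

text \<open>The choice of a level is harmless, since \<open>coherent\<close> gives the same value at
  every level whose cone contains f.\<close>

definition m_union :: "('a \<Rightarrow> real) \<Rightarrow> real" where
  "m_union f = m (SOME i. i \<in> I \<and> f \<in> cc (L i)) f"

lemma m_union_eq:
  assumes "i \<in> I" "f \<in> cc (L i)"
  shows "m_union f = m i f"
proof -
  define j where "j = (SOME i. i \<in> I \<and> f \<in> cc (L i))"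
  have j: "j \<in> I" "f \<in> cc (L j)" unfolding j_def using someI[of "\<lambda>i. i \<in> I \<and> f \<in> cc (L i)"] assms by blast+
  have "m j f = m i f" using coherent[OF j(1) assms(1) _ j(2)] coherent[OF assms(1) j(1) _ assms(2)] by (metis linear)
  then show ?thesis by (simp add: m_union_def j_def)
qed

lemma cc_union_common:
  assumes "f \<in> cc_union" "g \<in> cc_union"
  obtains i where "i \<in> I" "f \<in> cc (L i)" "g \<in> cc (L i)"
proof -
  obtain i j where ij: "i \<in> I" "f \<in> cc (L i)" "j \<in> I" "g \<in> cc (L j)" using assms unfolding cc_union_def by blast
  obtain k where "k \<in> I" "i \<le> k" "j \<le> k" using functional_chain_max[OF ij(1,3)] by blast
  then show thesis using that cc_chain ij by blast
qed

lemma cc_union_sub: "f \<in> cc_union \<Longrightarrow> f \<in> cc N"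
  unfolding cc_union_def using cc_mono[OF proper_limit N_sub] by blast

lemma m_union_add: "f \<in> cc_union \<Longrightarrow> g \<in> cc_union \<Longrightarrow> m_union (\<lambda>x. f x + g x) = m_union f + m_union g"
proof -
  assume fg: "f \<in> cc_union" "g \<in> cc_union"
  obtain i where i: "i \<in> I" "f \<in> cc (L i)" "g \<in> cc (L i)" using cc_union_common[OF fg] .
  show ?thesis
    using functional_add[OF func[OF i(1)] i(2,3)] m_union_eq[OF i(1,2)] m_union_eq[OF i(1,3)]
      m_union_eq[OF i(1) cc_add[OF i(2,3)]] by simp
qed

lemma cc_union_add: "f \<in> cc_union \<Longrightarrow> g \<in> cc_union \<Longrightarrow> (\<lambda>x. f x + g x) \<in> cc_union"
proof -
  assume fg: "f \<in> cc_union" "g \<in> cc_union"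
  obtain i where i: "i \<in> I" "f \<in> cc (L i)" "g \<in> cc (L i)" using cc_union_common[OF fg] .
  show ?thesis using cc_add[OF i(2,3)] i(1) unfolding cc_union_def by blast
qed

lemma m_union_mono:
  assumes "f \<in> cc_union" "g \<in> cc_union" "\<And>x. x \<in> carrier G \<Longrightarrow> f x \<le> g x"
  shows "m_union f \<le> m_union g"
proof -
  obtain i where i: "i \<in> I" "f \<in> cc (L i)" "g \<in> cc (L i)" using cc_union_common[OF assms(1,2)] .
  show ?thesis using functional_mono[OF func[OF i(1)] i(2,3) assms(3)] m_union_eq[OF i(1,2)] m_union_eq[OF i(1,3)] by simp
qed

lemma cc_union_translate:
  assumes "f \<in> cc_union" "g \<in> carrier G"
  shows "(\<lambda>x. f (x \<otimes> g)) \<in> cc_union" "m_union (\<lambda>x. f (x \<otimes> g)) = m_union f"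
proof -
  obtain i where i: "i \<in> I" "f \<in> cc (L i)" using assms(1) unfolding cc_union_def by blast
  have t: "(\<lambda>x. f (x \<otimes> g)) \<in> cc (L i)" using cc_translate[OF adm[OF i(1)] i(2) assms(2)] .
  then show "(\<lambda>x. f (x \<otimes> g)) \<in> cc_union" using i unfolding cc_union_def by blast
  show "m_union (\<lambda>x. f (x \<otimes> g)) = m_union f"
    using m_union_eq[OF i] m_union_eq[OF i(1) t] functional_translate[OF func[OF i(1)] i(2) assms(2)] by simp
qed

lemma m_union_nonneg: "f \<in> cc_union \<Longrightarrow> 0 \<le> m_union f"
  unfolding cc_union_def using m_union_eq functional_nonneg[OF func] by (metis UN_E)

lemma cc_union_inverse_scale:
  assumes "f \<in> cc_union" "n > 0"
  shows "(\<lambda>x. f x / real n) \<in> cc_union" "m_union (\<lambda>x. f x / real n) = m_union f / real n"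
proof -
  obtain i where i: "i \<in> I" "f \<in> cc (L i)" using assms(1) unfolding cc_union_def by blast
  have t: "(\<lambda>x. f x / real n) \<in> cc (L i)" using cc_scale[OF i(2), of "1 / real n"] by simp
  then show "(\<lambda>x. f x / real n) \<in> cc_union" using i unfolding cc_union_def by blast
  show "m_union (\<lambda>x. f x / real n) = m_union f / real n"
    using m_union_eq[OF i] m_union_eq[OF i(1) t] functional_inverse_scale[OF func[OF i(1)] i(2) assms(2)] by simp
qed

section \<open>Approximation from above by functions of lower levels\<close>

lemma approx_at_point:
  assumes f: "f \<in> cc N" and C: "compactin T C" "\<And>x. x \<in> carrier G \<Longrightarrow> f x \<noteq> 0 \<Longrightarrow> x \<in> C <#> N"
    and i0: "i0 \<in> I" and \<kappa>: "\<kappa> \<in> cc (L i0)" "\<And>x. x \<in> carrier G \<Longrightarrow> \<kappa> x \<le> 1" "\<And>x. x \<in> C <#> N \<Longrightarrow> \<kappa> x = 1"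
    and x: "x \<in> carrier G" and e: "\<epsilon> > 0"
  shows "\<exists>h\<in>cc_union. (\<forall>y\<in>carrier G. f y \<le> h y) \<and> (\<forall>y\<in>carrier G. \<kappa> y = 0 \<longrightarrow> h y = 0) \<and> h x \<le> f x + \<epsilon>"
proof -
  have Cc: "C \<subseteq> carrier G" using carrier_compactin[OF C(1)] by auto
  obtain B where B: "B > 0" "\<And>x. x \<in> carrier G \<Longrightarrow> f x \<le> B" using cc_bounded[OF admN f] by blast
  \<comment> \<open>F N contains all points where f is at least f x + \<epsilon>, and it misses x.
    Hence x is outside F L j for some level j, where a Urysohn function w can separate x from F L
    j.\<close>
  define F where "F = C \<inter> {y \<in> topspace T. f y \<in> {f x + \<epsilon>..}}"
  have F: "compactin T F"
    unfolding F_def using closedin_continuous_map_preimage[OF cc_cont[OF f], of "{f x + \<epsilon>..}"] C(1)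
    by (intro compact_Int_closedin) auto
  have Fc: "F \<subseteq> carrier G" using carrier_compactin[OF F] by auto
  have FN: "y \<in> F <#> N" if y: "y \<in> carrier G" "f y \<ge> f x + \<epsilon>" for y
  proof -
    have "f y \<noteq> 0" using y(2) e cc_nonneg[OF f x] by linarith
    then obtain c n where cn: "c \<in> C" "n \<in> N" "y = c \<otimes> n" using C(2)[OF y(1)] by (auto simp: set_mult_def)
    then have "f c = f y" using cc_inv[OF f, of c n] Cc by auto
    then have "c \<in> F" using cn y Cc by (auto simp: F_def topspace_T)
    then show ?thesis using cn by (auto simp: set_mult_def)
  qed
  have "x \<notin> F <#> N"
  proof
    assume "x \<in> F <#> N"
    then obtain c n where "c \<in> F" "n \<in> N" "x = c \<otimes> n" by (auto simp: set_mult_def)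
    then have "f x \<ge> f x + \<epsilon>" using cc_inv[OF f, of c n] Fc by (auto simp: F_def)
    then show False using e by simp
  qed
  then obtain i where i: "i \<in> I" "x \<notin> F <#> L i" using set_mult_Inter[OF F x] by blast
  obtain j where j: "j \<in> I" "i \<le> j" "i0 \<le> j" using functional_chain_max[OF i(1) i0] by blast
  note aj = adm[OF j(1)]
  define V where "V = carrier G - (F <#> L j)"
  have V: "openin T V"
    unfolding V_def using closedin_compact_set_mult[OF aj F] topspace_T by (metis openin_diff openin_topspace)
  have "F <#> L j \<subseteq> F <#> L i" using anti[OF i(1) j(1,2)] by (auto simp: set_mult_def)
  then have xV: "compactin T {x}" "{x} \<subseteq> V" using i(2) x topspace_T by (auto simp: V_def)
  have satV: "y \<otimes> n \<in> V" if y: "y \<in> V" and n: "n \<in> L j" for y n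
  proof -
    have yc: "y \<in> carrier G" using y by (simp add: V_def)
    then show ?thesis
      using set_mult_right_imp[OF aj Fc _ n yc] y admissible_subset[OF aj n] by (auto simp: V_def)
  qed
  obtain w D where w: "w \<in> cc (L j)" "\<And>y. y \<in> carrier G \<Longrightarrow> w y \<le> 1" "\<And>y. y \<in> {x} \<Longrightarrow> w y = 1"
    "D \<subseteq> V" "\<And>y. y \<in> carrier G \<Longrightarrow> w y \<noteq> 0 \<Longrightarrow> y \<in> D <#> L j"
    using urysohn_cc[OF aj xV(1) V xV(2) satV] by metis
  have wF: "w y = 0" if y: "y \<in> carrier G" "f y \<ge> f x + \<epsilon>" for y
  proof (rule ccontr)
    assume "w y \<noteq> 0"
    then have "y \<in> V" using w(5)[OF y(1)] w(4) satV by (auto simp: set_mult_def)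
    moreover have "y \<in> F <#> L j" using FN[OF y] N_sub[OF j(1)] by (auto simp: set_mult_def)
    ultimately show False by (simp add: V_def)
  qed
  note \<kappa>j = cc_chain[OF i0 j(1,3) \<kappa>(1)]
  \<comment> \<open>On the plateau \<kappa> = 1 this is f x + \<epsilon> + B (1 - w). Where f \<ge>
    f x + \<epsilon> there is w = 0 and h is at least B; at x there is w = 1, so the second term
    vanishes.\<close>
  define h where "h = (\<lambda>y. (f x + \<epsilon>) * \<kappa> y + B * \<kappa> y * (1 - w y))"
  have fx: "f x + \<epsilon> \<ge> 0" using cc_nonneg[OF f x] e by simp
  have hj: "h \<in> cc (L j)"
  proof (rule cc_dominated[OF \<kappa>j])
    show "continuous_map T euclideanreal h"
      unfolding h_def using cc_cont[OF \<kappa>j] cc_cont[OF w(1)]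
      by (intro continuous_map_add continuous_map_real_mult continuous_map_diff) auto
    show "0 \<le> h y" if "y \<in> carrier G" for y
      unfolding h_def using fx B(1) cc_nonneg[OF \<kappa>j that] w(2)[OF that] by simp
    show "h (y \<otimes> n) = h y" if "y \<in> carrier G" "n \<in> L j" for y n
      using cc_inv[OF \<kappa>j that] cc_inv[OF w(1) that] by (simp add: h_def)
  qed (simp add: h_def)
  have "f y \<le> h y" if y: "y \<in> carrier G" for y
  proof (cases "f y = 0")
    case True
    then show ?thesis using cc_nonneg[OF hj y] by simp
  next
    case False
    then have c1: "\<kappa> y = 1" using C(2)[OF y] \<kappa>(3) by blast
    show ?thesis
    proof (cases "f y \<ge> f x + \<epsilon>")
      case True
      then show ?thesis using wF[OF y True] c1 B(2)[OF y] fx by (simp add: h_def)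
    next
      case False
      then show ?thesis using c1 B(1) w(2)[OF y] by (simp add: h_def add_increasing2)
    qed
  qed
  moreover have "h x \<le> f x + \<epsilon>" using w(3)[of x] \<kappa>(2)[OF x] fx by (simp add: h_def mult_left_le)
  ultimately show ?thesis using hj j(1) unfolding cc_union_def by (intro bexI[of _ h]) (auto simp: h_def)
qed

text \<open>Kakutani's argument for the lattice form of the Stone--Weierstrass theorem.\<close>

lemma approx_from_above:
  assumes f: "f \<in> cc N"
  shows "\<exists>\<kappa>\<in>cc_union. \<forall>\<epsilon>>0. \<exists>h\<in>cc_union. \<forall>y\<in>carrier G. f y \<le> h y \<and> h y \<le> f y + \<epsilon> * \<kappa> y"
proof -
  obtain C where C: "compactin T C" "\<And>x. x \<in> carrier G \<Longrightarrow> f x \<noteq> 0 \<Longrightarrow> x \<in> C <#> N"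
    using cc_supp[OF f] by blast
  have Cc: "C \<subseteq> carrier G" using carrier_compactin[OF C(1)] by auto
  obtain i0 where i0: "i0 \<in> I" using I_ne by blast
  note a0 = adm[OF i0]
  have opc: "openin T (carrier G)" using openin_topspace[of T] topspace_T by simp
  have satG: "x \<otimes> n \<in> carrier G" if "x \<in> carrier G" "n \<in> L i0" for x n using that admissible_subset[OF a0] by simp
  have ext1: "\<psi> x = 1" if "\<psi> \<in> cc (L i0)" "\<And>x. x \<in> E \<Longrightarrow> \<psi> x = 1" "E \<subseteq> carrier G" "x \<in> E <#> L i0" for \<psi> E x
    using that cc_inv[OF that(1)] by (auto simp: set_mult_def subset_iff)
  \<comment> \<open>The function \<kappa> equals 1 on C and makes all approximants vanish off E L
    i0, while \<psi> equals 1 on E L i0 and carries the error. Properness puts E L i0 into D N, so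
    by N-invariance the comparison is needed only on the compact set D.\<close>
  obtain \<kappa> where \<kappa>: "\<kappa> \<in> cc (L i0)" "\<And>x. x \<in> carrier G \<Longrightarrow> \<kappa> x \<le> 1" "\<And>x. x \<in> C \<Longrightarrow> \<kappa> x = 1"
    using urysohn_cc[OF a0 C(1) opc Cc satG] by metis
  have \<kappa>1: "\<kappa> x = 1" if "x \<in> C <#> N" for x
    using ext1[OF \<kappa>(1,3) Cc, of x] that N_sub[OF i0] by (auto simp: set_mult_def)
  obtain E where E: "compactin T E" "\<And>x. x \<in> carrier G \<Longrightarrow> \<kappa> x \<noteq> 0 \<Longrightarrow> x \<in> E <#> L i0"
    using cc_supp[OF \<kappa>(1)] by blast
  have Ec: "E \<subseteq> carrier G" using carrier_compactin[OF E(1)] by auto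
  obtain \<psi> where \<psi>: "\<psi> \<in> cc (L i0)" "\<And>x. x \<in> E \<Longrightarrow> \<psi> x = 1"
    using urysohn_cc[OF a0 E(1) opc Ec satG] by metis
  obtain D where D: "compactin T D" "E <#> L i0 \<subseteq> D <#> N"
    using proper_overD[OF proper_limit[OF i0] E(1)] .
  have Dc: "D \<subseteq> carrier G" using carrier_compactin[OF D(1)] by auto
  have "\<exists>h\<in>cc_union. \<forall>y\<in>carrier G. f y \<le> h y \<and> h y \<le> f y + \<epsilon> * \<psi> y" if e: "\<epsilon> > 0" for \<epsilon>
  proof -
    have e2: "\<epsilon> / 2 > 0" using e by simp
    define P where "P = (\<lambda>h. h \<in> cc_union \<and> (\<forall>y\<in>carrier G. f y \<le> h y) \<and> (\<forall>y\<in>carrier G. \<kappa> y = 0 \<longrightarrow> h y = 0))"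
    have "\<exists>h. P h \<and> h x \<le> f x + \<epsilon> / 2" if "x \<in> carrier G" for x
      unfolding P_def using approx_at_point[OF f C i0 \<kappa>(1,2) \<kappa>1 that e2] by blast
    then obtain h where h: "\<And>x. x \<in> carrier G \<Longrightarrow> P (h x)" "\<And>x. x \<in> carrier G \<Longrightarrow> h x x \<le> f x + \<epsilon> / 2" by metis
    have hc: "h x \<in> cc N" if "x \<in> carrier G" for x using h(1)[OF that] cc_union_sub unfolding P_def by blast
    obtain X where X: "finite X" "X \<subseteq> D" "D \<subseteq> (\<Union>x\<in>X. {y \<in> carrier G. h x y - f y < \<epsilon>})"
    proof (rule compactin_finite_subcover_points[OF D(1), of "\<lambda>x. {y \<in> carrier G. h x y - f y < \<epsilon>}"])
      fix x assume "x \<in> D"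
      then have x: "x \<in> carrier G" using Dc by auto
      have "continuous_map T euclideanreal (\<lambda>y. h x y - f y)"
        by (intro continuous_map_diff cc_cont[OF hc[OF x]] cc_cont[OF f])
      from openin_continuous_map_preimage[OF this, of "{..<\<epsilon>}"]
      show "openin T {y \<in> carrier G. h x y - f y < \<epsilon>} \<and> x \<in> {y \<in> carrier G. h x y - f y < \<epsilon>}"
        using h(2)[OF x] e x by (simp add: topspace_T)
    qed auto
    have "\<exists>g. P g \<and> (\<forall>x\<in>X. \<forall>y\<in>carrier G. g y \<le> h x y)"
      using X(1,2)
    proof (induction X)
      case empty
      then show ?case using h(1)[OF one_closed] by blast
    next
      case (insert x X)
      then obtain g where g: "P g" "\<forall>x\<in>X. \<forall>y\<in>carrier G. g y \<le> h x y" by blast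
      have xP: "P (h x)" using insert.prems Dc h(1) by auto
      obtain i where i: "i \<in> I" "g \<in> cc (L i)" "h x \<in> cc (L i)"
        using cc_union_common g(1) xP unfolding P_def by blast
      have "(\<lambda>y. min (g y) (h x y)) \<in> cc_union" using cc_min[OF i(2,3)] i(1) unfolding cc_union_def by blast
      then have "P (\<lambda>y. min (g y) (h x y))" using g(1) xP unfolding P_def by simp
      moreover have "\<forall>z\<in>insert x X. \<forall>y\<in>carrier G. min (g y) (h x y) \<le> h z y" using g(2) by (auto simp: min_le_iff_disj)
      ultimately show ?case by blast
    qed
    then obtain g where g: "P g" "\<And>x y. x \<in> X \<Longrightarrow> y \<in> carrier G \<Longrightarrow> g y \<le> h x y" by blast
    have gN: "g \<in> cc N" using g(1) cc_union_sub unfolding P_def by blast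
    have "g y \<le> f y + \<epsilon> * \<psi> y" if y: "y \<in> carrier G" for y
    proof (cases "\<kappa> y = 0")
      case True
      then have "g y = 0" using g(1) y unfolding P_def by blast
      then show ?thesis using cc_nonneg[OF f y] cc_nonneg[OF \<psi>(1) y] e by simp
    next
      case False
      then have yE: "y \<in> E <#> L i0" using E(2)[OF y] by blast
      have p1: "\<psi> y = 1" using ext1[OF \<psi> Ec yE] .
      obtain d n where d: "d \<in> D" "n \<in> N" "y = d \<otimes> n" using subsetD[OF D(2) yE] by (auto simp: set_mult_def)
      obtain x where x: "x \<in> X" "h x d - f d < \<epsilon>" using X(3) d(1) by blast
      have dc: "d \<in> carrier G" using d(1) Dc by auto
      have "g d \<le> f d + \<epsilon>" using g(2)[OF x(1) dc] x(2) by linarith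
      then show ?thesis using cc_inv[OF gN dc d(2)] cc_inv[OF f dc d(2)] d(3) p1 by simp
    qed
    then show ?thesis using g(1) unfolding P_def by blast
  qed
  then show ?thesis using \<psi>(1) i0 unfolding cc_union_def by blast
qed

section \<open>The functional at the limit, as an infimum over majorants\<close>

definition m_limit :: "('a \<Rightarrow> real) \<Rightarrow> real" where
  "m_limit f = Inf {m_union h |h. h \<in> cc_union \<and> (\<forall>x\<in>carrier G. f x \<le> h x)}"

lemma m_limit_le:
  assumes "h \<in> cc_union" "\<And>x. x \<in> carrier G \<Longrightarrow> f x \<le> h x"
  shows "m_limit f \<le> m_union h"
  unfolding m_limit_def using assms m_union_nonneg by (intro cInf_lower bdd_belowI[of _ 0]) auto

lemma m_limit_greatest:
  assumes f: "f \<in> cc N" and "\<And>h. h \<in> cc_union \<Longrightarrow> (\<And>x. x \<in> carrier G \<Longrightarrow> f x \<le> h x) \<Longrightarrow> b \<le> m_union h"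
  shows "b \<le> m_limit f"
proof -
  obtain h where "h \<in> cc_union" "\<forall>y\<in>carrier G. f y \<le> h y"
    using approx_from_above[OF f] zero_less_one by blast
  then show ?thesis unfolding m_limit_def using assms(2) by (intro cInf_greatest) auto
qed

lemma m_limit_extends:
  assumes "i \<in> I" "f \<in> cc (L i)"
  shows "m_limit f = m i f"
proof -
  have fu: "f \<in> cc_union" using assms unfolding cc_union_def by blast
  have "m_union f \<le> m_limit f" using m_union_mono[OF fu] by (intro m_limit_greatest[OF cc_union_sub[OF fu]]) auto
  moreover have "m_limit f \<le> m_union f" using m_limit_le[OF fu] by auto
  ultimately show ?thesis using m_union_eq[OF assms] by simp
qed

lemma m_limit_translate_le:
  assumes f: "f \<in> cc N" and g: "g \<in> carrier G"
  shows "m_limit (\<lambda>x. f (x \<otimes> g)) \<le> m_limit f"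
proof (rule m_limit_greatest[OF f])
  fix h assume h: "h \<in> cc_union" "\<And>x. x \<in> carrier G \<Longrightarrow> f x \<le> h x"
  have "m_limit (\<lambda>x. f (x \<otimes> g)) \<le> m_union (\<lambda>x. h (x \<otimes> g))"
    using cc_union_translate(1)[OF h(1) g] h(2) g by (intro m_limit_le) auto
  then show "m_limit (\<lambda>x. f (x \<otimes> g)) \<le> m_union h" using cc_union_translate(2)[OF h(1) g] by simp
qed

lemma m_limit_mono:
  assumes "f \<in> cc N" "g \<in> cc N" "\<And>x. x \<in> carrier G \<Longrightarrow> f x \<le> g x"
  shows "m_limit f \<le> m_limit g"
  using assms(3) by (intro m_limit_greatest[OF assms(2)] m_limit_le) (auto intro: order_trans)

lemma m_limit_translate:
  assumes f: "f \<in> cc N" and g: "g \<in> carrier G"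
  shows "m_limit (\<lambda>x. f (x \<otimes> g)) = m_limit f"
proof (rule antisym[OF m_limit_translate_le[OF assms]])
  note fg = cc_translate[OF admN f g]
  have fgg: "(\<lambda>x. f (x \<otimes> inv g \<otimes> g)) \<in> cc N" using cc_translate[OF admN fg, of "inv g"] g by simp
  have "m_limit f \<le> m_limit (\<lambda>x. f (x \<otimes> inv g \<otimes> g))"
    using g by (intro m_limit_mono[OF f fgg]) (simp add: m_assoc)
  also have "\<dots> \<le> m_limit (\<lambda>x. f (x \<otimes> g))" using m_limit_translate_le[OF fg, of "inv g"] g by simp
  finally show "m_limit f \<le> m_limit (\<lambda>x. f (x \<otimes> g))" .
qed

text \<open>Subadditivity is formal. Conversely, majorants p of f and q of g can be chosen with
  total excess at most (\<kappa> + \<psi>)/n, so that p + q \<le> h + (\<kappa> + \<psi>)/n for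
  every majorant h of f + g. The mass of the error tends to 0 because \<kappa> + \<psi> does not
  depend on n.\<close>

lemma m_limit_add:
  assumes f: "f \<in> cc N" and g: "g \<in> cc N"
  shows "m_limit (\<lambda>x. f x + g x) = m_limit f + m_limit g"
proof (rule antisym)
  note fg = cc_add[OF f g]
  have 1: "m_limit (\<lambda>x. f x + g x) - m_union h \<le> m_limit g"
    if h: "h \<in> cc_union" "\<And>x. x \<in> carrier G \<Longrightarrow> f x \<le> h x" for h
  proof (rule m_limit_greatest[OF g])
    fix k assume k: "k \<in> cc_union" "\<And>x. x \<in> carrier G \<Longrightarrow> g x \<le> k x"
    have "m_limit (\<lambda>x. f x + g x) \<le> m_union (\<lambda>x. h x + k x)"
      using h(2) k(2) by (intro m_limit_le cc_union_add[OF h(1) k(1)] add_mono)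
    then show "m_limit (\<lambda>x. f x + g x) - m_union h \<le> m_union k" using m_union_add[OF h(1) k(1)] by simp
  qed
  have "m_limit (\<lambda>x. f x + g x) - m_limit g \<le> m_limit f"
    using 1 by (intro m_limit_greatest[OF f]) (simp add: algebra_simps)
  then show "m_limit (\<lambda>x. f x + g x) \<le> m_limit f + m_limit g" by simp
  obtain \<kappa> where \<kappa>: "\<kappa> \<in> cc_union" "\<And>\<epsilon>. \<epsilon> > 0 \<Longrightarrow> \<exists>h\<in>cc_union. \<forall>y\<in>carrier G. f y \<le> h y \<and> h y \<le> f y + \<epsilon> * \<kappa> y"
    using approx_from_above[OF f] by blast
  obtain \<psi> where \<psi>: "\<psi> \<in> cc_union" "\<And>\<epsilon>. \<epsilon> > 0 \<Longrightarrow> \<exists>h\<in>cc_union. \<forall>y\<in>carrier G. g y \<le> h y \<and> h y \<le> g y + \<epsilon> * \<psi> y"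
    using approx_from_above[OF g] by blast
  show "m_limit f + m_limit g \<le> m_limit (\<lambda>x. f x + g x)"
  proof (rule m_limit_greatest[OF fg])
    fix h assume h: "h \<in> cc_union" "\<And>x. x \<in> carrier G \<Longrightarrow> f x + g x \<le> h x"
    define r where "r = (\<lambda>x. \<kappa> x + \<psi> x)"
    have r: "r \<in> cc_union" unfolding r_def using cc_union_add[OF \<kappa>(1) \<psi>(1)] .
    have le: "m_limit f + m_limit g \<le> m_union h + m_union r / real n" if n: "n > 0" for n
    proof -
      have n1: "1 / real n > 0" using n by simp
      obtain p where p: "p \<in> cc_union" "\<And>y. y \<in> carrier G \<Longrightarrow> f y \<le> p y" "\<And>y. y \<in> carrier G \<Longrightarrow> p y \<le> f y + 1 / real n * \<kappa> y"
        using \<kappa>(2)[OF n1] by blast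
      obtain q where q: "q \<in> cc_union" "\<And>y. y \<in> carrier G \<Longrightarrow> g y \<le> q y" "\<And>y. y \<in> carrier G \<Longrightarrow> q y \<le> g y + 1 / real n * \<psi> y"
        using \<psi>(2)[OF n1] by blast
      note rn = cc_union_inverse_scale[OF r n]
      have "m_limit f + m_limit g \<le> m_union p + m_union q"
        using m_limit_le[OF p(1,2)] m_limit_le[OF q(1,2)] by simp
      also have "\<dots> = m_union (\<lambda>x. p x + q x)" using m_union_add[OF p(1) q(1)] by simp
      also have "\<dots> \<le> m_union (\<lambda>x. h x + r x / real n)"
      proof (rule m_union_mono[OF cc_union_add[OF p(1) q(1)] cc_union_add[OF h(1) rn(1)]])
        fix y assume y: "y \<in> carrier G"
        show "p y + q y \<le> h y + r y / real n"
          using p(3)[OF y] q(3)[OF y] h(2)[OF y] by (simp add: r_def add_divide_distrib)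
      qed
      also have "\<dots> = m_union h + m_union r / real n" using m_union_add[OF h(1) rn(1)] rn(2) by simp
      finally show ?thesis .
    qed
    show "m_limit f + m_limit g \<le> m_union h"
    proof (rule field_le_epsilon)
      fix e :: real assume e: "e > 0"
      obtain n where n: "m_union r < real n * e" using reals_Archimedean3[OF e] by blast
      have n0: "n > 0" using n m_union_nonneg[OF r] by (cases n) auto
      then have "m_union r / real n \<le> e" using n by (simp add: pos_divide_le_eq mult.commute)
      then show "m_limit f + m_limit g \<le> m_union h + e" using le[OF n0] by linarith
    qed
  qed
qed

lemma functional_limit: "invariant_functional N m_limit"
  unfolding invariant_functional_def
proof (intro conjI ballI impI)
  obtain i where i: "i \<in> I" using I_ne by blast
  obtain f where f: "f \<in> cc (L i)" "m i f \<noteq> 0" using func[OF i] unfolding invariant_functional_def by blast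
  then show "\<exists>f\<in>cc N. m_limit f \<noteq> 0"
    using m_limit_extends[OF i] cc_mono[OF proper_limit[OF i] N_sub[OF i]] by metis
qed (use m_limit_add m_limit_mono m_limit_translate in auto)

end

section \<open>Transfinite construction\<close>

lemma ord_succ_le: "i < j \<Longrightarrow> ord_succ i \<le> j"
  unfolding ord_succ_def by (rule Least_le)

lemma less_ord_succ: "j < ord_succ i \<Longrightarrow> j \<le> i"
  using ord_succ_le not_less by blast

lemma ord_zero_le: "ord_zero \<le> i"
  unfolding ord_zero_def by (rule Least_le) simp

section \<open>The given system and the recursion along it\<close>

locale normal_system = lch_right_top_group +
  fixes top_index :: "'i::wellorder" and L :: "'i \<Rightarrow> 'a set"
  assumes system: "compact_strong_normal_system G T top_index L"
begin

definition one_index :: 'i where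
  "one_index = ord_succ ord_zero"

lemma zero_less_top: "ord_zero < top_index"
  using system by (simp add: compact_strong_normal_system_def)

lemma one_le_top: "one_index \<le> top_index"
  unfolding one_index_def using ord_succ_le[OF zero_less_top] .

lemma admissible_L: "i \<le> top_index \<Longrightarrow> admissible (L i)"
  using system by (simp add: compact_strong_normal_system_def admissible_def)

lemma L_top: "L top_index = {\<one>}"
  using system by (simp add: compact_strong_normal_system_def)

lemma compact_L: "one_index \<le> i \<Longrightarrow> i \<le> top_index \<Longrightarrow> compactin T (L i)"
  using system by (simp add: compact_strong_normal_system_def one_index_def)

lemma L_limit: "i \<le> top_index \<Longrightarrow> ord_limit i \<Longrightarrow> L i = (\<Inter>j\<in>{..<i}. L j)"
  using system by (simp add: compact_strong_normal_system_def)

lemma L_succ: "i < top_index \<Longrightarrow> L (ord_succ i) \<subseteq> L i"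
  using system by (simp add: compact_strong_normal_system_def)

lemma joint_L:
  "i < top_index \<Longrightarrow> continuous_map
     (prod_topology (coset_space (L (ord_succ i))) (coset_topology G T (L i) (L (ord_succ i))))
     (coset_space (L (ord_succ i))) (\<lambda>(A, B). A <#> B)"
  using system by (simp add: compact_strong_normal_system_def Let_def coset_space_def)

lemma topological_group_quotient: "topological_group (G Mod L one_index) (coset_space (L one_index))"
  using system by (simp add: compact_strong_normal_system_def Let_def coset_space_def one_index_def)

text \<open>The system prescribes inclusions only at successors and intersections only at limits;
  transfinite induction on the larger index combines the two.\<close>

lemma L_antimono: "j \<le> i \<Longrightarrow> i \<le> top_index \<Longrightarrow> L i \<subseteq> L j"
proof (induction i rule: less_induct)
  case (less i)
  show ?case
  proof (cases "j = i")
    case False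
    then have ji: "j < i" using less.prems by simp
    show ?thesis
    proof (cases "ord_limit i")
      case True
      then show ?thesis using L_limit[OF less.prems(2)] ji by auto
    next
      case False
      moreover have "i \<noteq> ord_zero" using ji ord_zero_le[of j] by auto
      ultimately obtain k where k: "k < i" "ord_succ k = i" unfolding ord_limit_def by blast
      have "j \<le> k" using less_ord_succ ji k(2) by blast
      then have "L k \<subseteq> L j" using less.IH[OF k(1)] k(1) less.prems(2) by simp
      moreover have "L i \<subseteq> L k" using L_succ[OF order.strict_trans2[OF k(1) less.prems(2)]] k(2) by simp
      ultimately show ?thesis by blast
    qed
  qed simp
qed

text \<open>Multiplication of the topological group G/L_1 makes (x, y) \<mapsto> h (x y) continuous.
  Multiplication and inversion together send the images of C and D to a compact set of cosets, which
  lifts to E.\<close>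

lemma haar_functional_quotient: "\<exists>m. invariant_functional (L one_index) m"
proof -
  let ?N = "L one_index" and ?Q = "coset_space (L one_index)"
  have N: "admissible ?N" using admissible_L[OF one_le_top] .
  interpret N: normal ?N G using N by (simp add: admissible_def)
  interpret M: group "G Mod ?N" using N.factorgroup_is_group .
  note tg = topological_group_quotient[unfolded topological_group_def]
  have q: "continuous_map T ?Q (\<lambda>x. x <#\<^bsub>G\<^esub> ?N)" by (rule quotient_imp_continuous_map[OF quotient_map_coset])
  have mult: "continuous_map (prod_topology ?Q ?Q) ?Q (\<lambda>(A, B). A <#> B)" using tg by simp
  have inv: "continuous_map ?Q ?Q (\<lambda>A. inv\<^bsub>G Mod ?N\<^esub> A)" using tg by simp
  \<comment> \<open>The factor group consists of right cosets while the quotient topology is built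
    from left cosets; normality identifies them.\<close>
  have inv_eq: "inv\<^bsub>G Mod ?N\<^esub> (x <#\<^bsub>G\<^esub> ?N) = inv x <#\<^bsub>G\<^esub> ?N" if x: "x \<in> carrier G" for x
  proof -
    have "x <#\<^bsub>G\<^esub> ?N = ?N #> x" "inv x <#\<^bsub>G\<^esub> ?N = ?N #> inv x" using N.coset_eq x by auto
    moreover have "?N #> x \<in> carrier (G Mod ?N)" using x by (auto simp: FactGroup_def RCOSETS_def)
    ultimately show ?thesis using N.inv_FactGroup N.rcos_inv[OF x] by simp
  qed
  show ?thesis
  proof (rule haar_functional[OF N])
    fix h assume h: "h \<in> cc ?N"
    obtain F where F: "continuous_map ?Q euclideanreal F" "\<And>x. x \<in> carrier G \<Longrightarrow> F (x <#\<^bsub>G\<^esub> ?N) = h x"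
      using cc_factor[OF N cc_cont[OF h] cc_inv[OF h]] by blast
    have 1: "continuous_map (prod_topology T T) ?Q (\<lambda>p. fst p <#\<^bsub>G\<^esub> ?N)"
      "continuous_map (prod_topology T T) ?Q (\<lambda>p. snd p <#\<^bsub>G\<^esub> ?N)"
      using continuous_map_compose[OF continuous_map_fst q] continuous_map_compose[OF continuous_map_snd q]
      by (simp_all add: o_def)
    have "continuous_map (prod_topology T T) euclideanreal
        (F \<circ> ((\<lambda>(A, B). A <#> B) \<circ> (\<lambda>p. (fst p <#\<^bsub>G\<^esub> ?N, snd p <#\<^bsub>G\<^esub> ?N))))"
      by (intro continuous_map_compose[OF _ F(1)] continuous_map_compose[OF _ mult] continuous_map_pairedI 1)
    then show "continuous_map (prod_topology T T) euclideanreal (\<lambda>(x, y). h (x \<otimes> y))"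
    proof (rule continuous_map_eq)
      fix p assume "p \<in> topspace (prod_topology T T)"
      then have "fst p \<in> carrier G" "snd p \<in> carrier G" by (auto simp: topspace_T)
      then show "(F \<circ> ((\<lambda>(A, B). A <#> B) \<circ> (\<lambda>p. (fst p <#\<^bsub>G\<^esub> ?N, snd p <#\<^bsub>G\<^esub> ?N)))) p = (\<lambda>(x, y). h (x \<otimes> y)) p"
        by (simp add: l_coset_mult[OF N] F(2) case_prod_unfold)
    qed
  next
    fix C D assume C: "compactin T C" and D: "compactin T D"
    let ?q = "\<lambda>x. x <#\<^bsub>G\<^esub> ?N"
    have Cc: "c \<in> carrier G" if "c \<in> C" for c using carrier_compactin[OF C that] .
    have Dc: "d \<in> carrier G" if "d \<in> D" for d using carrier_compactin[OF D that] .
    define A where "A = (\<lambda>A. inv\<^bsub>G Mod ?N\<^esub> A) ` ?q ` C"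
    have "compactin ?Q A" "compactin ?Q (?q ` D)"
      unfolding A_def using image_compactin[OF image_compactin[OF C q] inv] image_compactin[OF D q] by auto
    then have "compactin (prod_topology ?Q ?Q) (A \<times> ?q ` D)" by (simp add: compactin_Times)
    then have "compactin ?Q ((\<lambda>(A, B). A <#> B) ` (A \<times> ?q ` D))" using image_compactin mult by blast
    then obtain E where E: "compactin T E" "(\<lambda>(A, B). A <#> B) ` (A \<times> ?q ` D) \<subseteq> ?q ` E"
      by (rule compactin_coset_space_lift[OF N])
    have Ec: "E \<subseteq> carrier G" using carrier_compactin[OF E(1)] by auto
    have "inv c \<otimes> d \<in> E <#> ?N" if cd: "c \<in> C" "d \<in> D" for c d
    proof -
      have "(inv\<^bsub>G Mod ?N\<^esub> (?q c), ?q d) \<in> A \<times> ?q ` D" using cd by (auto simp: A_def)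
      from imageI[OF this, of "\<lambda>(A, B). A <#> B"]
      have "?q (inv c \<otimes> d) \<in> (\<lambda>(A, B). A <#> B) ` (A \<times> ?q ` D)"
        using inv_eq[OF Cc[OF cd(1)]] l_coset_mult[OF N, of "inv c" d] Cc[OF cd(1)] Dc[OF cd(2)] by simp
      from subsetD[OF E(2) this] obtain e where e: "e \<in> E" "?q e = ?q (inv c \<otimes> d)" by auto
      have y: "inv c \<otimes> d \<in> carrier G" using Cc[OF cd(1)] Dc[OF cd(2)] by simp
      have "inv e \<otimes> (inv c \<otimes> d) \<in> ?N" using l_coset_eq_iff[OF N _ y, of e] e Ec by auto
      then show ?thesis using set_mult_mem_iff[OF N Ec y] e(1) by blast
    qed
    then show "\<exists>E. compactin T E \<and> (\<forall>c\<in>C. \<forall>d\<in>D. inv c \<otimes> d \<in> E <#> ?N)" using E(1) by blast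
  qed
qed

text \<open>The condition is void outside the range from \<open>one_index\<close> to
  \<open>top_index\<close>, since the first functional lives on G/L_1. Properness and agreement with
  all earlier functionals are carried along because a limit step takes both as hypotheses.\<close>

definition coherent_at :: "('i \<Rightarrow> ('a \<Rightarrow> real) \<Rightarrow> real) \<Rightarrow> 'i \<Rightarrow> (('a \<Rightarrow> real) \<Rightarrow> real) \<Rightarrow> bool" where
  "coherent_at f i r \<longleftrightarrow> (one_index \<le> i \<and> i \<le> top_index \<longrightarrow>
     invariant_functional (L i) r \<and>
     (\<forall>j. one_index \<le> j \<and> j \<le> i \<longrightarrow> proper_over (L j) (L i)) \<and>
     (\<forall>j. one_index \<le> j \<and> j < i \<longrightarrow> (\<forall>g\<in>cc (L j). r g = f j g)))"

lemma coherent_at_base: "\<exists>r. coherent_at f one_index r"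
proof -
  obtain m where "invariant_functional (L one_index) m" using haar_functional_quotient by blast
  then have "coherent_at f one_index m" unfolding coherent_at_def using proper_over_subset by auto
  then show ?thesis by blast
qed

text \<open>The layer supplies the extension by fibre means and one more proper map, and earlier
  levels reach the new one by composition. The assumption i < ord_succ i guarantees that
  \<open>ord_succ\<close> is meaningful at i.\<close>

lemma coherent_at_succ:
  assumes i: "one_index \<le> i" "ord_succ i \<le> top_index" "i < ord_succ i" and IH: "coherent_at f i (f i)"
  shows "\<exists>r. coherent_at f (ord_succ i) r"
proof -
  have it: "i < top_index" using i by simp
  have fi: "invariant_functional (L i) (f i)" "\<And>j. one_index \<le> j \<Longrightarrow> j \<le> i \<Longrightarrow> proper_over (L j) (L i)"
    "\<And>j g. one_index \<le> j \<Longrightarrow> j < i \<Longrightarrow> g \<in> cc (L j) \<Longrightarrow> f i g = f j g"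
    using IH i(1) it unfolding coherent_at_def by auto
  interpret layer: compact_layer G T "L i" "L (ord_succ i)"
    by unfold_locales (use it i admissible_L L_succ compact_L joint_L in auto)
  obtain r where r: "invariant_functional (L (ord_succ i)) r" "\<And>g. g \<in> cc (L i) \<Longrightarrow> r g = f i g"
    using layer.functional_extends_layer[OF fi(1)] by blast
  have "proper_over (L j) (L (ord_succ i))" if "one_index \<le> j" "j \<le> ord_succ i" for j
  proof (cases "j = ord_succ i")
    case True
    then show ?thesis using proper_over_subset by simp
  next
    case False
    then have "j \<le> i" using that(2) by (intro less_ord_succ) (simp add: order.not_eq_order_implies_strict)
    then show ?thesis using proper_over_trans[OF fi(2)[OF that(1)] layer.layer_proper] by blast
  qed
  moreover have "r g = f j g" if j: "one_index \<le> j" "j < ord_succ i" and g: "g \<in> cc (L j)" for j g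
  proof (cases "j = i")
    case True
    then show ?thesis using r(2) g by simp
  next
    case False
    then have ji: "j < i" using less_ord_succ[OF j(2)] by simp
    then have "g \<in> cc (L i)" using cc_mono[OF fi(2)[OF j(1)] L_antimono] g it by simp
    then show ?thesis using r(2) fi(3)[OF j(1) ji g] by simp
  qed
  ultimately have "coherent_at f (ord_succ i) r" unfolding coherent_at_def using r(1) by blast
  then show ?thesis by blast
qed

lemma coherent_at_limit:
  assumes i: "one_index < i" "i \<le> top_index" "ord_limit i"
    and IH: "\<And>j. j < i \<Longrightarrow> coherent_at f j (f j)"
  shows "\<exists>r. coherent_at f i r"
proof -
  \<comment> \<open>Index zero is left out because L 0 = G is not assumed to be compact. The
    intersection stays the same, since every omitted term contains L one_index.\<close>
  define I where "I = {j. one_index \<le> j \<and> j < i}"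
  have f: "invariant_functional (L j) (f j)" "\<And>k. one_index \<le> k \<Longrightarrow> k \<le> j \<Longrightarrow> proper_over (L k) (L j)"
    "\<And>k g. one_index \<le> k \<Longrightarrow> k < j \<Longrightarrow> g \<in> cc (L k) \<Longrightarrow> f j g = f k g" if "j \<in> I" for j
    using IH[of j] that i(2) unfolding coherent_at_def I_def by auto
  have I: "one_index \<in> I" using i(1) by (simp add: I_def)
  have Ii: "j \<le> top_index" if "j \<in> I" for j using that i(2) unfolding I_def by (auto intro: order.trans[OF less_imp_le])
  interpret ch: functional_chain G T I L f "L i"
  proof unfold_locales
    show "I \<noteq> {}" using I by blast
    show "admissible (L j)" if "j \<in> I" for j using admissible_L Ii that by blast
    show "admissible (L i)" using admissible_L i(2) by blast
    have "L one_index \<subseteq> L j" if "j \<le> one_index" for j using L_antimono[OF that one_le_top] .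
    then have "(\<Inter>j\<in>I. L j) \<subseteq> L j" if "j < i" for j
      using I that unfolding I_def by (cases "one_index \<le> j") (blast, meson INF_lower I_def linear order_trans I)
    then show "L i = (\<Inter>j\<in>I. L j)" using L_limit[OF i(2,3)] by (auto simp: I_def)
    show "L k \<subseteq> L j" if "j \<in> I" "k \<in> I" "j \<le> k" for j k using L_antimono[OF that(3)] Ii that(2) by blast
    show "compactin T (L j)" if "j \<in> I" for j using compact_L Ii that by (simp add: I_def)
    show "proper_over (L j) (L k)" if "j \<in> I" "k \<in> I" "j \<le> k" for j k
      using f(2)[OF that(2) _ that(3)] that(1) by (simp add: I_def)
    show "invariant_functional (L j) (f j)" if "j \<in> I" for j using f(1) that by blast
    show "f k g = f j g" if "j \<in> I" "k \<in> I" "j \<le> k" "g \<in> cc (L j)" for j k g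
      using f(3)[OF that(2) _ _ that(4)] that by (cases "j = k") (auto simp: I_def)
  qed
  have "proper_over (L j) (L i)" if "one_index \<le> j" "j \<le> i" for j
    using ch.proper_limit[of j] proper_over_subset[of "L i" "L i"] that by (cases "j = i") (auto simp: I_def)
  then have "coherent_at f i ch.m_limit"
    unfolding coherent_at_def using ch.functional_limit ch.m_limit_extends by (simp add: I_def)
  then show ?thesis by blast
qed

text \<open>\<open>coherent_at f i\<close> depends on f only below i, which is the condition for
  recursion with choices along the well-order. The member of the resulting family at the top index
  is the required functional.\<close>

lemma invariant_functional_exists: "\<exists>m. invariant_functional {\<one>} m"
proof -
  have "\<exists>f. \<forall>i. coherent_at f i (f i)"
  proof (rule dependent_wellorder_choice)
    fix r :: "('a \<Rightarrow> real) \<Rightarrow> real" and f g :: "'i \<Rightarrow> ('a \<Rightarrow> real) \<Rightarrow> real" and i :: 'i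
    assume "\<And>j. j < i \<Longrightarrow> f j = g j"
    then show "coherent_at f i r = coherent_at g i r" unfolding coherent_at_def by simp
  next
    fix i :: 'i and f
    assume IH: "\<And>j. j < i \<Longrightarrow> coherent_at f j (f j)"
    show "\<exists>r. coherent_at f i r"
    proof (cases "one_index < i \<and> i \<le> top_index")
      case True
      show ?thesis
      proof (cases "ord_limit i")
        case True
        then show ?thesis using coherent_at_limit IH \<open>one_index < i \<and> i \<le> top_index\<close> by blast
      next
        case False
        moreover have "i \<noteq> ord_zero" using True ord_zero_le[of one_index] by auto
        ultimately obtain k where k: "k < i" "ord_succ k = i" unfolding ord_limit_def by blast
        have "one_index \<le> k" using less_ord_succ True k(2) by blast
        then show ?thesis using coherent_at_succ[of k f] k True IH by auto
      qed
    next
      case False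
      show ?thesis
      proof (cases "i = one_index")
        case True
        then show ?thesis using coherent_at_base by simp
      next
        case False
        then show ?thesis using \<open>\<not> (one_index < i \<and> i \<le> top_index)\<close> unfolding coherent_at_def by auto
      qed
    qed
  qed
  then obtain f where "coherent_at f top_index (f top_index)" by blast
  then have "invariant_functional (L top_index) (f top_index)" unfolding coherent_at_def using one_le_top by blast
  then show ?thesis using L_top by auto
qed

end

theorem theorem2p6:
  fixes G :: "('a, 'm) monoid_scheme" and T :: "'a topology"
    and \<xi>\<^sub>0 :: "'i::wellorder" and L :: "'i \<Rightarrow> 'a set"
  assumes "right_topological_group G T"
    and "locally_compact_space T" and "Hausdorff_space T"
    and "compact_strong_normal_system G T \<xi>\<^sub>0 L"
  shows "\<exists>\<mu>. right_haar_measure G T \<mu>"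
proof -
  interpret group G using assms(1) by (simp add: right_topological_group_def)
  interpret normal_system G T \<xi>\<^sub>0 L
    by unfold_locales (use assms in \<open>auto simp: right_topological_group_def\<close>)
  obtain m where m: "invariant_functional {\<one>\<^bsub>G\<^esub>} m" using invariant_functional_exists by blast
  \<comment> \<open>The trivial subgroup is admissible as the last term of the system, and its cone
    is the whole nonnegative part of C_c(G).\<close>
  interpret radon_functional G T m
    by unfold_locales (use m admissible_L[of \<xi>\<^sub>0] L_top in auto)
  show ?thesis using right_haar_measure_haar by blast
qed

end
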